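(* Let $V$ be a vertex operator superalgebra, let $k$ be an odd positive integer, let $g=(1\;2\;\cdots\;k)$ act on $V^{\otimes k}$, and let $(M_g,Y_g)$ be a weak $g$-twisted $V^{\otimes k}$-module. For $u\in V$ set $$Y_M(u,x)=Y_g\big((\Delta_k(x^k)^{-1}u)^1,x^k\big)\in(\mathrm{End}\,M_g)[[x,x^{-1}]],$$ where one takes $(x^k)^{1/k}=x$. Then $U_g^k(M_g,Y_g)=(M_g,Y_M)$ is a weak $V$-module.
   Context: Conventions: $\delta(x)=\sum_{n\in\mathbb{Z}}x^n$; expressions $(x_1-x_2)^n$, $n\in\mathbb{C}$, are expanded in nonnegative integral powers of the second variable. Vertex operator superalgebra $(V,Y,\mathbf 1,\omega)$: a $\mathbb{Z}_2$-graded vector space $V=V^{(0)}\oplus V^{(1)}$ over $\mathbb{C}$ ($|v|=j$ for $v\in V^{(j)}$) with a linear map $v\mapsto Y(v,x)=\sum_{n\in\mathbb{Z}}v_nx^{-n-1}\in(\mathrm{End}\,V)[[x,x^{-1}]]$, $v_n\in(\mathrm{End}\,V)^{(|v|)}$, and $\mathbf 1\in V^{(0)}$, such that $u_nv=0$ for $n$ large; $Y(\mathbf 1,x)=\mathrm{Id}_V$; $Y(v,x)\mathbf 1\in V[[x]]$ with constant term $v$; the Jacobi identity $x_0^{-1}\delta(\frac{x_1-x_2}{x_0})Y(u,x_1)Y(v,x_2)-(-1)^{|u||v|}x_0^{-1}\delta(\frac{x_2-x_1}{-x_0})Y(v,x_2)Y(u,x_1)=x_2^{-1}\delta(\frac{x_1-x_0}{x_2})Y(Y(u,x_0)v,x_2)$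 for $u,v$ of homogeneous sign; and $\omega\in V_2$ whose modes $L(n)=\omega_{n+1}$ satisfy the Virasoro relations with central charge $c\in\mathbb{C}$, $\frac{d}{dx}Y(v,x)=Y(L(-1)v,x)$, $V=\coprod_{n\in\frac12\mathbb{Z}}V_n$ with $L(0)v=nv=(\mathrm{wt}\,v)v$ for $v\in V_n$, $\dim V_n<\infty$, $V_n=0$ for $n$ sufficiently negative, and $V^{(j)}=\coprod_{n\in\mathbb{Z}+j/2}V_n$. Twisted modules: let $g$ be an automorphism of a vertex operator superalgebra $V$ with $g^k=1$, and let $\eta$ be a fixed primitive $k$-th root of unity. A weak $g$-twisted $V$-module is a $\mathbb{Z}_2$-graded space $M$ with a linear map $v\mapsto Y_g(v,x)=\sum_{n\in\frac1k\mathbb{Z}}v^g_nx^{-n-1}\in(\mathrm{End}\,M)[[x^{1/k},x^{-1/k}]]$, $v^g_n\in(\mathrm{End}\,M)^{(|v|)}$, such that $v^g_nw=0$ for $n$ large, $Y_g(\mathbf 1,x)=1$, and for $u,v$ of homogeneous sign $x_0^{-1}\delta(\frac{x_1-x_2}{x_0})Y_g(u,x_1)Y_g(v,x_2)-(-1)^{|u||v|}x_0^{-1}\delta(\frac{x_2-x_1}{-x_0})Y_g(v,x_2)Y_g(u,x_1)=\frac{x_2^{-1}}{k}\sum_{j\in\mathbb{Z}/k\mathbb{Z}}\delta\big(\eta^j\frac{(x_1-x_0)^{1/k}}{x_2^{1/k}}\big)Y_g(Y(g^ju,x_0)v,x_2)$. A weak $V$-module is the case $g=1$, $k=1$. Tensor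 products: $V^{\otimes k}$ is a vertex operator superalgebra via $(Y\otimes Y')(u\otimes u',x)(v\otimes v')=(-1)^{|u'||v|}Y(u,x)v\otimes Y'(u',x)v'$ (iterated), with conformal vector $\sum_j\omega^j$, where for $v\in V$, $v^j\in V^{\otimes k}$ has $j$-th tensor factor $v$ and all other factors $\mathbf 1$. The $k$-cycle acts by $g(v_1\otimes\cdots\otimes v_k)=(-1)^{|v_1|(|v_2|+\cdots+|v_k|)}v_2\otimes\cdots\otimes v_k\otimes v_1$, so $gv^j=v^{j-1}$ (indices mod $k$). The operator $\Delta_k$: let $a_j\in\mathbb{C}$, $j\ge1$, be the unique numbers with $\exp\big(-\sum_{j\ge1}a_jx^{j+1}\frac{\partial}{\partial x}\big)\cdot x=\frac1k(1+x)^k-\frac1k$. Fix a square root $k^{1/2}$. On $V$, $\Delta_k(x)=\exp\big(\sum_{j\ge1}a_jx^{-j/k}L(j)\big)(k^{1/2})^{-2L(0)}(x^{1/2k})^{(1-k)2L(0)}$, where $(t^{1/2})^{n2L(0)}v=t^{np}v$ for $v\in V_p$; hence $\Delta_k(x)^{-1}=(x^{1/2k})^{-(1-k)2L(0)}(k^{1/2})^{2L(0)}\exp\big(-\sum_{j\ge1}a_jx^{-j/k}L(j)\big)$. The map $u\mapsto u^1$ is extended linearly to coefficients of formal series. *)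

theory Defs
  imports
    "HOL-Analysis.Analysis"
    "HOL-Computational_Algebra.Formal_Power_Series"
    "HOL-Library.Poly_Mapping"
    "HOL-Library.Groups_Big_Fun"
    "HOL-Library.Z2"
begin

text \<open>
  Conventions. A formal series is represented by the function giving its coefficients. All sums
  written with \<^const>\<open>Sum_any\<close> range over an infinite index set but have only finitely many
  nonzero terms in the situations in which they are used, because modes of large index annihilate
  a given vector.
\<close>

section \<open>Complex vector spaces\<close>

class complex_vector = ab_group_add +
  fixes scaleC :: "complex \<Rightarrow> 'a \<Rightarrow> 'a"  (infixr \<open>*\<^sub>C\<close> 75)
  assumes scaleC_add_right: "c *\<^sub>C (x + y) = c *\<^sub>C x + c *\<^sub>C y"
    and scaleC_add_left: "(c + d) *\<^sub>C x = c *\<^sub>C x + d *\<^sub>C x"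
    and scaleC_scaleC: "c *\<^sub>C (d *\<^sub>C x) = (c * d) *\<^sub>C x"
    and scaleC_one: "1 *\<^sub>C x = x"

global_interpretation complex_vector:
  vector_space "scaleC :: complex \<Rightarrow> 'a \<Rightarrow> 'a::complex_vector"
  by unfold_locales (simp_all add: scaleC_add_right scaleC_add_left scaleC_scaleC scaleC_one)

abbreviation csubspace :: "'a::complex_vector set \<Rightarrow> bool"
  where "csubspace \<equiv> module.subspace scaleC"

abbreviation cspan :: "'a::complex_vector set \<Rightarrow> 'a set"
  where "cspan \<equiv> module.span scaleC"

abbreviation clinear :: "('a::complex_vector \<Rightarrow> 'b::complex_vector) \<Rightarrow> bool"
  where "clinear \<equiv> Vector_Spaces.linear scaleC scaleC"

lemma clinear_add: "clinear f \<Longrightarrow> f (x + y) = f x + f y"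
  by (simp add: linear_iff_module_hom module_hom.add)

lemma clinear_scale: "clinear f \<Longrightarrow> f (c *\<^sub>C x) = c *\<^sub>C f x"
  by (simp add: linear_iff_module_hom module_hom.scale)

instantiation complex :: complex_vector
begin

definition scaleC_complex :: "complex \<Rightarrow> complex \<Rightarrow> complex"
  where "scaleC_complex = (*)"

instance
  by standard (simp_all add: scaleC_complex_def algebra_simps)

end

instantiation poly_mapping :: (type, complex_vector) complex_vector
begin

definition scaleC_poly_mapping :: "complex \<Rightarrow> ('a \<Rightarrow>\<^sub>0 'b) \<Rightarrow> 'a \<Rightarrow>\<^sub>0 'b"
  where "scaleC_poly_mapping c = Poly_Mapping.map (scaleC c)"

lemma lookup_scaleC [simp]:
  "Poly_Mapping.lookup (c *\<^sub>C f) x = c *\<^sub>C Poly_Mapping.lookup f x"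
  by (simp add: scaleC_poly_mapping_def Poly_Mapping.map.rep_eq when_def)

instance
  by standard (rule poly_mapping_eqI;
      simp add: lookup_add scaleC_add_right scaleC_add_left scaleC_scaleC scaleC_one)+

end

text \<open>The coordinates of \<open>v\<close> with respect to a family \<open>A\<close> of subspaces.\<close>

definition is_decomposition :: "('i \<Rightarrow> 'a::complex_vector set) \<Rightarrow> 'a \<Rightarrow> ('i \<Rightarrow> 'a) \<Rightarrow> bool"
  where "is_decomposition A v f \<longleftrightarrow>
    (\<forall>i. f i \<in> A i) \<and> finite {i. f i \<noteq> 0} \<and> Sum_any f = v"

definition direct_sum :: "('i \<Rightarrow> 'a::complex_vector set) \<Rightarrow> bool"
  where "direct_sum A \<longleftrightarrow> (\<forall>i. csubspace (A i)) \<and> (\<forall>v. \<exists>!f. is_decomposition A v f)"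

definition component :: "('i \<Rightarrow> 'a::complex_vector set) \<Rightarrow> 'i \<Rightarrow> 'a \<Rightarrow> 'a"
  where "component A i v = (THE f. is_decomposition A v f) i"


section \<open>Twisted and untwisted vertex operators\<close>

definition ksign :: "bit \<Rightarrow> complex"
  where "ksign p = (if p = 0 then 1 else - 1)"

text \<open>The coefficient of \<open>x\<^sub>1\<^bsup>s-i\<^esup> x\<^sub>2\<^bsup>i\<^esup>\<close> in the expansion of \<open>(x\<^sub>1 - x\<^sub>2)\<^bsup>s\<^esup>\<close> in nonnegative integral
  powers of \<open>x\<^sub>2\<close>.\<close>

definition binexp :: "complex \<Rightarrow> nat \<Rightarrow> complex"
  where "binexp s i = (- 1) ^ i * (s gchoose i)"

text \<open>
  A \<open>g\<close>-twisted vertex operator is encoded by \<open>Yg v N w\<close>, standing for \<open>v\<^bsup>g\<^esup>\<^bsub>N/k\<^esub> w\<close>: the index of a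
  mode is multiplied by \<open>k\<close>, so that
    \<open>Y\<^sub>g(v,x) w = \<Sum>\<^bsub>N \<in> \<int>\<^esub> (Yg v N w) x\<^bsup>-N/k-1\<^esup>\<close>.
  For \<open>k = 1\<close> (in particular for \<open>Y v n w\<close> in the algebra itself) these are the usual modes \<open>v\<^sub>n w\<close>.

  The next three functions give the coefficient of
    \<open>x\<^sub>0\<^bsup>-l-1\<^esup> x\<^sub>1\<^bsup>-m/k-1\<^esup> x\<^sub>2\<^bsup>-n/k-1\<^esup>\<close>
  in the three terms of the twisted Jacobi identity applied to a vector \<open>w\<close>.

  In the first term \<open>x\<^sub>0\<^bsup>-1\<^esup> \<delta>((x\<^sub>1-x\<^sub>2)/x\<^sub>0) Y\<^sub>g(u,x\<^sub>1) Y\<^sub>g(v,x\<^sub>2)\<close>, the power of \<open>x\<^sub>0\<close> selects the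
  summand \<open>(x\<^sub>1-x\<^sub>2)\<^bsup>l\<^esup> x\<^sub>0\<^bsup>-l-1\<^esup>\<close> of the delta function, and \<open>x\<^sub>1\<^bsup>l-i\<^esup> x\<^sub>2\<^bsup>i\<^esup>\<close> is to be multiplied by
  \<open>x\<^sub>1\<^bsup>-(m/k+l-i)-1\<^esup> x\<^sub>2\<^bsup>-(n/k+i)-1\<^esup>\<close>.
\<close>

definition jacobi_term1 ::
  "nat \<Rightarrow> ('a \<Rightarrow> int \<Rightarrow> 'm \<Rightarrow> 'm) \<Rightarrow> 'a \<Rightarrow> 'a \<Rightarrow> int \<Rightarrow> int \<Rightarrow> int \<Rightarrow> 'm \<Rightarrow> 'm::complex_vector"
  where "jacobi_term1 k Yg u v l m n w =
    Sum_any (\<lambda>i::nat. binexp (of_int l) i *\<^sub>C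
      Yg u (m + int k * (l - int i)) (Yg v (n + int k * int i) w))"

text \<open>
  The second term is \<open>x\<^sub>0\<^bsup>-1\<^esup> \<delta>((x\<^sub>2-x\<^sub>1)/(-x\<^sub>0)) Y\<^sub>g(v,x\<^sub>2) Y\<^sub>g(u,x\<^sub>1)\<close>, without the sign
  \<open>(-1)\<^bsup>|u||v|\<^esup>\<close>. Here the summand \<open>(x\<^sub>2-x\<^sub>1)\<^bsup>l\<^esup> (-x\<^sub>0)\<^bsup>-l\<^esup> x\<^sub>0\<^bsup>-1\<^esup>\<close> is selected.
\<close>

definition jacobi_term2 ::
  "nat \<Rightarrow> ('a \<Rightarrow> int \<Rightarrow> 'm \<Rightarrow> 'm) \<Rightarrow> 'a \<Rightarrow> 'a \<Rightarrow> int \<Rightarrow> int \<Rightarrow> int \<Rightarrow> 'm \<Rightarrow> 'm::complex_vector"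
  where "jacobi_term2 k Yg u v l m n w =
    (- 1) powi l *\<^sub>C Sum_any (\<lambda>i::nat. binexp (of_int l) i *\<^sub>C
      Yg v (n + int k * (l - int i)) (Yg u (m + int k * int i) w))"

text \<open>
  The third term is
  \<open>x\<^sub>2\<^bsup>-1\<^esup> k\<^bsup>-1\<^esup> \<Sum>\<^bsub>j mod k\<^esub> \<delta>(\<eta>\<^bsup>j\<^esup> (x\<^sub>1-x\<^sub>0)\<^bsup>1/k\<^esup> / x\<^sub>2\<^bsup>1/k\<^esup>) Y\<^sub>g(Y(g\<^bsup>j\<^esup>u,x\<^sub>0)v,x\<^sub>2)\<close>.
  The summand of index \<open>t\<close> of the delta function is \<open>\<eta>\<^bsup>jt\<^esup> (x\<^sub>1-x\<^sub>0)\<^bsup>t/k\<^esup> x\<^sub>2\<^bsup>-t/k\<^esup>\<close>; its part of degree \<open>i\<close>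
  in \<open>x\<^sub>0\<close> involves \<open>x\<^sub>1\<^bsup>t/k-i\<^esup>\<close>, so \<open>t = ki - m - k\<close>. The remaining powers of \<open>x\<^sub>0\<close> and \<open>x\<^sub>2\<close> select
  the mode \<open>l + i\<close> in \<open>Y\<close> and the mode \<open>(m + n)/k - i\<close> in \<open>Y\<^sub>g\<close>.
\<close>

definition jacobi_term3 ::
  "('a \<Rightarrow> int \<Rightarrow> 'a \<Rightarrow> 'a) \<Rightarrow> nat \<Rightarrow> ('a \<Rightarrow> 'a) \<Rightarrow> complex \<Rightarrow> ('a \<Rightarrow> int \<Rightarrow> 'm \<Rightarrow> 'm)
    \<Rightarrow> 'a \<Rightarrow> 'a \<Rightarrow> int \<Rightarrow> int \<Rightarrow> int \<Rightarrow> 'm \<Rightarrow> 'm::complex_vector"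
  where "jacobi_term3 Y k g \<eta> Yg u v l m n w =
    (1 / of_nat k) *\<^sub>C (\<Sum>j<k. Sum_any (\<lambda>i::nat.
      let t = int k * int i - m - int k in
        (\<eta> powi (int j * t) * binexp (of_int t / of_nat k) i) *\<^sub>C
          Yg (Y ((g ^^ j) u) (l + int i) v) (m + n - int k * int i) w))"

definition jacobi_identity ::
  "(bit \<Rightarrow> 'a set) \<Rightarrow> ('a \<Rightarrow> int \<Rightarrow> 'a \<Rightarrow> 'a) \<Rightarrow> nat \<Rightarrow> ('a \<Rightarrow> 'a) \<Rightarrow> complex
    \<Rightarrow> ('a \<Rightarrow> int \<Rightarrow> 'm \<Rightarrow> 'm::complex_vector) \<Rightarrow> bool"
  where "jacobi_identity par Y k g \<eta> Yg \<longleftrightarrow>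
    (\<forall>p q. \<forall>u \<in> par p. \<forall>v \<in> par q. \<forall>l m n w.
      jacobi_term1 k Yg u v l m n w - ksign (p * q) *\<^sub>C jacobi_term2 k Yg u v l m n w
        = jacobi_term3 Y k g \<eta> Yg u v l m n w)"


section \<open>Vertex operator superalgebras\<close>

text \<open>
  \<open>par V p\<close> is the subspace \<open>V\<^bsup>(p)\<^esup>\<close> of sign \<open>p\<close>, and \<open>mode V v n\<close> is \<open>v\<^sub>n\<close>. Weights are doubled:
  \<open>wsp V m\<close> is the weight space \<open>V\<^bsub>m/2\<^esub>\<close>.
\<close>

record 'a vosa_data =
  par :: "bit \<Rightarrow> 'a set"
  wsp :: "int \<Rightarrow> 'a set"
  mode :: "'a \<Rightarrow> int \<Rightarrow> 'a \<Rightarrow> 'a"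
  vac :: 'a
  conf :: 'a

definition vir :: "'a vosa_data \<Rightarrow> int \<Rightarrow> 'a \<Rightarrow> 'a"
  where "vir V n = mode V (conf V) (n + 1)"

locale vertex_operator_superalgebra =
  fixes V :: "'a::complex_vector vosa_data" and c :: complex
  assumes superspace: "direct_sum (par V)"
    and linear_left: "\<And>n v. clinear (\<lambda>u. mode V u n v)"
    and linear_right: "\<And>u n. clinear (mode V u n)"
    and parity: "\<And>p q u v n. u \<in> par V p \<Longrightarrow> v \<in> par V q \<Longrightarrow> mode V u n v \<in> par V (p + q)"
    and vac_even: "vac V \<in> par V 0"
    and truncation: "\<And>u v. \<exists>N. \<forall>n\<ge>N. mode V u n v = 0"
    and vacuum: "\<And>n v. mode V (vac V) n v = (if n = - 1 then v else 0)"
    and creation: "\<And>v n. n \<ge> 0 \<Longrightarrow> mode V v n (vac V) = 0" "\<And>v. mode V v (- 1) (vac V) = v"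
    and jacobi: "jacobi_identity (par V) (mode V) 1 (\<lambda>v. v) 1 (mode V)"
    and conf_weight: "conf V \<in> wsp V 4"
    and virasoro: "\<And>m n v. vir V m (vir V n v) - vir V n (vir V m v)
      = of_int (m - n) *\<^sub>C vir V (m + n) v
        + (if m + n = 0 then (of_int (m ^ 3 - m) / 12 * c) *\<^sub>C v else 0)"
    and derivative: "\<And>u n v. mode V (vir V (- 1) u) n v = - of_int n *\<^sub>C mode V u (n - 1) v"
    and grading: "direct_sum (wsp V)"
    and weight: "\<And>m v. v \<in> wsp V m \<Longrightarrow> vir V 0 v = (of_int m / 2) *\<^sub>C v"
    and finite_dim: "\<And>m. \<exists>B. finite B \<and> wsp V m = cspan B"
    and bounded_below: "\<exists>N. \<forall>m<N. wsp V m = {0}"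
    and even_part: "par V 0 = cspan (\<Union>m \<in> {m. even m}. wsp V m)"
    and odd_part: "par V 1 = cspan (\<Union>m \<in> {m. odd m}. wsp V m)"


section \<open>Weak twisted modules\<close>

definition primitive_root :: "complex \<Rightarrow> nat \<Rightarrow> bool"
  where "primitive_root \<eta> k \<longleftrightarrow> k > 0 \<and> \<eta> ^ k = 1 \<and> (\<forall>j. 0 < j \<and> j < k \<longrightarrow> \<eta> ^ j \<noteq> 1)"

text \<open>
  Here \<open>g\<close> is meant to be an automorphism of the vertex operator superalgebra \<open>V\<close> with \<open>g\<^bsup>k\<^esup> = 1\<close>
  and \<open>\<eta>\<close> a primitive \<open>k\<close>-th root of unity; \<open>M\<close> gives the \<open>\<int>\<^sub>2\<close>-grading of the module.
\<close>

locale weak_twisted_module =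
  fixes V :: "'a::complex_vector vosa_data" and k :: nat and g :: "'a \<Rightarrow> 'a" and \<eta> :: complex
    and M :: "bit \<Rightarrow> 'm::complex_vector set" and Yg :: "'a \<Rightarrow> int \<Rightarrow> 'm \<Rightarrow> 'm"
  assumes superspace: "direct_sum M"
    and linear_left: "\<And>N w. clinear (\<lambda>v. Yg v N w)"
    and linear_right: "\<And>v N. clinear (Yg v N)"
    and parity: "\<And>p q v w N. v \<in> par V p \<Longrightarrow> w \<in> M q \<Longrightarrow> Yg v N w \<in> M (p + q)"
    and truncation: "\<And>v w. \<exists>K. \<forall>N\<ge>K. Yg v N w = 0"
    and vacuum: "\<And>N w. Yg (vac V) N w = (if N = - int k then w else 0)"
    and jacobi: "jacobi_identity (par V) (mode V) k g \<eta> Yg"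

definition weak_module ::
  "'a::complex_vector vosa_data \<Rightarrow> (bit \<Rightarrow> 'm::complex_vector set) \<Rightarrow> ('a \<Rightarrow> int \<Rightarrow> 'm \<Rightarrow> 'm) \<Rightarrow> bool"
  where "weak_module V M Y \<longleftrightarrow> weak_twisted_module V 1 (\<lambda>v. v) 1 M Y"


section \<open>Tensor powers\<close>

text \<open>
  The type \<open>('a, 'k) tensor_power\<close> is the tensor power of \<open>'a\<close> with exponent \<open>CARD('k)\<close>: the vector
  space freely generated by the lists over \<open>'a\<close> modulo the multilinearity relations, where lists of
  the wrong length are identified with \<open>0\<close>.
\<close>

definition tensor_rels :: "nat \<Rightarrow> ('a::complex_vector list \<Rightarrow>\<^sub>0 complex) set"
  where "tensor_rels k =
    {Poly_Mapping.single (xs @ (a + b) # ys) 1 - Poly_Mapping.single (xs @ a # ys) 1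
       - Poly_Mapping.single (xs @ b # ys) 1 | xs ys a b. length xs + length ys + 1 = k}
    \<union> {Poly_Mapping.single (xs @ (c *\<^sub>C a) # ys) 1 - c *\<^sub>C Poly_Mapping.single (xs @ a # ys) 1
       | xs ys a c. length xs + length ys + 1 = k}
    \<union> {Poly_Mapping.single xs 1 | xs. length xs \<noteq> k}"

definition tensor_eq ::
  "'k itself \<Rightarrow> ('a::complex_vector list \<Rightarrow>\<^sub>0 complex) \<Rightarrow> ('a list \<Rightarrow>\<^sub>0 complex) \<Rightarrow> bool"
  where "tensor_eq _ f h \<longleftrightarrow> f - h \<in> cspan (tensor_rels CARD('k))"

lemma tensor_eq_equivp: "equivp (tensor_eq TYPE('k))"
proof (rule equivpI)
  show "reflp (tensor_eq TYPE('k))"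
    by (simp add: reflp_def tensor_eq_def complex_vector.span_zero)
  show "symp (tensor_eq TYPE('k))"
    unfolding symp_def tensor_eq_def using complex_vector.span_neg by fastforce
  show "transp (tensor_eq TYPE('k))"
    unfolding transp_def tensor_eq_def using complex_vector.span_add by fastforce
qed

quotient_type (overloaded) ('a, 'k) tensor_power =
  "'a::complex_vector list \<Rightarrow>\<^sub>0 complex" / "tensor_eq TYPE('k)"
  by (rule tensor_eq_equivp)

instantiation tensor_power :: (complex_vector, type) complex_vector
begin

lift_definition zero_tensor_power :: "('a, 'b) tensor_power" is 0 .

lift_definition plus_tensor_power ::
  "('a, 'b) tensor_power \<Rightarrow> ('a, 'b) tensor_power \<Rightarrow> ('a, 'b) tensor_power" is "(+)"
  unfolding tensor_eq_def by (subst add_diff_add) (rule complex_vector.span_add)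

lift_definition minus_tensor_power ::
  "('a, 'b) tensor_power \<Rightarrow> ('a, 'b) tensor_power \<Rightarrow> ('a, 'b) tensor_power" is "(-)"
proof -
  fix f f' h h' :: "'a list \<Rightarrow>\<^sub>0 complex"
  assume "tensor_eq TYPE('b) f f'" "tensor_eq TYPE('b) h h'"
  moreover have "(f - h) - (f' - h') = (f - f') - (h - h')"
    by simp
  ultimately show "tensor_eq TYPE('b) (f - h) (f' - h')"
    unfolding tensor_eq_def by (simp only: complex_vector.span_diff)
qed

lift_definition uminus_tensor_power :: "('a, 'b) tensor_power \<Rightarrow> ('a, 'b) tensor_power" is uminus
  unfolding tensor_eq_def by (subst minus_diff_minus) (rule complex_vector.span_neg)

lift_definition scaleC_tensor_power :: "complex \<Rightarrow> ('a, 'b) tensor_power \<Rightarrow> ('a, 'b) tensor_power"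
  is scaleC
  unfolding tensor_eq_def
  by (subst complex_vector.scale_right_diff_distrib[symmetric]) (rule complex_vector.span_scale)

instance
  by standard (transfer; simp add: tensor_eq_def complex_vector.span_zero algebra_simps
      scaleC_add_right scaleC_add_left scaleC_scaleC scaleC_one)+

end

text \<open>\<open>tens [v\<^sub>1, \<dots>, v\<^sub>k]\<close> is \<open>v\<^sub>1 \<otimes> \<dots> \<otimes> v\<^sub>k\<close>.\<close>

lift_definition tens :: "'a::complex_vector list \<Rightarrow> ('a, 'k) tensor_power"
  is "\<lambda>xs. Poly_Mapping.single xs 1" .

text \<open>The linear extension to the tensor power of a multilinear map \<open>F\<close>.\<close>

definition tensor_extend ::
  "('a::complex_vector list \<Rightarrow> 'b::complex_vector) \<Rightarrow> ('a, 'k) tensor_power \<Rightarrow> 'b"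
  where "tensor_extend F t =
    (let f = rep_tensor_power t in
      \<Sum>xs \<in> {xs \<in> Poly_Mapping.keys f. length xs = CARD('k)}. Poly_Mapping.lookup f xs *\<^sub>C F xs)"

definition multilinear :: "nat \<Rightarrow> ('a::complex_vector list \<Rightarrow> 'b::complex_vector) \<Rightarrow> bool"
  where "multilinear k F \<longleftrightarrow>
    (\<forall>xs ys. length xs + length ys + 1 = k \<longrightarrow> clinear (\<lambda>a. F (xs @ a # ys)))"

lemma tensor_extend_tens:
  fixes F :: "'a::complex_vector list \<Rightarrow> 'b::complex_vector"
  assumes F: "multilinear CARD('k) F" and us: "length us = CARD('k)"
  shows "tensor_extend F (tens us :: ('a, 'k) tensor_power) = F us"
proof -
  define G :: "('a list \<Rightarrow>\<^sub>0 complex) \<Rightarrow> 'b" where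
    "G f = (\<Sum>xs \<in> {xs \<in> Poly_Mapping.keys f. length xs = CARD('k)}. Poly_Mapping.lookup f xs *\<^sub>C F xs)"
    for f
  have G_sup: "G f = (\<Sum>xs \<in> {xs \<in> S. length xs = CARD('k)}. Poly_Mapping.lookup f xs *\<^sub>C F xs)"
    if "finite S" "Poly_Mapping.keys f \<subseteq> S" for f S
    unfolding G_def using that
    by (intro sum.mono_neutral_left) (auto simp: in_keys_iff)
  have G_diff: "G (f - h) = G f - G h" for f h
  proof -
    let ?S = "Poly_Mapping.keys f \<union> Poly_Mapping.keys h"
    have "finite ?S" "Poly_Mapping.keys (f - h) \<subseteq> ?S"
      by (auto simp: in_keys_iff lookup_minus)
    then show ?thesis
      by (simp add: G_sup[of ?S] lookup_minus complex_vector.scale_left_diff_distrib sum_subtractf)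
  qed
  have G_scale: "G (c *\<^sub>C f) = c *\<^sub>C G f" for c f
  proof -
    have "Poly_Mapping.keys (c *\<^sub>C f) \<subseteq> Poly_Mapping.keys f"
      by (auto simp: in_keys_iff scaleC_complex_def)
    then show ?thesis
      by (simp add: G_sup[of "Poly_Mapping.keys f"] complex_vector.scale_sum_right scaleC_complex_def)
  qed
  have G_zero: "G 0 = 0"
    by (simp add: G_def)
  have G_add: "G (f + h) = G f + G h" for f h
    using G_diff[of f "- h"] G_diff[of 0 h] by (simp add: G_zero)
  have G_single: "G (Poly_Mapping.single xs c) = (if length xs = CARD('k) then c *\<^sub>C F xs else 0)" for xs c
  proof -
    have "{ys \<in> {xs}. length ys = CARD('k)} = (if length xs = CARD('k) then {xs} else {})"
      by auto
    then show ?thesis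
      by (simp add: G_sup[of "{xs}"] split: if_splits)
  qed
  have "G r = 0" if "r \<in> tensor_rels CARD('k)" for r
  proof -
    have lin: "clinear (\<lambda>a. F (xs @ a # ys))" if "length xs + length ys + 1 = CARD('k)" for xs ys
      using F that unfolding multilinear_def by blast
    show ?thesis
      using that unfolding tensor_rels_def
      by (auto simp: G_diff G_scale G_single scaleC_one scaleC_complex_def
        clinear_add[OF lin] clinear_scale[OF lin])
  qed
  note G_rel = this
  have G_span: "G r = 0" if "r \<in> cspan (tensor_rels CARD('k))" for r
    by (rule complex_vector.span_induct_alt[OF that]) (simp_all add: G_zero G_add G_scale G_rel)
  have "tensor_eq TYPE('k) (rep_tensor_power (tens us :: ('a, 'k) tensor_power)) (Poly_Mapping.single us 1)"
    by (metis (no_types) Quotient3_tensor_power Quotient3_rep_abs tens.abs_eq tensor_eq_equivp equivp_reflp)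
  then have "G (rep_tensor_power (tens us :: ('a, 'k) tensor_power)) = G (Poly_Mapping.single us 1)"
    using G_span G_diff unfolding tensor_eq_def by fastforce
  also have "\<dots> = F us"
    using us by (simp add: G_single scaleC_one)
  finally show ?thesis
    by (simp add: tensor_extend_def G_def Let_def)
qed


subsection \<open>The vertex operator superalgebra structure\<close>

definition bit_lists :: "nat \<Rightarrow> bit list set"
  where "bit_lists k = {ps. length ps = k}"

definition homogeneous_parts :: "'a::complex_vector vosa_data \<Rightarrow> bit list \<Rightarrow> 'a list \<Rightarrow> 'a list"
  where "homogeneous_parts V ps us = map2 (component (par V)) ps us"

text \<open>
  The coefficient of \<open>x\<^bsup>-n-1\<^esup>\<close> in \<open>Y(u\<^sub>1,x)v\<^sub>1 \<otimes> \<dots> \<otimes> Y(u\<^sub>k,x)v\<^sub>k\<close>.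
\<close>

definition product_mode ::
  "'a::complex_vector vosa_data \<Rightarrow> int \<Rightarrow> 'a list \<Rightarrow> 'a list \<Rightarrow> ('a, 'k) tensor_power"
  where "product_mode V n us vs =
    Sum_any (\<lambda>ns::int list.
      if length ns = CARD('k) \<and> (\<Sum>n'\<leftarrow>ns. - n' - 1) = - n - 1
      then tens (map (\<lambda>i. mode V (us ! i) (ns ! i) (vs ! i)) [0..<CARD('k)])
      else 0)"

text \<open>
  Iterating \<open>(Y \<otimes> Y')(u \<otimes> u',x)(v \<otimes> v') = (-1)\<^bsup>|u'||v|\<^esup> Y(u,x)v \<otimes> Y'(u',x)v'\<close> gives the sign
  \<open>(-1)\<^bsup>|u\<^sub>i||v\<^sub>j|\<^esup>\<close> for every pair \<open>j < i\<close>. Arbitrary tensor factors are first split into their even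
  and odd parts, \<open>ps\<close> and \<open>qs\<close> being the lists of their parities.
\<close>

definition tensor_mode ::
  "'a::complex_vector vosa_data \<Rightarrow> ('a, 'k) tensor_power \<Rightarrow> int \<Rightarrow> ('a, 'k) tensor_power
    \<Rightarrow> ('a, 'k) tensor_power"
  where "tensor_mode V s n t =
    tensor_extend (\<lambda>us. tensor_extend (\<lambda>vs.
      \<Sum>ps \<in> bit_lists CARD('k). \<Sum>qs \<in> bit_lists CARD('k).
        ksign (\<Sum>i<CARD('k). \<Sum>j<i. ps ! i * qs ! j) *\<^sub>C
          product_mode V n (homogeneous_parts V ps us) (homogeneous_parts V qs vs)) t) s"

text \<open>
  \<open>tensor_slot V j v\<close> has \<open>v\<close> as one factor and the vacuum as all others. Positions are counted from
  \<open>0\<close>, so this is \<open>v\<^bsup>j+1\<^esup>\<close>.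
\<close>

definition tensor_slot :: "'a::complex_vector vosa_data \<Rightarrow> nat \<Rightarrow> 'a \<Rightarrow> ('a, 'k) tensor_power"
  where "tensor_slot V j v = tens ((replicate CARD('k) (vac V))[j := v])"

definition tensor_vosa :: "'a::complex_vector vosa_data \<Rightarrow> ('a, 'k) tensor_power vosa_data"
  where "tensor_vosa V =
    \<lparr> par = (\<lambda>p. cspan {tens us | us ps. length us = CARD('k) \<and> length ps = CARD('k)
                  \<and> (\<forall>i<CARD('k). us ! i \<in> par V (ps ! i)) \<and> sum_list ps = p}),
      wsp = (\<lambda>m. cspan {tens us | us ms. length us = CARD('k) \<and> length ms = CARD('k)
                  \<and> (\<forall>i<CARD('k). us ! i \<in> wsp V (ms ! i)) \<and> sum_list ms = m}),
      mode = tensor_mode V,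
      vac = tens (replicate CARD('k) (vac V)),
      conf = (\<Sum>j<CARD('k). tensor_slot V j (conf V)) \<rparr>"

text \<open>
  The cycle \<open>v\<^sub>1 \<otimes> \<dots> \<otimes> v\<^sub>k \<mapsto> (-1)\<^bsup>|v\<^sub>1|(|v\<^sub>2|+\<dots>+|v\<^sub>k|)\<^esup> v\<^sub>2 \<otimes> \<dots> \<otimes> v\<^sub>k \<otimes> v\<^sub>1\<close>.
\<close>

definition tensor_cycle ::
  "'a::complex_vector vosa_data \<Rightarrow> ('a, 'k) tensor_power \<Rightarrow> ('a, 'k) tensor_power"
  where "tensor_cycle V = tensor_extend (\<lambda>vs.
    \<Sum>ps \<in> bit_lists CARD('k).
      ksign (hd ps * sum_list (tl ps)) *\<^sub>C tens (rotate1 (homogeneous_parts V ps vs)))"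


section \<open>The operator \<open>\<Delta>\<^sub>k(x)\<^sup>-\<^sup>1\<close>\<close>

text \<open>The derivation \<open>\<Sum>\<^bsub>j\<ge>1\<^esub> a\<^sub>j x\<^bsup>j+1\<^esup> d/dx\<close> of formal power series; the value \<open>a 0\<close> is not used.\<close>

definition vector_field :: "(nat \<Rightarrow> complex) \<Rightarrow> complex fps \<Rightarrow> complex fps"
  where "vector_field a f = Abs_fps (\<lambda>n. if n \<ge> 2 then a (n - 1) else 0) * fps_deriv f"

text \<open>
  The series \<open>exp(-\<Sum>\<^bsub>j\<ge>1\<^esub> a\<^sub>j x\<^bsup>j+1\<^esup> d/dx) x\<close>. As the derivation raises the order of a series, only its
  powers with exponent at most \<open>m\<close> contribute to the coefficient of \<open>x\<^bsup>m\<^esup>\<close>.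
\<close>

definition exp_vector_field :: "(nat \<Rightarrow> complex) \<Rightarrow> complex fps"
  where "exp_vector_field a =
    Abs_fps (\<lambda>m. \<Sum>n\<le>m. (- 1) ^ n / fact n * fps_nth ((vector_field a ^^ n) fps_X) m)"

definition change_of_variable :: "nat \<Rightarrow> (nat \<Rightarrow> complex) \<Rightarrow> bool"
  where "change_of_variable k a \<longleftrightarrow>
    exp_vector_field a = fps_const (1 / of_nat k) * (1 + fps_X) ^ k - fps_const (1 / of_nat k)"

text \<open>
  A series \<open>\<Sum>\<^bsub>r\<ge>0\<^esub> f\<^sub>r x\<^bsup>-r/k\<^esup>\<close> over \<open>V\<close> is given by \<open>f :: nat \<Rightarrow> 'a\<close>; \<open>vir_series\<close> is the action of
  \<open>\<Sum>\<^bsub>j\<ge>1\<^esub> a\<^sub>j x\<^bsup>-j/k\<^esup> L(j)\<close> on such series, and \<open>exp_vir V a u r\<close> is the coefficient of \<open>x\<^bsup>-r/k\<^esup>\<close> in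
  \<open>exp(-\<Sum>\<^bsub>j\<ge>1\<^esub> a\<^sub>j x\<^bsup>-j/k\<^esup> L(j)) u\<close>, to which only powers with exponent at most \<open>r\<close> contribute.
\<close>

definition vir_series ::
  "'a::complex_vector vosa_data \<Rightarrow> (nat \<Rightarrow> complex) \<Rightarrow> (nat \<Rightarrow> 'a) \<Rightarrow> nat \<Rightarrow> 'a"
  where "vir_series V a f r = (\<Sum>j=1..r. a j *\<^sub>C vir V (int j) (f (r - j)))"

definition exp_vir :: "'a::complex_vector vosa_data \<Rightarrow> (nat \<Rightarrow> complex) \<Rightarrow> 'a \<Rightarrow> nat \<Rightarrow> 'a"
  where "exp_vir V a u r =
    (\<Sum>n\<le>r. ((- 1) ^ n / fact n) *\<^sub>C (vir_series V a ^^ n) (\<lambda>i. if i = 0 then u else 0) r)"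

text \<open>
  With \<open>s = k\<^bsup>1/2\<^esup>\<close>, \<open>Delta_inv V k a s u e\<close> is the coefficient of \<open>(x\<^bsup>1/2k\<^esup>)\<^bsup>e\<^esup>\<close> in
    \<open>\<Delta>\<^sub>k(x)\<^bsup>-1\<^esup> u = (x\<^bsup>1/2k\<^esup>)\<^bsup>-(1-k)2L(0)\<^esup> (k\<^bsup>1/2\<^esup>)\<^bsup>2L(0)\<^esup> exp(-\<Sum>\<^bsub>j\<ge>1\<^esub> a\<^sub>j x\<^bsup>-j/k\<^esup> L(j)) u\<close>.
  On the component of weight \<open>m/2\<close> of the coefficient of \<open>x\<^bsup>-r/k\<^esup> = (x\<^bsup>1/2k\<^esup>)\<^bsup>-2r\<^esup>\<close>, the first two
  operators act as \<open>(x\<^bsup>1/2k\<^esup>)\<^bsup>(k-1)m\<^esup>\<close> and \<open>s\<^bsup>m\<^esup>\<close>.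
\<close>

definition Delta_inv ::
  "'a::complex_vector vosa_data \<Rightarrow> nat \<Rightarrow> (nat \<Rightarrow> complex) \<Rightarrow> complex \<Rightarrow> 'a \<Rightarrow> int \<Rightarrow> 'a"
  where "Delta_inv V k a s u e =
    Sum_any (\<lambda>(r::nat, m::int).
      if (int k - 1) * m - 2 * int r = e
      then s powi m *\<^sub>C component (wsp V) m (exp_vir V a u r)
      else 0)"

text \<open>
  The coefficient of \<open>x\<^bsup>h/2\<^esup>\<close> in \<open>Y\<^sub>M(u,x)w = Y\<^sub>g((\<Delta>\<^sub>k(x\<^bsup>k\<^esup>)\<^bsup>-1\<^esup>u)\<^bsup>1\<^esup>,x\<^bsup>k\<^esup>)w\<close>, where
  \<open>(x\<^bsup>k\<^esup>)\<^bsup>1/k\<^esup> = x\<close>. Under this substitution \<open>(x\<^bsup>1/2k\<^esup>)\<^bsup>e\<^esup>\<close> becomes \<open>x\<^bsup>e/2\<^esup>\<close> and \<open>x\<^bsup>-N/k-1\<^esup>\<close> becomes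
  \<open>x\<^bsup>-N-k\<^esup>\<close>, so that \<open>h = e - 2N - 2k\<close>.
\<close>

definition untwisted_coeff ::
  "'a::complex_vector vosa_data \<Rightarrow> (nat \<Rightarrow> complex) \<Rightarrow> complex
    \<Rightarrow> (('a, 'k) tensor_power \<Rightarrow> int \<Rightarrow> 'm \<Rightarrow> 'm::complex_vector) \<Rightarrow> 'a \<Rightarrow> int \<Rightarrow> 'm \<Rightarrow> 'm"
  where "untwisted_coeff V a s Yg u h w =
    Sum_any (\<lambda>N::int.
      Yg (tensor_slot V 0 (Delta_inv V CARD('k) a s u (h + 2 * N + 2 * int CARD('k)))) N w)"

text \<open>The modes of \<open>Y\<^sub>M\<close>: the coefficient of \<open>x\<^bsup>-n-1\<^esup>\<close>.\<close>

definition untwisted_mode ::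
  "'a::complex_vector vosa_data \<Rightarrow> (nat \<Rightarrow> complex) \<Rightarrow> complex
    \<Rightarrow> (('a, 'k) tensor_power \<Rightarrow> int \<Rightarrow> 'm \<Rightarrow> 'm::complex_vector) \<Rightarrow> 'a \<Rightarrow> int \<Rightarrow> 'm \<Rightarrow> 'm"
  where "untwisted_mode V a s Yg u n w = untwisted_coeff V a s Yg u (2 * (- n - 1)) w"

end

(*
  On each tensor factor, write T(u, z) for Y_g(u^1, z^k). Testing the twisted Jacobi identity against
  z_1^A z_2^B (z_1 - z_2)^l, where z_i^k = x_i, kills every summand except the one at z_1 = z_2: the
  function is a polynomial multiple of (x_1 - x_2)^(-L), it is regular at z_1 = eta^j z_2, and distinct
  tensor factors have regular operator products. So T satisfies an untwisted Jacobi identity up to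
  the change of variable 1 + t = (1 + y)^k, which is undone by Delta_k.

  For the latter let L_a be the sum of the a_j L(j) and f(y) = ((1 + y)^k - 1)/k. Since (1 + y) f' = 1 + k f,
  the operator exp(- L_a) conjugates L(-1) + L(0), which is (1 + y) d/dy, to L(-1) + k L(0). It also conjugates
  Y(u, y) to some Y(Theta(y) u, y) because ad L_a preserves the span of the modes, and Theta can be read off
  from the action on the vacuum. The result is
    exp(- L_a) Y(u, y) v = Y((1 + y)^(k L(0)) exp(- L_a) (1 + y)^(- L(0)) u, f(y)) exp(- L_a) v.
*)
theory Submission
  imports Defs
begin

section \<open>Powers of formal power series and residues\<close>

text \<open>The identity for \<open>Yg\<close> supplies only integral powers of x_1 - x_2, while
  (z_1 - z_2)^l is wanted. The bridge is the polynomial (z_1^k - z_2^k)/(z_1 - z_2), whose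
  coefficients are the same in all three terms and which vanishes at z_1 = eta^j z_2 for j not 0 mod
  k. Writing x_0/x_2 = k f(y) then costs powers of k, which the factor s^(2L(0)) with s^2 = k
  absorbs, and an exponent (k - 1) wt u of 1 + y, which the remaining factor of Delta_k matches. For
  odd k this exponent is an integer although wt u may be a half-integer. Exponentials act on
  sequences indexed by degree; their generators raise the degree strictly, so every coefficient is a
  finite sum. Reading Theta off the vacuum needs care: the coefficients of Y(Theta(y) u, f(y))
  depend on the mode index n, but polynomially, and a factor n is absorbed by L(-1). The last step
  works because all scalars and mode indices depend only on the total degree.\<close>

definition fps_pw :: "complex fps \<Rightarrow> complex \<Rightarrow> complex fps"
  where "fps_pw F c = fps_binomial c oo (F - 1)"

lemma fps_pw_add: "fps_nth F 0 = 1 \<Longrightarrow> fps_pw F (c + d) = fps_pw F c * fps_pw F d"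
  by (simp add: fps_pw_def fps_binomial_add_mult fps_compose_mult_distrib)

lemma fps_pw_0 [simp]: "fps_pw F 0 = 1"
  by (simp add: fps_pw_def)

lemma fps_pw_1: "fps_nth F 0 = 1 \<Longrightarrow> fps_pw F 1 = F"
  by (simp add: fps_pw_def fps_binomial_1 fps_compose_add_distrib)

lemma fps_pw_of_nat: "fps_nth F 0 = 1 \<Longrightarrow> fps_pw F (of_nat n) = F ^ n"
  by (induction n) (simp_all add: fps_pw_add fps_pw_1)

lemma fps_pw_nth_0 [simp]: "fps_nth (fps_pw F c) 0 = 1"
  by (simp add: fps_pw_def)

lemma fps_deriv_binomial: "fps_deriv (fps_binomial c) = fps_const c * fps_binomial (c - 1)"
  for c :: complex
proof -
  have "fps_binomial c = (1 + fps_X) * fps_binomial (c - 1)"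
    using fps_binomial_add_mult[of 1 "c - 1"] by (simp add: fps_binomial_1)
  moreover have "fps_deriv (fps_binomial c) = fps_const c * fps_binomial c / (1 + fps_X)"
    by (rule fps_binomial_deriv)
  ultimately show ?thesis
    by (metis (no_types, lifting) fps_divide_times_eq mult.left_commute nonzero_mult_div_cancel_left
        fps_nonzeroI fps_add_nth fps_one_nth fps_X_nth add.right_neutral zero_neq_one)
qed

lemma fps_deriv_pw:
  "fps_nth F 0 = 1 \<Longrightarrow> fps_deriv (fps_pw F c) = fps_const c * fps_pw F (c - 1) * fps_deriv F"
  by (simp add: fps_pw_def fps_compose_deriv fps_deriv_binomial fps_compose_mult_distrib)

lemma fps_binomial_of_nat_complex: "fps_binomial (of_nat n :: complex) = (1 + fps_X) ^ n"
  by (rule fps_binomial_of_nat)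

text \<open>Both sides solve (1 + x) G' = b c G, whose solutions are determined by their constant
  term.\<close>

lemma fps_pw_binomial: "fps_pw (fps_binomial b) c = fps_binomial (b * c)"
proof -
  have nz: "(1 + fps_X :: complex fps) \<noteq> 0"
    by (metis fps_add_nth fps_one_nth fps_X_nth fps_zero_nth add.right_neutral zero_neq_one)
  have b: "fps_binomial b = (1 + fps_X) * fps_binomial (b - 1)"
    using fps_binomial_add_mult[of 1 "b - 1"] by (simp add: fps_binomial_1)
  let ?G = "fps_pw (fps_binomial b) c"
  have g: "?G = fps_pw (fps_binomial b) (c - 1) * fps_binomial b"
    using fps_pw_add[of "fps_binomial b" "c - 1" 1] by (simp add: fps_pw_1)
  have "fps_deriv ?G * (1 + fps_X) = fps_const (b * c) * (fps_pw (fps_binomial b) (c - 1)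
      * ((1 + fps_X) * fps_binomial (b - 1)))"
    by (simp add: fps_deriv_pw fps_deriv_binomial mult_ac flip: fps_const_mult)
  also have "\<dots> = fps_const (b * c) * ?G"
    by (simp only: g b[symmetric])
  finally have "fps_deriv ?G = fps_const (b * c) * ?G / (1 + fps_X)"
    by (metis nz nonzero_mult_div_cancel_right)
  then have "?G = fps_const (fps_nth ?G 0) * fps_binomial (b * c)"
    by (simp only: fps_binomial_ODE_unique)
  then show ?thesis by simp
qed

text \<open>This is the residue of \<open>f\<^bsup>-n-1\<^esup> f'\<close>, where \<open>f = x F\<close>.\<close>

lemma fps_residue_power:
  assumes F: "fps_nth F 0 = 1"
  shows "fps_nth (fps_pw F (- of_nat n - 1) * fps_deriv (fps_X * F)) n = (if n = 0 then 1 else 0)"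
proof (cases "n = 0")
  case True
  then show ?thesis using F by simp
next
  case False
  let ?P = "fps_pw F (- of_nat n)"
  have 1: "fps_pw F (- of_nat n - 1) * F = ?P"
    using fps_pw_add[OF F, of "- of_nat n - 1" 1] by (simp add: fps_pw_1[OF F])
  have 2: "fps_deriv ?P = - (fps_const (of_nat n) * fps_pw F (- of_nat n - 1) * fps_deriv F)"
    unfolding fps_deriv_pw[OF F] by (simp only: fps_const_neg[symmetric] mult_minus_left)
  have 3: "fps_deriv (fps_X * F) = F + fps_X * fps_deriv F"
    by (simp add: add.commute)
  have gen: "c * (q * (f + x * d)) = c * (q * f) - x * - (c * q * d)" for c q f x d :: "complex fps"
    by (simp add: algebra_simps)
  \<comment> \<open>Up to the factor x^(n+1), the left side is minus the derivative of f^(-n), hence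
    has no residue. Concretely, x d/dx multiplies the coefficient of degree n by n, so the right
    side vanishes in that degree.\<close>
  have "fps_const (of_nat n) * (fps_pw F (- of_nat n - 1) * fps_deriv (fps_X * F))
      = fps_const (of_nat n) * ?P - fps_X * fps_deriv ?P"
    unfolding 2 3 unfolding 1[symmetric] by (rule gen)
  from arg_cong[OF this, of "\<lambda>f. fps_nth f n"]
  have "of_nat n * fps_nth (fps_pw F (- of_nat n - 1) * fps_deriv (fps_X * F)) n
      = of_nat n * fps_nth ?P n - fps_nth (fps_X * fps_deriv ?P) n"
    by (simp only: fps_mult_left_const_nth fps_sub_nth)
  also have "\<dots> = 0"
    using False by (cases n) simp_all
  finally show ?thesis using False by simp
qed

text \<open>The powers Y^j start in degree j, so the coefficient is a finite linear expression in
  those of \<open>F\<close>. This serves to change variables in residues and to show polynomial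
  dependence on an exponent.\<close>

lemma fps_mult_compose_nth:
  fixes F G Y :: "complex fps"
  assumes Y: "fps_nth Y 0 = 0"
  shows "fps_nth (G * (F oo Y)) i = (\<Sum>j\<le>i. fps_nth F j * fps_nth (G * Y ^ j) i)"
proof -
  have c: "fps_nth (F oo Y) n = (\<Sum>j\<le>i. fps_nth F j * fps_nth (Y ^ j) n)" if "n \<le> i" for n
    unfolding fps_compose_nth using that Y
    by (intro sum.mono_neutral_left) (auto simp: startsby_zero_power_prefix)
  have "fps_nth (G * (F oo Y)) i = (\<Sum>m=0..i. fps_nth G m * (\<Sum>j\<le>i. fps_nth F j * fps_nth (Y ^ j) (i - m)))"
    unfolding fps_mult_nth by (intro sum.cong) (auto simp: c)
  also have "\<dots> = (\<Sum>j\<le>i. fps_nth F j * fps_nth (G * Y ^ j) i)"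
    unfolding fps_mult_nth sum_distrib_left by (subst sum.swap) (simp add: mult_ac)
  finally show ?thesis .
qed

text \<open>Change of variable t = f = x F in a residue: Res t^(-i-1) G(t) dt = Res f^(-i-1) G(f) f'
  dx. By linearity it suffices to take G a power of t, which is the case of
  \<open>fps_residue_power\<close>.\<close>

lemma fps_lagrange:
  fixes F G :: "complex fps"
  assumes F: "fps_nth F 0 = 1"
  shows "fps_nth (fps_pw F (- of_nat i - 1) * fps_deriv (fps_X * F) * (G oo (fps_X * F))) i = fps_nth G i"
proof -
  let ?D = "fps_deriv (fps_X * F)"
  have t: "fps_nth (fps_pw F (- of_nat i - 1) * ?D * (fps_X * F) ^ j) i = (if j = i then 1 else 0)"
    if "j \<le> i" for j
  proof -
    have "fps_pw F (- of_nat (i - j) - 1) = fps_pw F (- of_nat i - 1) * F ^ j"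
      using fps_pw_add[OF F, of "- of_nat i - 1" "of_nat j"] that
      by (simp add: fps_pw_of_nat[OF F] of_nat_diff algebra_simps)
    then have "fps_pw F (- of_nat i - 1) * ?D * (fps_X * F) ^ j
        = fps_X ^ j * (fps_pw F (- of_nat (i - j) - 1) * ?D)"
      by (simp only: power_mult_distrib mult_ac)
    then have "fps_nth (fps_pw F (- of_nat i - 1) * ?D * (fps_X * F) ^ j) i
       = fps_nth (fps_pw F (- of_nat (i - j) - 1) * ?D) (i - j)"
      using that by (simp only: fps_X_power_mult_nth not_less if_False flip: not_le) simp
    also have "\<dots> = (if j = i then 1 else 0)"
      unfolding fps_residue_power[OF F] using that by auto
    finally show ?thesis .
  qed
  have "fps_nth (fps_pw F (- of_nat i - 1) * ?D * (G oo (fps_X * F))) i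
      = (\<Sum>j\<le>i. fps_nth G j * (if j = i then 1 else 0))"
    by (subst fps_mult_compose_nth) (simp, intro sum.cong refl, simp only: t atMost_iff)
  also have "\<dots> = fps_nth G i" by (simp add: if_distrib cong: if_cong)
  finally show ?thesis .
qed

section \<open>The change of variable f = ((1 + x)^k - 1)/k\<close>

definition fps_cov :: "nat \<Rightarrow> complex fps"
  where "fps_cov k = fps_const (1 / of_nat k) * ((1 + fps_X) ^ k - 1)"

text \<open>The unit f(x)/x; its constant term is 1 for k > 0, so that its complex powers make
  sense.\<close>

definition fps_covu :: "nat \<Rightarrow> complex fps"
  where "fps_covu k = fps_shift 1 (fps_cov k)"

lemma fps_cov_0 [simp]: "fps_nth (fps_cov k) 0 = 0"
  by (simp add: fps_cov_def fps_power_zeroth)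

lemma fps_cov_eq: "fps_cov k = fps_X * fps_covu k"
  by (rule fps_ext) (auto simp: fps_covu_def fps_X_mult_nth)

lemma fps_deriv_cov:
  assumes "k > 0" shows "fps_deriv (fps_cov k) = (1 + fps_X) ^ (k - 1)"
  using assms by (simp add: fps_cov_def fps_deriv_power mult.assoc[symmetric] fps_const_mult
     del: fps_const_mult flip: fps_of_nat) 

lemma fps_covu_0 [simp]: "k > 0 \<Longrightarrow> fps_nth (fps_covu k) 0 = 1"
proof -
  assume "k > 0"
  then have "fps_nth (fps_deriv (fps_cov k)) 0 = 1" by (simp add: fps_deriv_cov fps_power_zeroth)
  then show ?thesis by (simp add: fps_covu_def)
qed

lemma fps_cov_ode:
  assumes "k > 0"
  shows "(1 + fps_X) * fps_deriv (fps_cov k) = 1 + fps_const (of_nat k) * fps_cov k"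
proof -
  have "(1 + fps_X :: complex fps) * (1 + fps_X) ^ (k - 1) = (1 + fps_X) ^ k"
    using assms by (metis power_eq_if neq0_conv)
  then show ?thesis using assms
    by (simp only: fps_deriv_cov[OF assms]) (simp add: fps_cov_def mult.assoc[symmetric])
qed

text \<open>The left side is the coefficient of t^i in (1 + k t)^(A/k). For t = f(y) this series is
  (1 + y)^A and dt = (1 + y)^(k-1) dy, so \<open>fps_lagrange\<close> applies. This turns the
  fractional powers of the twisted identity into integral ones.\<close>

lemma gbinomial_root_eq:
  assumes k: "k > 0"
  shows "((A / of_nat k) gchoose i) * of_nat k ^ i
    = fps_nth (fps_pw (fps_covu k) (- of_nat i - 1) * fps_binomial (A + of_nat k - 1)) i"
proof -
  define G where "G = fps_binomial (A / of_nat k) oo (fps_const (of_nat k) * fps_X)"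
  have Gi: "fps_nth G i = ((A / of_nat k) gchoose i) * of_nat k ^ i"
    unfolding G_def by (simp add: fps_compose_linear)
  have "G oo fps_cov k = fps_binomial (A / of_nat k) oo ((fps_const (of_nat k) * fps_X) oo fps_cov k)"
    unfolding G_def by (rule fps_compose_assoc[symmetric]) simp_all
  also have "(fps_const (of_nat k) * fps_X) oo fps_cov k = fps_const (of_nat k) * fps_cov k"
    by (simp add: fps_compose_mult_distrib)
  also have "\<dots> = fps_binomial (of_nat k) - 1"
    using k by (simp add: fps_cov_def mult.assoc[symmetric] fps_binomial_of_nat_complex)
  also have "fps_binomial (A / of_nat k) oo \<dots> = fps_binomial A"
    using fps_pw_binomial[of "of_nat k" "A / of_nat k"] k by (simp add: fps_pw_def)
  finally have Gc: "G oo (fps_X * fps_covu k) = fps_binomial A" by (simp add: fps_cov_eq)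
  have D: "fps_deriv (fps_X * fps_covu k) = fps_binomial (of_nat k - 1)"
    using fps_deriv_cov[OF k] k
    by (simp add: fps_binomial_of_nat_complex[symmetric] of_nat_diff flip: fps_cov_eq)
  show ?thesis
    using fps_lagrange[OF fps_covu_0[OF k], of i G]
    unfolding Gc D Gi by (simp add: mult.assoc fps_binomial_add_mult[symmetric] add_diff_eq add.commute)
qed

section \<open>Exponentials of graded operators\<close>

text \<open>Sequences stand for series graded by the index. The last condition says that
  \<open>H\<close> raises the degree strictly, so only powers up to r reach degree r and the
  exponential below is a finite sum.\<close>

definition raising :: "((nat \<Rightarrow> 'a::complex_vector) \<Rightarrow> nat \<Rightarrow> 'a) \<Rightarrow> bool"
  where "raising H \<longleftrightarrow>
    (\<forall>S T. H (\<lambda>r. S r + T r) = (\<lambda>r. H S r + H T r)) \<and>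
    (\<forall>c S. H (\<lambda>r. c *\<^sub>C S r) = (\<lambda>r. c *\<^sub>C H S r)) \<and>
    (\<forall>S T r. (\<forall>i<r. S i = T i) \<longrightarrow> H S r = H T r)"

definition graded_exp ::
  "complex \<Rightarrow> ((nat \<Rightarrow> 'a::complex_vector) \<Rightarrow> nat \<Rightarrow> 'a) \<Rightarrow> (nat \<Rightarrow> 'a) \<Rightarrow> nat \<Rightarrow> 'a"
  where "graded_exp c H S r = (\<Sum>n\<le>r. (c ^ n / fact n) *\<^sub>C (H ^^ n) S r)"

lemma raising_0: "raising H \<Longrightarrow> H (\<lambda>_. 0) r = 0"
  unfolding raising_def by (metis (no_types) complex_vector.scale_zero_left)

lemma raising_pow_zero: "raising H \<Longrightarrow> r < n \<Longrightarrow> (H ^^ n) S r = 0"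
proof (induction n arbitrary: r)
  case (Suc n)
  have "H ((H ^^ n) S) r = H (\<lambda>_. 0) r"
    using Suc by (auto simp: raising_def)
  then show ?case using raising_0[OF Suc.prems(1)] by simp
qed simp

lemma raising_pow_cong:
  "raising H \<Longrightarrow> (\<And>i. i \<le> r \<Longrightarrow> S i = T i) \<Longrightarrow> (H ^^ n) S r = (H ^^ n) T r"
proof (induction n arbitrary: r)
  case (Suc n)
  have "\<forall>i<r. (H ^^ n) S i = (H ^^ n) T i" using Suc by simp
  then show ?case using Suc.prems(1) by (auto simp: raising_def)
qed simp

lemma raising_pow_add:
  "raising H \<Longrightarrow> (H ^^ n) (\<lambda>r. S r + T r) r = (H ^^ n) S r + (H ^^ n) T r"
proof (induction n arbitrary: S T)
  case (Suc n)
  then show ?case by (simp add: raising_def funpow_swap1)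
qed simp

lemma raising_pow_scale: "raising H \<Longrightarrow> (H ^^ n) (\<lambda>r. c *\<^sub>C S r) r = c *\<^sub>C (H ^^ n) S r"
proof (induction n arbitrary: S)
  case (Suc n)
  then show ?case by (simp add: raising_def funpow_swap1)
qed simp

lemma raising_pow_0: "raising H \<Longrightarrow> (H ^^ n) (\<lambda>_. 0) r = 0"
  using raising_pow_scale[of H n 0 "\<lambda>_. 0" r] by simp

lemma raising_pow_sum:
  assumes "raising H" "finite I"
  shows "(H ^^ n) (\<lambda>r. \<Sum>i\<in>I. S i r) r = (\<Sum>i\<in>I. (H ^^ n) (S i) r)"
  using assms(2)
  by induction (simp_all add: raising_pow_0[OF assms(1)] raising_pow_add[OF assms(1)])

lemma graded_exp_upto:
  assumes "raising H" "r \<le> N"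
  shows "graded_exp c H S r = (\<Sum>n\<le>N. (c ^ n / fact n) *\<^sub>C (H ^^ n) S r)"
  unfolding graded_exp_def using assms
  by (intro sum.mono_neutral_left) (auto simp: raising_pow_zero)

lemma graded_exp_0: "graded_exp c H S 0 = S 0"
  by (simp add: graded_exp_def scaleC_one)

lemma graded_exp_fixed:
  assumes "H S = (\<lambda>_. 0)" "raising H"
  shows "graded_exp c H S = S"
proof
  fix r
  have "(H ^^ n) S r = 0" if "n \<noteq> 0" for n
    using that assms by (cases n) (simp_all add: funpow_swap1 raising_pow_0)
  then have "graded_exp c H S r = (\<Sum>n\<in>{0}. (c ^ n / fact n) *\<^sub>C (H ^^ n) S r)"
    unfolding graded_exp_def by (intro sum.mono_neutral_right) auto
  then show "graded_exp c H S r = S r" by (simp add: scaleC_one)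
qed

lemma graded_exp_add:
  assumes "raising H"
  shows "graded_exp c H (\<lambda>r. S r + T r) r = graded_exp c H S r + graded_exp c H T r"
  by (simp add: graded_exp_def raising_pow_add[OF assms] scaleC_add_right sum.distrib)

lemma graded_exp_scale:
  assumes "raising H"
  shows "graded_exp c H (\<lambda>r. d *\<^sub>C S r) r = d *\<^sub>C graded_exp c H S r"
  by (simp add: graded_exp_def raising_pow_scale[OF assms] complex_vector.scale_sum_right
      scaleC_scaleC mult.commute)

text \<open>Grouping the double sum by the total power N of \<open>H\<close> leaves the coefficient
  (c - c)^N / N!.\<close>

lemma graded_exp_inverse:
  assumes H: "raising H"
  shows "graded_exp c H (graded_exp (- c) H S) r = S r"
proof -
  have 1: "(H ^^ n) (graded_exp (- c) H S) r
      = (\<Sum>j\<le>r. ((- c) ^ j / fact j) *\<^sub>C (H ^^ (n + j)) S r)" for n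
  proof -
    have "(H ^^ n) (graded_exp (- c) H S) r
        = (H ^^ n) (\<lambda>i. \<Sum>j\<le>r. ((- c) ^ j / fact j) *\<^sub>C (H ^^ j) S i) r"
      by (rule raising_pow_cong[OF H]) (rule graded_exp_upto[OF H])
    then show ?thesis
      by (simp add: raising_pow_sum[OF H] raising_pow_scale[OF H] funpow_add)
  qed
  have nz: "n < Suc r" if "(H ^^ n) S r \<noteq> 0" for n
    using that raising_pow_zero[OF H] not_less_eq by blast
  have 2: "(\<Sum>(n, j) | n + j = N. (c ^ n / fact n) * ((- c) ^ j / fact j)) = (if N = 0 then 1 else 0)" for N
  proof -
    have "(\<Sum>(n, j) | n + j = N. (c ^ n / fact n) * ((- c) ^ j / fact j))
        = (\<Sum>n\<le>N. (c ^ n / fact n) * ((- c) ^ (N - n) / fact (N - n)))"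
      by (rule sum.reindex_bij_witness[of _ "\<lambda>n. (n, N - n)" fst]) auto
    also have "\<dots> = (\<Sum>n\<le>N. of_nat (N choose n) * c ^ n * (- c) ^ (N - n)) / fact N"
      unfolding sum_divide_distrib by (intro sum.cong) (auto simp: binomial_fact)
    also have "\<dots> = (c - c) ^ N / fact N"
      by (simp flip: binomial_ring)
    finally show ?thesis by (simp add: power_0_left)
  qed
  have "graded_exp c H (graded_exp (- c) H S) r
      = (\<Sum>n\<le>r. \<Sum>j\<le>r. ((c ^ n / fact n) * ((- c) ^ j / fact j)) *\<^sub>C (H ^^ (n + j)) S r)"
    unfolding graded_exp_def[of c] 1 by (simp add: complex_vector.scale_sum_right scaleC_scaleC)
  also have "\<dots> = (\<Sum>(n, j)\<in>{..r}\<times>{..r}. ((c ^ n / fact n) * ((- c) ^ j / fact j)) *\<^sub>C (H ^^ (n + j)) S r)"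
    by (simp add: sum.cartesian_product)
  also have "\<dots> = (\<Sum>(n, j) | n + j < Suc r. ((c ^ n / fact n) * ((- c) ^ j / fact j)) *\<^sub>C (H ^^ (n + j)) S r)"
    by (intro sum.mono_neutral_right) (auto dest: nz)
  also have "\<dots> = (\<Sum>N<Suc r. \<Sum>n\<le>N. ((c ^ n / fact n) * ((- c) ^ (N - n) / fact (N - n))) *\<^sub>C (H ^^ (n + (N - n))) S r)"
    by (rule sum.triangle_reindex)
  also have "\<dots> = (\<Sum>N<Suc r. (\<Sum>(n, j) | n + j = N. (c ^ n / fact n) * ((- c) ^ j / fact j)) *\<^sub>C (H ^^ N) S r)"
  proof (rule sum.cong[OF refl])
    fix N
    have "(\<Sum>(n, j) | n + j = N. (c ^ n / fact n) * ((- c) ^ j / fact j))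
        = (\<Sum>n\<le>N. (c ^ n / fact n) * ((- c) ^ (N - n) / fact (N - n)))"
      by (rule sum.reindex_bij_witness[of _ "\<lambda>n. (n, N - n)" fst]) auto
    then show "(\<Sum>n\<le>N. ((c ^ n / fact n) * ((- c) ^ (N - n) / fact (N - n))) *\<^sub>C (H ^^ (n + (N - n))) S r)
      = (\<Sum>(n, j) | n + j = N. (c ^ n / fact n) * ((- c) ^ j / fact j)) *\<^sub>C (H ^^ N) S r"
      by (simp add: complex_vector.scale_sum_left)
  qed
  also have "\<dots> = (\<Sum>N<Suc r. if N = 0 then S r else 0)"
    unfolding 2 by (intro sum.cong) (auto simp: scaleC_one)
  finally show ?thesis by simp
qed

definition graded_conv ::
  "('b \<Rightarrow> 'c \<Rightarrow> 'a::complex_vector) \<Rightarrow> (nat \<Rightarrow> 'b) \<Rightarrow> (nat \<Rightarrow> 'c) \<Rightarrow> nat \<Rightarrow> 'a"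
  where "graded_conv m S T r = (\<Sum>i\<le>r. m (S i) (T (r - i)))"

text \<open>The binomial form of the Leibniz rule. The predicate \<open>good\<close> restricts the
  rule to admissible left factors, such as sequences of linear operators, and must therefore be
  preserved by \<open>Q\<close>.\<close>

lemma graded_leibniz_pow:
  fixes m :: "'b \<Rightarrow> 'c \<Rightarrow> 'a::complex_vector"
  assumes H: "raising H"
    and good: "good S" "\<And>S. good S \<Longrightarrow> good (Q S)"
    and leib: "\<And>S T. good S \<Longrightarrow> H (graded_conv m S T) =
      (\<lambda>r. graded_conv m (Q S) T r + graded_conv m S (R T) r)"
  shows "(H ^^ n) (graded_conv m S T) r
    = (\<Sum>i\<le>n. of_nat (n choose i) *\<^sub>C graded_conv m ((Q ^^ i) S) ((R ^^ (n - i)) T) r)"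
  using good(1)
proof (induction n arbitrary: S T)
  case 0
  then show ?case by (simp add: scaleC_one)
next
  case (Suc n)
  let ?F = "\<lambda>i j. graded_conv m ((Q ^^ i) S) ((R ^^ j) T) r"
  have "(H ^^ Suc n) (graded_conv m S T) r
      = (H ^^ n) (\<lambda>r. graded_conv m (Q S) T r + graded_conv m S (R T) r) r"
    by (simp add: funpow_swap1 leib[OF Suc.prems])
  also have "\<dots> = (\<Sum>i\<le>n. of_nat (n choose i) *\<^sub>C ?F (Suc i) (n - i))
      + (\<Sum>i\<le>n. of_nat (n choose i) *\<^sub>C ?F i (Suc (n - i)))"
    using Suc.IH[of "Q S" T] Suc.IH[of S "R T"] Suc.prems good(2)
    by (simp add: raising_pow_add[OF H] funpow_swap1)
  also have "(\<Sum>i\<le>n. of_nat (n choose i) *\<^sub>C ?F i (Suc (n - i)))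
      = (\<Sum>i\<le>Suc n. of_nat (n choose i) *\<^sub>C ?F i (Suc n - i))"
    by (simp add: Suc_diff_le)
  also have "\<dots> = ?F 0 (Suc n) + (\<Sum>i\<le>n. of_nat (n choose Suc i) *\<^sub>C ?F (Suc i) (n - i))"
    by (subst sum.atMost_Suc_shift) (simp add: scaleC_one)
  also have "(\<Sum>i\<le>n. of_nat (n choose i) *\<^sub>C ?F (Suc i) (n - i)) + \<dots>
      = ?F 0 (Suc n) + (\<Sum>i\<le>n. of_nat (Suc n choose Suc i) *\<^sub>C ?F (Suc i) (n - i))"
    by (simp add: scaleC_add_left sum.distrib)
  also have "\<dots> = (\<Sum>i\<le>Suc n. of_nat (Suc n choose i) *\<^sub>C ?F i (Suc n - i))"
    by (simp add: sum.atMost_Suc_shift scaleC_one del: sum.atMost_Suc)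
  finally show ?case .
qed

text \<open>The exponential of a derivation is multiplicative. The left factors are operators on \<open>V\<close> below, a type
  without linear structure here, so \<open>Q\<close> is not exponentiated on its own.\<close>

lemma graded_exp_conv:
  fixes m :: "'b \<Rightarrow> 'c::complex_vector \<Rightarrow> 'a::complex_vector"
  assumes H: "raising H" and R: "raising R"
    and good: "good S" "\<And>S. good S \<Longrightarrow> good (Q S)"
    and lin: "\<And>S i. good S \<Longrightarrow> clinear (m (S i))"
    and van: "\<And>i p y. p < i \<Longrightarrow> m ((Q ^^ i) S p) y = 0"
    and leib: "\<And>S T. good S \<Longrightarrow> H (graded_conv m S T) =
      (\<lambda>r. graded_conv m (Q S) T r + graded_conv m S (R T) r)"
  shows "graded_exp c H (graded_conv m S T) r
    = (\<Sum>p\<le>r. \<Sum>i\<le>p. (c ^ i / fact i) *\<^sub>C m ((Q ^^ i) S p) (graded_exp c R T (r - p)))"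
proof -
  have gQ: "good ((Q ^^ i) S)" for i by (induction i) (simp_all add: good)
  have m0: "m ((Q ^^ i) S p) 0 = 0" for i p
    using clinear_scale[OF lin[OF gQ], of i p 0 0] by simp
  have msum: "m ((Q ^^ i) S p) (\<Sum>j\<in>J. f j) = (\<Sum>j\<in>J. m ((Q ^^ i) S p) (f j))" for i p f and J :: "nat set"
    by (induction J rule: infinite_finite_induct) (simp_all add: m0 clinear_add[OF lin[OF gQ]])
  let ?F = "\<lambda>i j. graded_conv m ((Q ^^ i) S) ((R ^^ j) T) r"
  have pow: "(H ^^ n) (graded_conv m S T) r = (\<Sum>i\<le>n. of_nat (n choose i) *\<^sub>C ?F i (n - i))" for n
    by (rule graded_leibniz_pow[where good = good]) (fact H good leib)+
  \<comment> \<open>The i-th iterate of \<open>Q\<close> contributes nothing below degree i, and the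
    j-th iterate of \<open>R\<close> nothing below degree j.\<close>
  have F0: "?F i j = 0" if "\<not> i + j < Suc r" for i j
  proof -
    have "m ((Q ^^ i) S p) ((R ^^ j) T (r - p)) = 0" if "p \<le> r" for p
    proof (cases "p < i")
      case False
      then have "r - p < j" using \<open>\<not> i + j < Suc r\<close> that by linarith
      then show ?thesis by (simp add: raising_pow_zero[OF R] m0)
    qed (simp add: van)
    then show ?thesis by (simp add: graded_conv_def)
  qed
  have "graded_exp c H (graded_conv m S T) r
      = (\<Sum>n<Suc r. \<Sum>i\<le>n. ((c ^ i / fact i) * (c ^ (n - i) / fact (n - i))) *\<^sub>C ?F i (n - i))"
    unfolding graded_exp_def lessThan_Suc_atMost
    by (auto simp: pow complex_vector.scale_sum_right scaleC_scaleC binomial_fact simp flip: power_add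
        intro!: sum.cong)
  also have "\<dots> = (\<Sum>(i, j) | i + j < Suc r. ((c ^ i / fact i) * (c ^ j / fact j)) *\<^sub>C ?F i j)"
    by (rule sum.triangle_reindex[symmetric])
  also have "\<dots> = (\<Sum>(i, j)\<in>{..r}\<times>{..r}. ((c ^ i / fact i) * (c ^ j / fact j)) *\<^sub>C ?F i j)"
    using F0 by (intro sum.mono_neutral_left) fastforce+
  also have "\<dots> = (\<Sum>i\<le>r. \<Sum>j\<le>r. ((c ^ i / fact i) * (c ^ j / fact j)) *\<^sub>C ?F i j)"
    by (rule sum.cartesian_product[symmetric])
  also have "\<dots> = (\<Sum>i\<le>r. \<Sum>j\<le>r. \<Sum>p\<le>r. ((c ^ i / fact i) * (c ^ j / fact j)) *\<^sub>C m ((Q ^^ i) S p) ((R ^^ j) T (r - p)))"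
    by (simp add: graded_conv_def complex_vector.scale_sum_right)
  also have "\<dots> = (\<Sum>i\<le>r. \<Sum>p\<le>r. \<Sum>j\<le>r. ((c ^ i / fact i) * (c ^ j / fact j)) *\<^sub>C m ((Q ^^ i) S p) ((R ^^ j) T (r - p)))"
    by (intro sum.cong refl sum.swap)
  also have "\<dots> = (\<Sum>p\<le>r. \<Sum>i\<le>r. \<Sum>j\<le>r. ((c ^ i / fact i) * (c ^ j / fact j)) *\<^sub>C m ((Q ^^ i) S p) ((R ^^ j) T (r - p)))"
    by (rule sum.swap)
  also have "\<dots> = (\<Sum>p\<le>r. \<Sum>i\<le>r. (c ^ i / fact i) *\<^sub>C m ((Q ^^ i) S p) (graded_exp c R T (r - p)))"
    by (simp add: graded_exp_upto[OF R, of _ r] msum clinear_scale[OF lin[OF gQ]]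
        complex_vector.scale_sum_right scaleC_scaleC)
  also have "\<dots> = (\<Sum>p\<le>r. \<Sum>i\<le>p. (c ^ i / fact i) *\<^sub>C m ((Q ^^ i) S p) (graded_exp c R T (r - p)))"
    by (intro sum.cong refl sum.mono_neutral_right) (auto simp: van)
  finally show ?thesis .
qed

section \<open>Weights and commutators in a vertex operator superalgebra\<close>

lemma clinear_0: "clinear f \<Longrightarrow> f 0 = 0"
  using clinear_scale[of f 0 0] by simp

lemma clinear_sum: "clinear f \<Longrightarrow> f (sum g I) = (\<Sum>i\<in>I. f (g i))"
  by (induction I rule: infinite_finite_induct) (simp_all add: clinear_0 clinear_add)

lemma clinearI:
  "(\<And>x y. f (x + y) = f x + f y) \<Longrightarrow> (\<And>c x. f (c *\<^sub>C x) = c *\<^sub>C f x) \<Longrightarrow> clinear f"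
  by (simp add: Vector_Spaces.linear_iff complex_vector.vector_space_axioms)

lemma clinear_Sum_any:
  assumes "clinear F" "finite {i. f i \<noteq> 0}"
  shows "F (Sum_any f) = Sum_any (\<lambda>i. F (f i))"
proof -
  have "Sum_any (\<lambda>i. F (f i)) = (\<Sum>i\<in>{i. f i \<noteq> 0}. F (f i))"
    using assms clinear_0[OF assms(1)] by (intro Sum_any.expand_superset) auto
  then show ?thesis using assms by (simp add: Sum_any.expand_set clinear_sum)
qed

lemma direct_sum_subspace: "direct_sum A \<Longrightarrow> csubspace (A i)"
  by (simp add: direct_sum_def)

lemma component_is_decomposition:
  "direct_sum A \<Longrightarrow> is_decomposition A v (\<lambda>i. component A i v)"
  unfolding component_def direct_sum_def by (metis (mono_tags, lifting) theI')

lemma component_eqI: "direct_sum A \<Longrightarrow> is_decomposition A v f \<Longrightarrow> component A i v = f i"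
  using component_is_decomposition[of A v] unfolding direct_sum_def by metis

lemma component_in: "direct_sum A \<Longrightarrow> component A i v \<in> A i"
  using component_is_decomposition[of A v] by (simp add: is_decomposition_def)

lemma finite_component: "direct_sum A \<Longrightarrow> finite {i. component A i v \<noteq> 0}"
  using component_is_decomposition[of A v] by (simp add: is_decomposition_def)

lemma Sum_any_component: "direct_sum A \<Longrightarrow> Sum_any (\<lambda>i. component A i v) = v"
  using component_is_decomposition[of A v] by (simp add: is_decomposition_def)

lemma component_of_homogeneous:
  assumes "direct_sum A" "v \<in> A j"
  shows "component A i v = (if i = j then v else 0)"
proof (rule component_eqI[OF assms(1)])
  have "finite {i. (if i = j then v else 0) \<noteq> 0}" by (rule finite_subset[of _ "{j}"]) auto
  then show "is_decomposition A v (\<lambda>i. if i = j then v else 0)"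
    using assms complex_vector.subspace_0[OF direct_sum_subspace[OF assms(1)]]
    by (auto simp: is_decomposition_def)
qed

lemma clinear_component:
  fixes A :: "'i \<Rightarrow> 'a::complex_vector set"
  assumes A: "direct_sum A"
  shows "clinear (component A i)"
proof (rule clinearI)
  fix x y :: 'a and c :: complex
  let ?C = "\<lambda>v i. component A i v"
  have fin: "finite {i. ?C x i + ?C y i \<noteq> 0}"
    by (rule finite_subset[of _ "{i. ?C x i \<noteq> 0} \<union> {i. ?C y i \<noteq> 0}"])
      (auto simp: finite_component[OF A])
  have "is_decomposition A (x + y) (\<lambda>i. ?C x i + ?C y i)"
    using complex_vector.subspace_add[OF direct_sum_subspace[OF A]] fin
    by (simp add: is_decomposition_def component_in[OF A] Sum_any.distrib finite_component[OF A]
        Sum_any_component[OF A])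
  then show "component A i (x + y) = component A i x + component A i y"
    by (rule component_eqI[OF A])
  have fin: "finite {i. c *\<^sub>C ?C x i \<noteq> 0}"
    by (rule finite_subset[OF _ finite_component[OF A, of x]]) auto
  have "Sum_any (\<lambda>i. c *\<^sub>C ?C x i) = c *\<^sub>C Sum_any (?C x)"
    by (rule clinear_Sum_any[symmetric, OF clinearI finite_component[OF A]])
      (simp_all add: scaleC_add_right scaleC_scaleC mult.commute)
  then have "is_decomposition A (c *\<^sub>C x) (\<lambda>i. c *\<^sub>C ?C x i)"
    using complex_vector.subspace_scale[OF direct_sum_subspace[OF A]] fin
    by (simp add: is_decomposition_def component_in[OF A] Sum_any_component[OF A])
  then show "component A i (c *\<^sub>C x) = c *\<^sub>C component A i x"
    by (rule component_eqI[OF A])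
qed

lemma direct_sum_induct [consumes 1, case_names homogeneous zero add]:
  assumes "direct_sum A"
    and "\<And>i v. v \<in> A i \<Longrightarrow> P v" and "P 0" and "\<And>x y. P x \<Longrightarrow> P y \<Longrightarrow> P (x + y)"
  shows "P v"
proof -
  have *: "P (sum f I)" if "\<And>i. i \<in> I \<Longrightarrow> P (f i)" for f and I :: "'a set"
    using that by (induction I rule: infinite_finite_induct) (simp_all add: assms(3,4))
  have "P (\<Sum>i\<in>{i. component A i v \<noteq> 0}. component A i v)"
    by (rule *) (rule assms(2)[OF component_in[OF assms(1)]])
  then show ?thesis
    using Sum_any_component[OF assms(1), of v] by (simp add: Sum_any.expand_set)
qed

lemma binexp_zero_left: "binexp 0 i = (if i = 0 then 1 else 0)"
  by (auto simp: binexp_def gbinomial_0_left)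

lemma binexp_eq_gbinomial: "binexp (of_nat i - s - 1) i = s gchoose i"
  by (simp add: binexp_def gbinomial_negated_upper[of s i] algebra_simps)

lemma Sum_any_single:
  assumes "\<And>i. i \<noteq> j \<Longrightarrow> f i = 0"
  shows "Sum_any f = f j"
proof -
  have "Sum_any f = sum f {j}"
    by (rule Sum_any.expand_superset) (use assms in auto)
  then show ?thesis by simp
qed

lemma Sum_any_lessThan:
  fixes K :: nat
  assumes "\<And>i. i \<ge> K \<Longrightarrow> f i = 0"
  shows "Sum_any f = (\<Sum>i<K. f i)"
proof (rule Sum_any.expand_superset)
  show "{i. f i \<noteq> 0} \<subseteq> {..<K}"
    using assms by (metis (mono_tags, lifting) mem_Collect_eq lessThan_iff not_le subsetI)
qed simp

definition weight_parity :: "int \<Rightarrow> bit"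
  where "weight_parity m = (if even m then 0 else 1)"

lemma bit_cases: "(p :: bit) = 0 \<or> p = 1"
  by (cases p) auto

context vertex_operator_superalgebra
begin

lemma clinear_vir: "clinear (vir V j)"
  unfolding vir_def by (rule linear_right)

lemma mode_0_left [simp]: "mode V 0 n v = 0"
  using clinear_0[OF linear_left] .

lemma mode_0_right [simp]: "mode V u n 0 = 0"
  using clinear_0[OF linear_right] .

lemma vir_0_right [simp]: "vir V j 0 = 0"
  using clinear_0[OF clinear_vir] .

text \<open>Different weights are different eigenvalues of L(0), so an eigenvector has at most one
  nonzero component. Weights can then be found from commutators with L(0).\<close>

lemma weight_iff: "v \<in> wsp V m \<longleftrightarrow> vir V 0 v = (of_int m / 2) *\<^sub>C v"
proof
  assume v: "vir V 0 v = (of_int m / 2) *\<^sub>C v"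
  let ?c = "\<lambda>i. component (wsp V) i v"
  have "?c i = 0" if "i \<noteq> m" for i
  proof -
    have fin: "finite {i. (of_int i / 2) *\<^sub>C ?c i \<noteq> 0}"
      by (rule finite_subset[OF _ finite_component[OF grading, of v]]) auto
    have "vir V 0 v = Sum_any (\<lambda>i. vir V 0 (?c i))"
      using clinear_Sum_any[OF clinear_vir finite_component[OF grading, of v]]
      by (simp add: Sum_any_component[OF grading])
    also have "\<dots> = Sum_any (\<lambda>i. (of_int i / 2) *\<^sub>C ?c i)"
      by (simp only: weight[OF component_in[OF grading]])
    finally have "is_decomposition (wsp V) (vir V 0 v) (\<lambda>i. (of_int i / 2) *\<^sub>C ?c i)"
      using complex_vector.subspace_scale[OF direct_sum_subspace[OF grading]] fin
      by (simp add: is_decomposition_def component_in[OF grading])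
    then have "component (wsp V) i (vir V 0 v) = (of_int i / 2) *\<^sub>C ?c i"
      by (rule component_eqI[OF grading])
    then have "(of_int i / 2 - of_int m / 2) *\<^sub>C ?c i = 0"
      unfolding v clinear_scale[OF clinear_component[OF grading]]
      by (simp only: complex_vector.scale_left_diff_distrib diff_self)
    moreover have "(of_int i / 2 - of_int m / 2 :: complex) \<noteq> 0" using that by simp
    ultimately show ?thesis by (simp only: complex_vector.scale_eq_0_iff) simp
  qed
  then have "v = ?c m"
    using Sum_any_component[OF grading, of v] Sum_any_single[of m ?c] by metis
  then show "v \<in> wsp V m" using component_in[OF grading] by metis
qed (rule weight)

lemma wsp_vir:
  assumes "v \<in> wsp V m" shows "vir V j v \<in> wsp V (m - 2 * j)"
proof -
  have "vir V 0 (vir V j v) = vir V j (vir V 0 v) - of_int j *\<^sub>C vir V j v"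
    using virasoro[of 0 j v] by (cases "j = 0") (auto simp: algebra_simps)
  also have "\<dots> = (of_int m / 2 - of_int j) *\<^sub>C vir V j v"
    using assms by (simp add: weight_iff clinear_scale[OF clinear_vir]
        complex_vector.scale_left_diff_distrib)
  also have "of_int m / 2 - of_int j = (of_int (m - 2 * j) / 2 :: complex)"
    by (simp add: field_simps)
  finally show ?thesis by (simp add: weight_iff)
qed

lemma wsp_par: "wsp V m \<subseteq> par V (weight_parity m)"
  unfolding weight_parity_def using even_part odd_part by (auto intro!: complex_vector.span_base)

text \<open>The Jacobi identity for the conformal vector with x_0-exponent l = 0. As omega is even
  there is no sign, and writing the index as J - 1 with J natural makes the binomial sum
  finite.\<close>

lemma vir_mode_commutator:
  "vir V (int J - 1) (mode V u n v) - mode V u n (vir V (int J - 1) v)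
    = (\<Sum>i\<le>J. of_nat (J choose i) *\<^sub>C mode V (vir V (int i - 1) u) (n + int J - int i) v)"
proof -
  have homog: "vir V (int J - 1) (mode V u n v) - mode V u n (vir V (int J - 1) v)
    = (\<Sum>i\<le>J. of_nat (J choose i) *\<^sub>C mode V (vir V (int i - 1) u) (n + int J - int i) v)"
    if u: "u \<in> par V q" for q u
  proof -
    have c: "conf V \<in> par V 0" using wsp_par[of 4] conf_weight by (auto simp: weight_parity_def)
    have 1: "jacobi_term1 1 (mode V) (conf V) u 0 (int J) n v = vir V (int J - 1) (mode V u n v)"
      unfolding jacobi_term1_def vir_def
      by (subst Sum_any_single[of 0]) (auto simp: binexp_zero_left scaleC_one)
    have 2: "jacobi_term2 1 (mode V) (conf V) u 0 (int J) n v = mode V u n (vir V (int J - 1) v)"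
      unfolding jacobi_term2_def vir_def
      by (subst Sum_any_single[of 0]) (auto simp: binexp_zero_left scaleC_one)
    have 3: "jacobi_term3 (mode V) 1 (\<lambda>v. v) 1 (mode V) (conf V) u 0 (int J) n v
       = (\<Sum>i\<le>J. of_nat (J choose i) *\<^sub>C mode V (vir V (int i - 1) u) (n + int J - int i) v)"
    proof -
      have b: "binexp (of_int (int i - int J - 1)) i = of_nat (J choose i)" for i
        using binexp_eq_gbinomial[of i "of_nat J"] by (simp add: binomial_gbinomial)
      have "jacobi_term3 (mode V) 1 (\<lambda>v. v) 1 (mode V) (conf V) u 0 (int J) n v
        = Sum_any (\<lambda>i. of_nat (J choose i) *\<^sub>C mode V (vir V (int i - 1) u) (n + int J - int i) v)"
        unfolding jacobi_term3_def Let_def using b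
        by (simp add: vir_def scaleC_one add.commute)
      also have "\<dots> = (\<Sum>i\<le>J. of_nat (J choose i) *\<^sub>C mode V (vir V (int i - 1) u) (n + int J - int i) v)"
        by (rule Sum_any.expand_superset) (auto simp: not_less[symmetric])
      finally show ?thesis .
    qed
    have "jacobi_term1 1 (mode V) (conf V) u 0 (int J) n v
        - ksign (0 * q) *\<^sub>C jacobi_term2 1 (mode V) (conf V) u 0 (int J) n v
        = jacobi_term3 (mode V) 1 (\<lambda>v. v) 1 (mode V) (conf V) u 0 (int J) n v"
      by (rule jacobi[unfolded jacobi_identity_def, rule_format, OF c u])
    then show ?thesis
      unfolding 1 2 3 by (simp add: ksign_def scaleC_one)
  qed
  \<comment> \<open>The Jacobi identity is available only for u of homogeneous sign; both sides are
    additive in u.\<close>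
  show ?thesis
    using superspace
  proof (induction u rule: direct_sum_induct)
    case (homogeneous i u)
    then show ?case by (rule homog)
  next
    case (add x y)
    show ?case
      by (simp only: clinear_add[OF linear_left] clinear_add[OF clinear_vir] scaleC_add_right
          sum.distrib add_diff_add add)
  qed simp
qed

lemma wsp_mode:
  assumes "u \<in> wsp V mu" "v \<in> wsp V mv"
  shows "mode V u n v \<in> wsp V (mu + mv - 2 * n - 2)"
proof -
  have "vir V 0 (mode V u n v) - mode V u n (vir V 0 v)
      = mode V (vir V (- 1) u) (n + 1) v + mode V (vir V 0 u) n v"
    using vir_mode_commutator[of 1 u n v] by (simp add: scaleC_one)
  then have "vir V 0 (mode V u n v) = (of_int mv / 2) *\<^sub>C mode V u n v
      + (- of_int (n + 1) *\<^sub>C mode V u n v + (of_int mu / 2) *\<^sub>C mode V u n v)"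
    using assms by (simp add: weight_iff derivative clinear_scale[OF linear_left]
        clinear_scale[OF linear_right] diff_eq_eq add_ac)
  then show ?thesis
    by (simp only: weight_iff flip: scaleC_add_left) (simp add: field_simps)
qed

lemma vir_vac [simp]: "j \<ge> - 1 \<Longrightarrow> vir V j (vac V) = 0"
  by (simp add: vir_def creation)

lemma vac_wsp: "vac V \<in> wsp V 0"
  by (simp add: weight_iff)

text \<open>Coefficient form of Y(w,x)1 = exp(x L(-1)) w, by iterating the L(-1)-derivative
  property.\<close>

lemma mode_vac: "mode V w (- 1 - int N) (vac V) = (1 / fact N) *\<^sub>C (vir V (- 1) ^^ N) w"
proof (induction N arbitrary: w)
  case 0
  then show ?case by (simp add: creation scaleC_one)
next
  case (Suc N)
  have "(1 / fact N) *\<^sub>C (vir V (- 1) ^^ N) (vir V (- 1) w)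
      = (of_nat (Suc N)) *\<^sub>C mode V w (- 1 - int (Suc N)) (vac V)"
    unfolding Suc.IH[symmetric] derivative by (simp add: algebra_simps)
  then have "(1 / of_nat (Suc N)) *\<^sub>C ((1 / fact N) *\<^sub>C (vir V (- 1) ^^ N) (vir V (- 1) w))
      = mode V w (- 1 - int (Suc N)) (vac V)"
    by (simp add: scaleC_scaleC scaleC_one del: of_nat_Suc)
  then show ?case
    by (simp add: scaleC_scaleC funpow_swap1 del: of_nat_Suc)
qed

end

section \<open>The Virasoro exponential\<close>

lemma sum_assoc_atMost:
  fixes F :: "nat \<Rightarrow> nat \<Rightarrow> nat \<Rightarrow> 'a::comm_monoid_add"
  shows "(\<Sum>p\<le>r. \<Sum>j\<le>p. F j (p - j) (r - p)) = (\<Sum>j\<le>r. \<Sum>i\<le>r - j. F j i (r - j - i))"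
  using fps_mult_assoc_lemma[of F r] by (simp add: atLeast0AtMost)

lemma sum_rev_atMost: "(\<Sum>j\<le>p. f j (p - j)) = (\<Sum>j\<le>p. f (p - j) j)" for p :: nat
  by (rule sum.reindex_bij_witness[of _ "\<lambda>j. p - j" "\<lambda>j. p - j"]) auto

lemma fps_mult_atMost: "fps_nth (f * g) r = (\<Sum>j\<le>r. fps_nth f j * fps_nth g (r - j))"
  by (simp add: fps_mult_nth atLeast0AtMost)

lemma fps_X_deriv_nth: "fps_nth (fps_X * fps_deriv g) i = of_nat i * fps_nth g i"
  for g :: "complex fps"
  by (cases i) auto

section \<open>Formal vector fields acting on functions, one-forms and vector fields\<close>

definition vf_coeff :: "(nat \<Rightarrow> complex) \<Rightarrow> nat \<Rightarrow> complex"
  where "vf_coeff a j = (if j = 0 then 0 else a j)"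

lemma vf_coeff_0 [simp]: "vf_coeff a 0 = 0"
  by (simp add: vf_coeff_def)

lemma vector_field_alt: "vector_field a f = fps_X * Abs_fps (vf_coeff a) * fps_deriv f"
  unfolding vector_field_def by (rule arg_cong[of _ _ "\<lambda>g. g * _"]) (auto simp: fps_eq_iff vf_coeff_def)

text \<open>The Lie derivative of the one-form g dx along X = sum of a_j x^(j+1) d/dx.\<close>

definition vf_push :: "(nat \<Rightarrow> complex) \<Rightarrow> complex fps \<Rightarrow> complex fps"
  where "vf_push a g = fps_deriv (fps_X * Abs_fps (vf_coeff a) * g)"

text \<open>The Lie bracket of X with the field g d/dx.\<close>

definition vf_bracket :: "(nat \<Rightarrow> complex) \<Rightarrow> complex fps \<Rightarrow> complex fps"
  where "vf_bracket a g = fps_X * Abs_fps (vf_coeff a) * fps_deriv g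
    - fps_deriv (fps_X * Abs_fps (vf_coeff a)) * g"

abbreviation on_coeffs :: "(complex fps \<Rightarrow> complex fps) \<Rightarrow> (nat \<Rightarrow> complex) \<Rightarrow> nat \<Rightarrow> complex"
  where "on_coeffs F S \<equiv> fps_nth (F (Abs_fps S))"

lemma on_coeffs_pow: "(on_coeffs F ^^ n) (fps_nth g) = fps_nth ((F ^^ n) g)"
  by (induction n) (simp_all add: fps_nth_inverse)

lemma vector_field_nth:
  "fps_nth (vector_field a g) r = (\<Sum>j\<le>r. vf_coeff a j * (of_nat (r - j) * fps_nth g (r - j)))"
proof -
  have "vector_field a g = Abs_fps (vf_coeff a) * (fps_X * fps_deriv g)"
    by (simp add: vector_field_alt mult_ac)
  then show ?thesis
    by (simp only: fps_mult_atMost[of "Abs_fps (vf_coeff a)"] fps_X_deriv_nth fps_nth_Abs_fps)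
qed

lemma vf_push_nth:
  "fps_nth (vf_push a g) r = of_nat (Suc r) * (\<Sum>j\<le>r. vf_coeff a j * fps_nth g (r - j))"
proof -
  have "fps_nth (vf_push a g) r = of_nat (Suc r) * fps_nth (fps_X * (Abs_fps (vf_coeff a) * g)) (Suc r)"
    unfolding vf_push_def fps_deriv_nth by (simp add: mult.assoc del: of_nat_Suc)
  also have "fps_nth (fps_X * (Abs_fps (vf_coeff a) * g)) (Suc r) = fps_nth (Abs_fps (vf_coeff a) * g) r"
    by simp
  finally show ?thesis
    by (simp only: fps_mult_atMost fps_nth_Abs_fps)
qed

lemma vf_bracket_nth:
  "fps_nth (vf_bracket a g) r
    = (\<Sum>j\<le>r. vf_coeff a j * ((of_nat r - 2 * of_nat j - 1) * fps_nth g (r - j)))"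
proof -
  let ?B = "Abs_fps (vf_coeff a)"
  have "vf_bracket a g = ?B * (fps_X * fps_deriv g) - ?B * g - (fps_X * fps_deriv ?B) * g"
    by (simp add: vf_bracket_def algebra_simps)
  then have "fps_nth (vf_bracket a g) r = (\<Sum>j\<le>r. vf_coeff a j * (of_nat (r - j) * fps_nth g (r - j)))
     - (\<Sum>j\<le>r. vf_coeff a j * fps_nth g (r - j)) - (\<Sum>j\<le>r. of_nat j * vf_coeff a j * fps_nth g (r - j))"
    by (simp only: fps_sub_nth fps_mult_atMost[of ?B] fps_mult_atMost[of "fps_X * fps_deriv ?B"]
        fps_X_deriv_nth fps_nth_Abs_fps)
  also have "\<dots> = (\<Sum>j\<le>r. vf_coeff a j * ((of_nat r - 2 * of_nat j - 1) * fps_nth g (r - j)))"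
    unfolding sum_subtractf[symmetric] by (intro sum.cong) (auto simp: of_nat_diff algebra_simps)
  finally show ?thesis .
qed

lemma raising_complexI:
  assumes "\<And>S r. H S r = (\<Sum>j\<le>r. c j r * S (r - j))" "\<And>r. c 0 r = 0"
  shows "raising (H :: (nat \<Rightarrow> complex) \<Rightarrow> nat \<Rightarrow> complex)"
  unfolding raising_def
proof (intro conjI allI impI)
  fix S T :: "nat \<Rightarrow> complex" and r
  assume "\<forall>i<r. S i = T i"
  then have "c j r * S (r - j) = c j r * T (r - j)" if "j \<le> r" for j
    using that assms(2) by (cases "j = 0") auto
  then show "H S r = H T r" unfolding assms(1) by (intro sum.cong refl) (simp only: atMost_iff)
qed (auto simp: assms(1) scaleC_complex_def sum.distrib sum_distrib_left algebra_simps)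

lemma raising_vector_field: "raising (on_coeffs (vector_field a))"
  by (rule raising_complexI[where c = "\<lambda>j r. vf_coeff a j * of_nat (r - j)"])
    (simp_all add: vector_field_nth mult.assoc)

lemma raising_vf_push: "raising (on_coeffs (vf_push a))"
  by (rule raising_complexI[where c = "\<lambda>j r. of_nat (Suc r) * vf_coeff a j"])
    (simp_all add: vf_push_nth mult.assoc sum_distrib_left del: of_nat_Suc)

lemma raising_vf_bracket: "raising (on_coeffs (vf_bracket a))"
  by (rule raising_complexI[where c = "\<lambda>j r. vf_coeff a j * (of_nat r - 2 * of_nat j - 1)"])
    (simp_all add: vf_bracket_nth mult.assoc)

lemma graded_conv_mult: "graded_conv (*) S T = fps_nth (Abs_fps S * Abs_fps T)"
  by (rule ext) (simp add: graded_conv_def fps_mult_nth atLeast0AtMost)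

lemma clinear_mult: "clinear ((*) (c :: complex))"
  by (rule clinearI) (simp_all add: scaleC_complex_def algebra_simps)

lemma graded_exp_vector_field:
  "graded_exp (- 1) (on_coeffs (vector_field a)) (fps_nth fps_X) = fps_nth (exp_vector_field a)"
  by (rule ext) (simp add: graded_exp_def exp_vector_field_def on_coeffs_pow scaleC_complex_def)

text \<open>Differentiation intertwines the actions on functions and on one-forms, and 1 is the
  derivative of x.\<close>

lemma graded_exp_vf_push:
  "graded_exp (- 1) (on_coeffs (vf_push a)) (fps_nth 1) = fps_nth (fps_deriv (exp_vector_field a))"
proof
  fix r
  have p: "(vf_push a ^^ n) 1 = fps_deriv ((vector_field a ^^ n) fps_X)" for n
    by (induction n) (simp_all add: vf_push_def vector_field_alt)
  have "graded_exp (- 1) (on_coeffs (vf_push a)) (fps_nth 1) r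
      = (\<Sum>n\<le>Suc r. ((- 1) ^ n / fact n) * fps_nth ((vf_push a ^^ n) 1) r)"
    by (subst graded_exp_upto[OF raising_vf_push, of r "Suc r"])
      (simp_all add: on_coeffs_pow scaleC_complex_def)
  also have "\<dots> = of_nat (Suc r) * (\<Sum>n\<le>Suc r. ((- 1) ^ n / fact n) * fps_nth ((vector_field a ^^ n) fps_X) (Suc r))"
    unfolding p sum_distrib_left by (intro sum.cong) (auto simp del: of_nat_Suc)
  finally show "graded_exp (- 1) (on_coeffs (vf_push a)) (fps_nth 1) r
      = fps_nth (fps_deriv (exp_vector_field a)) r"
    by (simp add: exp_vector_field_def del: sum.atMost_Suc)
qed

text \<open>Regard 1 + k x as the contraction of the field (1 + k x) d/dx with dx and apply exp(-X).
  As a function it becomes 1 + k f; as a contraction it becomes C f', where C d/dx is the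
  transported field. Since (1 + x) f' = 1 + k f, C = 1 + x, and inverting the exponential gives the
  claim.\<close>

lemma graded_exp_vf_bracket:
  assumes k: "k > 0" and a: "change_of_variable k a"
  shows "graded_exp 1 (on_coeffs (vf_bracket a)) (fps_nth (1 + fps_X))
    = fps_nth (1 + fps_const (of_nat k) * fps_X)"
proof -
  let ?H = "on_coeffs (vector_field a)" and ?Q = "on_coeffs (vf_bracket a)"
    and ?R = "on_coeffs (vf_push a)"
  let ?b = "1 + fps_const (of_nat k) * fps_X :: complex fps"
  have f: "exp_vector_field a = fps_cov k"
    using a by (simp add: change_of_variable_def fps_cov_def algebra_simps)
  define C where "C = Abs_fps (graded_exp (- 1) ?Q (fps_nth ?b))"
  \<comment> \<open>The Lie derivative of the contraction of a field with a one-form.\<close>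
  have leib': "vector_field a (g * h) = vf_bracket a g * h + g * vf_push a h" for g h
    by (simp add: vector_field_alt vf_bracket_def vf_push_def algebra_simps)
  have leib: "?H (graded_conv (*) S T) = (\<lambda>r. graded_conv (*) (?Q S) T r + graded_conv (*) S (?R T) r)" for S T
    by (rule ext) (simp only: graded_conv_mult fps_nth_inverse leib' fps_add_nth)
  have "graded_exp (- 1) ?H (graded_conv (*) (fps_nth ?b) (fps_nth 1)) r = fps_nth (C * fps_deriv (fps_cov k)) r" for r
  proof -
    have "graded_exp (- 1) ?H (graded_conv (*) (fps_nth ?b) (fps_nth 1)) r
        = (\<Sum>p\<le>r. \<Sum>i\<le>p. ((- 1) ^ i / fact i) *\<^sub>C ((?Q ^^ i) (fps_nth ?b) p * graded_exp (- 1) ?R (fps_nth 1) (r - p)))"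
      by (rule graded_exp_conv[where good = "\<lambda>_. True"])
        (auto simp: raising_vector_field raising_vf_push raising_pow_zero[OF raising_vf_bracket] clinear_mult leib)
    also have "\<dots> = (\<Sum>p\<le>r. graded_exp (- 1) ?Q (fps_nth ?b) p * graded_exp (- 1) ?R (fps_nth 1) (r - p))"
      by (simp add: graded_exp_def[of _ ?Q] sum_distrib_right scaleC_complex_def mult.assoc)
    finally show ?thesis
      unfolding graded_exp_vf_push f by (simp add: C_def fps_mult_nth atLeast0AtMost)
  qed
  moreover have "graded_exp (- 1) ?H (graded_conv (*) (fps_nth ?b) (fps_nth 1)) r
      = fps_nth (1 + fps_const (of_nat k) * fps_cov k) r" for r
  proof -
    have "graded_conv (*) (fps_nth ?b) (fps_nth 1) = (\<lambda>r. fps_nth 1 r + of_nat k *\<^sub>C fps_nth fps_X r)"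
      by (rule ext) (simp add: graded_conv_mult fps_nth_inverse scaleC_complex_def)
    moreover have "graded_exp (- 1) ?H (fps_nth 1) = fps_nth 1"
      by (rule graded_exp_fixed[OF _ raising_vector_field])
        (simp add: fps_nth_inverse vector_field_alt fun_eq_iff)
    ultimately show ?thesis
      by (simp only: graded_exp_add[OF raising_vector_field] graded_exp_scale[OF raising_vector_field]
          graded_exp_vector_field f) (simp add: scaleC_complex_def)
  qed
  ultimately have "C * fps_deriv (fps_cov k) = (1 + fps_X) * fps_deriv (fps_cov k)"
    unfolding fps_cov_ode[OF k] by (metis fps_ext)
  moreover have "fps_deriv (fps_cov k) \<noteq> 0"
    unfolding fps_deriv_cov[OF k]
    by (metis fps_power_zeroth fps_add_nth fps_one_nth fps_X_nth fps_zero_nth add.right_neutral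
        power_one zero_neq_one)
  ultimately have C: "C = 1 + fps_X" by simp
  have "fps_nth (1 + fps_X) = graded_exp (- 1) ?Q (fps_nth ?b)"
    unfolding C[symmetric] by (rule ext) (simp add: C_def)
  then show ?thesis
    using graded_exp_inverse[OF raising_vf_bracket, of 1 a "fps_nth ?b"] by auto
qed

context vertex_operator_superalgebra
begin

lemma vir_series_alt:
  "vir_series V a f r = (\<Sum>j\<le>r. vf_coeff a j *\<^sub>C vir V (int j) (f (r - j)))"
  unfolding vir_series_def vf_coeff_def by (intro sum.mono_neutral_cong_left) auto

lemma raising_vir_series: "raising (vir_series V a)"
  unfolding raising_def
proof (intro conjI allI impI)
  fix S T :: "nat \<Rightarrow> 'a" and r
  assume "\<forall>i<r. S i = T i"
  then have "vf_coeff a j *\<^sub>C vir V (int j) (S (r - j)) = vf_coeff a j *\<^sub>C vir V (int j) (T (r - j))"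
    if "j \<le> r" for j
    using that by (cases "j = 0") auto
  then show "vir_series V a S r = vir_series V a T r"
    unfolding vir_series_alt by (intro sum.cong refl) (simp only: atMost_iff)
qed (auto simp: vir_series_alt clinear_add[OF clinear_vir] clinear_scale[OF clinear_vir] scaleC_scaleC
    scaleC_add_right sum.distrib complex_vector.scale_sum_right mult.commute)

lemma exp_vir_eq: "exp_vir V a u r = graded_exp (- 1) (vir_series V a) (\<lambda>i. if i = 0 then u else 0) r"
  by (simp add: exp_vir_def graded_exp_def)

definition vir_ad :: "(nat \<Rightarrow> complex) \<Rightarrow> (nat \<Rightarrow> 'a \<Rightarrow> 'a) \<Rightarrow> nat \<Rightarrow> 'a \<Rightarrow> 'a"
  where "vir_ad a S p v =
    (\<Sum>j\<le>p. vf_coeff a j *\<^sub>C (vir V (int j) (S (p - j) v) - S (p - j) (vir V (int j) v)))"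

lemma vir_ad_clinear: "(\<And>i. clinear (S i)) \<Longrightarrow> clinear (vir_ad a S i)"
  by (rule clinearI) (simp_all add: vir_ad_def clinear_add clinear_add[OF clinear_vir] clinear_scale
      clinear_scale[OF clinear_vir] scaleC_scaleC scaleC_add_right sum.distrib
      complex_vector.scale_sum_right mult.commute complex_vector.scale_right_diff_distrib
      sum_subtractf algebra_simps)

lemma vir_ad_pow_zero: "p < i \<Longrightarrow> (vir_ad a ^^ i) S p v = 0"
proof (induction i arbitrary: p v)
  case (Suc i)
  have "vf_coeff a j *\<^sub>C (vir V (int j) ((vir_ad a ^^ i) S (p - j) v)
      - (vir_ad a ^^ i) S (p - j) (vir V (int j) v)) = 0" if "j \<le> p" for j
    using Suc that by (cases "j = 0") simp_all
  then show ?case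
    unfolding funpow.simps o_apply vir_ad_def[of a "(vir_ad a ^^ i) S"] by (intro sum.neutral) simp
qed simp

lemma exp_vir_conv:
  assumes "\<And>i. clinear (S i)"
  shows "graded_exp (- 1) (vir_series V a) (graded_conv (\<lambda>A. A) S T) r
    = (\<Sum>p\<le>r. \<Sum>i\<le>p. ((- 1) ^ i / fact i) *\<^sub>C
        (vir_ad a ^^ i) S p (graded_exp (- 1) (vir_series V a) T (r - p)))"
proof (rule graded_exp_conv[where good = "\<lambda>S. \<forall>i. clinear (S i)"])
  fix S :: "nat \<Rightarrow> 'a \<Rightarrow> 'a" and T
  assume S: "\<forall>i. clinear (S i)"
  show "vir_series V a (graded_conv (\<lambda>A. A) S T) =
      (\<lambda>r. graded_conv (\<lambda>A. A) (vir_ad a S) T r + graded_conv (\<lambda>A. A) S (vir_series V a T) r)"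
  proof
    fix r
    let ?F = "\<lambda>j i t. vf_coeff a j *\<^sub>C vir V (int j) (S i (T t))"
    let ?G = "\<lambda>i j t. vf_coeff a j *\<^sub>C S i (vir V (int j) (T t))"
    have "vir_series V a (graded_conv (\<lambda>A. A) S T) r = (\<Sum>j\<le>r. \<Sum>i\<le>r - j. ?F j i (r - j - i))"
      by (simp add: vir_series_alt graded_conv_def clinear_sum[OF clinear_vir] complex_vector.scale_sum_right)
    moreover have "graded_conv (\<lambda>A. A) S (vir_series V a T) r = (\<Sum>i\<le>r. \<Sum>j\<le>r - i. ?G i j (r - i - j))"
      using S by (simp add: vir_series_alt graded_conv_def clinear_sum clinear_scale)
    moreover have "graded_conv (\<lambda>A. A) (vir_ad a S) T r
        = (\<Sum>p\<le>r. \<Sum>j\<le>p. ?F j (p - j) (r - p)) - (\<Sum>p\<le>r. \<Sum>j\<le>p. ?G (p - j) j (r - p))"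
      by (simp add: graded_conv_def vir_ad_def complex_vector.scale_right_diff_distrib sum_subtractf)
    moreover have "(\<Sum>p\<le>r. \<Sum>j\<le>p. ?G (p - j) j (r - p)) = (\<Sum>p\<le>r. \<Sum>j\<le>p. ?G j (p - j) (r - p))"
      by (intro sum.cong refl sum_rev_atMost[symmetric])
    ultimately show "vir_series V a (graded_conv (\<lambda>A. A) S T) r =
      graded_conv (\<lambda>A. A) (vir_ad a S) T r + graded_conv (\<lambda>A. A) S (vir_series V a T) r"
      using sum_assoc_atMost[of ?F r] sum_assoc_atMost[of ?G r] by simp
  qed
qed (use assms in \<open>auto simp: raising_vir_series vir_ad_clinear vir_ad_pow_zero\<close>)

text \<open>The assignment of -x^(n+1) d/dx to L(n) respects brackets. It sends both the sum of a_j
  L(j) and the family on the left to minus a vector field, so the bracket of the fields reappears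
  with a minus sign in front of the L(p - 1).\<close>

lemma vir_ad_virasoro:
  "vir_ad a (\<lambda>i v. b i *\<^sub>C vir V (int i - 1) v)
    = (\<lambda>p v. (- on_coeffs (vf_bracket a) b p) *\<^sub>C vir V (int p - 1) v)"
proof (intro ext)
  fix p v
  have "vf_coeff a j *\<^sub>C (vir V (int j) (b (p - j) *\<^sub>C vir V (int (p - j) - 1) v)
      - b (p - j) *\<^sub>C vir V (int (p - j) - 1) (vir V (int j) v))
      = (- (vf_coeff a j * ((of_nat p - 2 * of_nat j - 1) * b (p - j)))) *\<^sub>C vir V (int p - 1) v"
    if "j \<le> p" for j
  proof -
    have br: "vir V (int j) (vir V (int (p - j) - 1) v) - vir V (int (p - j) - 1) (vir V (int j) v)
      = of_int (2 * int j - int p + 1) *\<^sub>C vir V (int p - 1) v" if "j \<noteq> 0"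
    proof -
      \<comment> \<open>A central term can occur only in degree p = 1, which forces j = 1, and then
        j^3 - j = 0.\<close>
      have c: "(if int j + (int (p - j) - 1) = 0 then (of_int (int j ^ 3 - int j) / 12 * c) *\<^sub>C v else 0) = 0"
      proof (cases "p = 1")
        case True
        then have "j = 1" using \<open>j \<le> p\<close> that by simp
        then show ?thesis by simp
      qed (use \<open>j \<le> p\<close> in \<open>auto simp: of_nat_diff\<close>)
      show ?thesis
        using virasoro[of "int j" "int (p - j) - 1" v] \<open>j \<le> p\<close> unfolding c
        by (simp add: of_nat_diff algebra_simps)
    qed
    show ?thesis
    proof (cases "j = 0")
      case False
      show ?thesis
        unfolding clinear_scale[OF clinear_vir] complex_vector.scale_right_diff_distrib[symmetric]
          br[OF False] scaleC_scaleC
        by (rule arg_cong[of _ _ "\<lambda>x. x *\<^sub>C _"]) (simp add: algebra_simps)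
    qed simp
  qed
  then show "vir_ad a (\<lambda>i v. b i *\<^sub>C vir V (int i - 1) v) p v
    = (- on_coeffs (vf_bracket a) b p) *\<^sub>C vir V (int p - 1) v"
    by (simp add: vir_ad_def vf_bracket_nth complex_vector.scale_sum_left flip: sum_negf)
qed

lemma vir_ad_virasoro_pow:
  "(vir_ad a ^^ n) (\<lambda>i v. b i *\<^sub>C vir V (int i - 1) v)
    = (\<lambda>p v. ((- 1) ^ n * (on_coeffs (vf_bracket a) ^^ n) b p) *\<^sub>C vir V (int p - 1) v)"
proof (induction n)
  case (Suc n)
  have "on_coeffs (vf_bracket a) (\<lambda>p. c * S p) r = c * on_coeffs (vf_bracket a) S r" for c S r
    using raising_pow_scale[OF raising_vf_bracket, of 1 a c S r] by (simp add: scaleC_complex_def)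
  then show ?case by (simp add: Suc vir_ad_virasoro)
qed (simp add: scaleC_one)

text \<open>Negative indices give \<open>0\<close>, which avoids boundary cases in the recursions below.\<close>

definition exp_vir_int :: "(nat \<Rightarrow> complex) \<Rightarrow> 'a \<Rightarrow> int \<Rightarrow> 'a"
  where "exp_vir_int a u r = (if r < 0 then 0 else exp_vir V a u (nat r))"

lemma exp_vir_shift:
  "graded_exp (- 1) (vir_series V a) (\<lambda>i. if i = 1 then u else 0) r = exp_vir_int a u (int r - 1)"
proof -
  define sh :: "(nat \<Rightarrow> 'a) \<Rightarrow> nat \<Rightarrow> 'a" where "sh S = (\<lambda>r. if r = 0 then 0 else S (r - 1))" for S
  have 1: "vir_series V a (sh S) = sh (vir_series V a S)" for S
  proof
    fix r
    show "vir_series V a (sh S) r = sh (vir_series V a S) r"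
      by (cases r) (simp_all add: vir_series_alt sh_def Suc_diff_le)
  qed
  have 2: "(vir_series V a ^^ n) (sh S) = sh ((vir_series V a ^^ n) S)" for n S
    by (induction n) (simp_all add: 1)
  have 3: "(\<lambda>i. if i = 1 then u else 0) = sh (\<lambda>i. if i = 0 then u else 0)"
    by (auto simp: sh_def)
  show ?thesis
  proof (cases r)
    case 0
    then show ?thesis by (simp add: graded_exp_0 exp_vir_int_def)
  next
    case (Suc q)
    have "graded_exp (- 1) (vir_series V a) (sh (\<lambda>i. if i = 0 then u else 0)) r
      = (\<Sum>n\<le>Suc q. ((- 1) ^ n / fact n) *\<^sub>C (vir_series V a ^^ n) (\<lambda>i. if i = 0 then u else 0) q)"
      unfolding graded_exp_def 2 by (simp add: Suc sh_def)
    also have "\<dots> = exp_vir V a u q"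
      unfolding exp_vir_eq by (rule graded_exp_upto[OF raising_vir_series, symmetric]) simp
    finally show ?thesis unfolding 3 by (simp add: Suc exp_vir_int_def)
  qed
qed

text \<open>In terms of vector fields: the exponential conjugates \<open>(1 + y) d/dy\<close> to \<open>(1 + k y) d/dy\<close>.\<close>

lemma exp_vir_intertwine:
  assumes k: "k > 0" and a: "change_of_variable k a"
  shows "exp_vir_int a (vir V (- 1) u) r + exp_vir_int a (vir V 0 u) (r - 1)
    = vir V (- 1) (exp_vir_int a u r) + of_nat k *\<^sub>C vir V 0 (exp_vir_int a u (r - 1))"
proof (cases "r < 0")
  case False
  then obtain q where r: "r = int q" by (metis nonneg_int_cases not_less)
  let ?E = "graded_exp (- 1) (vir_series V a)"
  \<comment> \<open>The coefficients of (1 + y) d/dy: L(-1) in degree 0 and L(0) in degree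
    1.\<close>
  define b where "b = fps_nth (1 + fps_X :: complex fps)"
  let ?S = "\<lambda>i v. b i *\<^sub>C vir V (int i - 1) v"
  let ?T = "\<lambda>i. if i = 0 then u else 0 :: 'a"
  have "graded_conv (\<lambda>A. A) ?S ?T
      = (\<lambda>i. (if i = 0 then vir V (- 1) u else 0) + (if i = 1 then vir V 0 u else 0))"
  proof
    fix r
    have "graded_conv (\<lambda>A. A) ?S ?T r = (\<Sum>i\<in>{r}. ?S i (?T (r - i)))"
      unfolding graded_conv_def by (intro sum.mono_neutral_right) auto
    then show "graded_conv (\<lambda>A. A) ?S ?T r
      = (if r = 0 then vir V (- 1) u else 0) + (if r = 1 then vir V 0 u else 0)"
      by (auto simp: b_def scaleC_one)
  qed
  then have "?E (graded_conv (\<lambda>A. A) ?S ?T) q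
      = exp_vir_int a (vir V (- 1) u) r + exp_vir_int a (vir V 0 u) (r - 1)"
    using exp_vir_shift[of a "vir V 0 u" q]
    by (simp add: graded_exp_add[OF raising_vir_series] exp_vir_int_def r exp_vir_eq)
  \<comment> \<open>The signs of the exponential cancel those in \<open>vir_ad_virasoro_pow\<close>,
    leaving the exponential of the bracket with parameter 1, which is known explicitly.\<close>
  moreover have "?E (graded_conv (\<lambda>A. A) ?S ?T) q
     = (\<Sum>p\<le>q. graded_exp 1 (on_coeffs (vf_bracket a)) b p *\<^sub>C vir V (int p - 1) (exp_vir V a u (q - p)))"
  proof -
    have "clinear (?S i)" for i
      by (rule clinearI) (simp_all add: clinear_add[OF clinear_vir] clinear_scale[OF clinear_vir]
          scaleC_add_right scaleC_scaleC mult.commute)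
    then show ?thesis
      by (simp add: exp_vir_conv vir_ad_virasoro_pow scaleC_scaleC graded_exp_def[of 1]
          complex_vector.scale_sum_left scaleC_complex_def flip: exp_vir_eq power_mult_distrib)
  qed
  moreover have "\<dots> = (\<Sum>p\<in>{0, 1} \<inter> {..q}. (if p = 0 then 1 else of_nat k) *\<^sub>C vir V (int p - 1) (exp_vir V a u (q - p)))"
    unfolding b_def graded_exp_vf_bracket[OF assms]
    by (intro sum.mono_neutral_cong_right) auto
  moreover have "\<dots> = vir V (- 1) (exp_vir_int a u r) + of_nat k *\<^sub>C vir V 0 (exp_vir_int a u (r - 1))"
    by (cases q) (simp_all add: r exp_vir_int_def scaleC_one nat_add_distrib)
  ultimately show ?thesis by simp
qed (simp add: exp_vir_int_def)

end

section \<open>Conjugation of vertex operators\<close>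

text \<open>Coefficient form of (1 + y) h_j' = j h_(j-1) + (c + j k) h_j, a consequence of
  \<open>fps_cov_ode\<close>.\<close>

lemma fps_cov_power_ode:
  fixes c :: complex
  assumes k: "k > 0"
  defines "h \<equiv> \<lambda>j. fps_cov k ^ j * fps_binomial c"
  shows "of_nat (Suc n) * fps_nth (h j) (Suc n)
    = of_nat j * fps_nth (h (j - 1)) n + (c + of_nat j * of_nat k - of_nat n) * fps_nth (h j) n"
proof -
  have g: "(1 + fps_X) * fps_deriv (fps_binomial c) = fps_const c * fps_binomial c"
  proof -
    have b: "fps_binomial c = (1 + fps_X) * fps_binomial (c - 1)"
      using fps_binomial_add_mult[of 1 "c - 1"] by (simp add: fps_binomial_1)
    have "(1 + fps_X) * fps_deriv (fps_binomial c) = fps_const c * ((1 + fps_X) * fps_binomial (c - 1))"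
      by (simp only: fps_deriv_binomial mult_ac)
    then show ?thesis by (simp only: b[symmetric])
  qed
  have f: "(1 + fps_X) * fps_deriv (fps_cov k ^ j)
      = of_nat j * fps_cov k ^ (j - 1) + of_nat j * of_nat k * fps_cov k ^ j"
  proof (cases j)
    case (Suc i)
    have "(1 + fps_X) * fps_deriv (fps_cov k ^ j)
        = of_nat j * fps_cov k ^ i * ((1 + fps_X) * fps_deriv (fps_cov k))"
      by (simp only: Suc fps_deriv_power diff_Suc_1 mult_ac fps_of_nat)
    also have "\<dots> = of_nat j * fps_cov k ^ i * (1 + fps_const (of_nat k) * fps_cov k)"
      by (simp only: fps_cov_ode[OF k])
    finally show ?thesis
      by (simp add: Suc fps_of_nat algebra_simps)
  qed simp
  have "(1 + fps_X) * fps_deriv (h j) = ((1 + fps_X) * fps_deriv (fps_cov k ^ j)) * fps_binomial c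
      + fps_cov k ^ j * ((1 + fps_X) * fps_deriv (fps_binomial c))"
    by (simp add: h_def algebra_simps)
  also have "\<dots> = fps_const (of_nat j) * h (j - 1) + fps_const (c + of_nat j * of_nat k) * h j"
    unfolding f g by (simp add: h_def algebra_simps fps_of_nat flip: fps_const_add fps_const_mult)
  finally have eq: "fps_deriv (h j) + fps_X * fps_deriv (h j)
      = fps_const (of_nat j) * h (j - 1) + fps_const (c + of_nat j * of_nat k) * h j"
    by (simp add: distrib_right)
  from arg_cong[OF eq, of "\<lambda>f. fps_nth f n"]
  have "of_nat (Suc n) * fps_nth (h j) (Suc n) + of_nat n * fps_nth (h j) n
      = of_nat j * fps_nth (h (j - 1)) n + (c + of_nat j * of_nat k) * fps_nth (h j) n"
    by (simp only: fps_add_nth fps_X_deriv_nth fps_deriv_nth fps_mult_left_const_nth Suc_eq_plus1)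
  then show ?thesis by (simp add: algebra_simps)
qed

context vertex_operator_superalgebra
begin

lemma clinear_exp_vir: "clinear (\<lambda>u. exp_vir V a u r)"
proof (rule clinearI)
  fix x y :: 'a and c
  have "(\<lambda>i::nat. if i = 0 then x + y else 0) = (\<lambda>i. (if i = 0 then x else 0) + (if i = 0 then y else 0))"
    by auto
  then show "exp_vir V a (x + y) r = exp_vir V a x r + exp_vir V a y r"
    unfolding exp_vir_eq by (simp only: graded_exp_add[OF raising_vir_series])
  have "(\<lambda>i::nat. if i = 0 then c *\<^sub>C x else 0) = (\<lambda>i. c *\<^sub>C (if i = 0 then x else 0))"
    by auto
  then show "exp_vir V a (c *\<^sub>C x) r = c *\<^sub>C exp_vir V a x r"
    unfolding exp_vir_eq by (simp only: graded_exp_scale[OF raising_vir_series])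
qed

lemma clinear_exp_vir_int: "clinear (\<lambda>u. exp_vir_int a u r)"
  by (cases "r < 0") (simp_all add: exp_vir_int_def clinear_exp_vir clinearI)

lemma exp_vir_wsp: "u \<in> wsp V m \<Longrightarrow> exp_vir V a u r \<in> wsp V (m - 2 * int r)"
proof -
  assume u: "u \<in> wsp V m"
  note sub = direct_sum_subspace[OF grading]
  have "(vir_series V a ^^ n) (\<lambda>i. if i = 0 then u else 0) i \<in> wsp V (m - 2 * int i)" for n i
  proof (induction n arbitrary: i)
    case 0
    then show ?case using u complex_vector.subspace_0[OF sub] by auto
  next
    case (Suc n)
    have "vf_coeff a j *\<^sub>C vir V (int j) ((vir_series V a ^^ n) (\<lambda>i. if i = 0 then u else 0) (i - j))
        \<in> wsp V (m - 2 * int i)" if "j \<le> i" for j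
      using wsp_vir[OF Suc, of "int j" "i - j"] that
      by (auto intro!: complex_vector.subspace_scale[OF sub] simp: of_nat_diff)
    then show ?case
      unfolding funpow.simps o_apply
      by (subst vir_series_alt) (rule complex_vector.subspace_sum[OF sub], simp)
  qed
  then show ?thesis
    unfolding exp_vir_def
    by (intro complex_vector.subspace_sum[OF sub] complex_vector.subspace_scale[OF sub])
qed

lemma exp_vir_int_wsp: "u \<in> wsp V m \<Longrightarrow> exp_vir_int a u r \<in> wsp V (m - 2 * r)"
  using exp_vir_wsp[of u m a "nat r"] complex_vector.subspace_0[OF direct_sum_subspace[OF grading]]
  by (auto simp: exp_vir_int_def)

lemma exp_vir_vac: "exp_vir V a (vac V) r = (if r = 0 then vac V else 0)"
proof -
  have "vir_series V a (\<lambda>i. if i = 0 then vac V else 0) = (\<lambda>_. 0)"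
    by (rule ext) (auto simp: vir_series_alt intro!: sum.neutral)
  from graded_exp_fixed[OF this raising_vir_series, of "- 1"] show ?thesis
    unfolding exp_vir_eq by simp
qed

text \<open>With the degrees r kept apart, this is the coefficient of y^n in exp(-L_a) exp(y L(-1))
  u = exp(f(y) L(-1)) (1 + y)^(k L(0)) exp(-L_a) (1 + y)^(-L(0)) u. The exponent in \<open>g\<close>
  is k (wt u - r) - wt u. In the induction on n, \<open>exp_vir_intertwine\<close> and
  \<open>fps_cov_power_ode\<close> give the same recursion for the two sides.\<close>

lemma exp_vir_L_minus_1_pow:
  assumes k: "k > 0" and a: "change_of_variable k a" and u: "u \<in> wsp V m"
  defines "g \<equiv> \<lambda>r. fps_binomial ((of_nat k - 1) * (of_int m / 2) - of_nat k * of_int r)"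
  shows "(1 / fact n) *\<^sub>C exp_vir_int a ((vir V (- 1) ^^ n) u) r
    = (\<Sum>j\<le>n. (fps_nth (fps_cov k ^ j * g (r + int j - int n)) n / fact j) *\<^sub>C
        (vir V (- 1) ^^ j) (exp_vir_int a u (r + int j - int n)))"
proof (induction n arbitrary: r)
  case 0
  then show ?case by (simp add: g_def)
next
  case (Suc n)
  let ?L = "vir V (- 1)"
  let ?w = "(?L ^^ n) u"
  let ?C = "\<lambda>n j r. fps_nth (fps_cov k ^ j * g r) n / fact j"
  let ?x = "\<lambda>j. (?L ^^ j) (exp_vir_int a u (r + int j - int (Suc n)))"
  \<comment> \<open>The contributions of the two L(0) terms: k times the weight of the degree r - 1
    part of the exponential of \<open>?w\<close>, minus the weight of \<open>?w\<close>.\<close>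
  let ?l = "of_nat k * (of_int m / 2 + of_nat n - of_int r + 1) - of_int m / 2 - of_nat n :: complex"
  have idx: "r + int (Suc j) - int (Suc n) = r + int j - int n" for j
    by simp
  have w: "?w \<in> wsp V (m + 2 * int n)"
  proof (induction n)
    case (Suc n)
    then show ?case using wsp_vir[OF Suc, of "- 1"] by (simp add: algebra_simps)
  qed (simp add: u)
  have w0: "vir V 0 ?w = (of_int m / 2 + of_nat n) *\<^sub>C ?w"
    using weight[OF w] by (simp add: field_simps)
  have e0: "vir V 0 (exp_vir_int a ?w (r - 1))
      = (of_int m / 2 + of_nat n - of_int r + 1) *\<^sub>C exp_vir_int a ?w (r - 1)"
    using weight[OF exp_vir_int_wsp[OF w, of a "r - 1"]] by (simp add: field_simps)
  have "exp_vir_int a (?L ?w) r = ?L (exp_vir_int a ?w r)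
      + of_nat k *\<^sub>C vir V 0 (exp_vir_int a ?w (r - 1)) - exp_vir_int a (vir V 0 ?w) (r - 1)"
    using exp_vir_intertwine[OF k a, of ?w r] by (simp add: algebra_simps)
  also have "\<dots> = ?L (exp_vir_int a ?w r) + ?l *\<^sub>C exp_vir_int a ?w (r - 1)"
    unfolding w0 e0 clinear_scale[OF clinear_exp_vir_int]
    by (simp add: scaleC_scaleC complex_vector.scale_left_diff_distrib algebra_simps)
  finally have "(1 / fact n) *\<^sub>C exp_vir_int a (?L ?w) r
      = ?L ((1 / fact n) *\<^sub>C exp_vir_int a ?w r) + ?l *\<^sub>C ((1 / fact n) *\<^sub>C exp_vir_int a ?w (r - 1))"
    by (simp add: clinear_scale[OF clinear_vir] scaleC_add_right scaleC_scaleC mult.commute)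
  also have "?L ((1 / fact n) *\<^sub>C exp_vir_int a ?w r)
      = (\<Sum>j\<le>n. ?C n j (r + int j - int n) *\<^sub>C ?x (Suc j))"
    unfolding Suc.IH
    by (simp only: clinear_sum[OF clinear_vir] clinear_scale[OF clinear_vir] idx funpow.simps o_apply)
  also have "\<dots> = (\<Sum>j\<le>Suc n. (if j = 0 then 0 else ?C n (j - 1) (r + int j - int (Suc n))) *\<^sub>C ?x j)"
    by (subst sum.atMost_Suc_shift)
      (simp only: idx nat.distinct if_False diff_Suc_1 if_True complex_vector.scale_zero_left add_0 simp_thms)
  also have "?l *\<^sub>C ((1 / fact n) *\<^sub>C exp_vir_int a ?w (r - 1))
      = (\<Sum>j\<le>n. (?l * ?C n j (r + int j - int (Suc n))) *\<^sub>C ?x j)"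
    unfolding Suc.IH[of "r - 1"] by (simp add: complex_vector.scale_sum_right scaleC_scaleC algebra_simps)
  \<comment> \<open>The term j = n + 1 can be added because f^(n+1) has no coefficient in degree
    n.\<close>
  also have "\<dots> = (\<Sum>j\<le>Suc n. (?l * ?C n j (r + int j - int (Suc n))) *\<^sub>C ?x j)"
  proof -
    have "fps_nth (fps_cov k ^ Suc n * h) n = 0" for h
      by (simp add: fps_cov_eq power_mult_distrib mult.assoc fps_X_power_mult_nth del: power_Suc)
    then show ?thesis by simp
  qed
  also have "(\<Sum>j\<le>Suc n. (if j = 0 then 0 else ?C n (j - 1) (r + int j - int (Suc n))) *\<^sub>C ?x j) + \<dots>
      = (\<Sum>j\<le>Suc n. (of_nat (Suc n) * ?C (Suc n) j (r + int j - int (Suc n))) *\<^sub>C ?x j)"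
    unfolding sum.distrib[symmetric] scaleC_add_left[symmetric]
  proof (intro sum.cong refl arg_cong[of _ _ "\<lambda>c. c *\<^sub>C _"])
    fix j
    define q where "q = r + int j - int (Suc n)"
    have l: "?l = (of_nat k - 1) * (of_int m / 2) - of_nat k * of_int q + of_nat j * of_nat k - of_nat n"
      by (simp add: q_def field_simps)
    have f: "of_nat j / (fact j :: complex) = (if j = 0 then 0 else 1 / fact (j - 1))"
      by (cases j) (simp_all add: field_simps del: of_nat_Suc)
    have "of_nat (Suc n) * ?C (Suc n) j q
        = of_nat j / fact j * fps_nth (fps_cov k ^ (j - 1) * g q) n + ?l * ?C n j q"
      using fps_cov_power_ode[OF k, of n j "(of_nat k - 1) * (of_int m / 2) - of_nat k * of_int q"]
      unfolding l g_def by (simp add: add_divide_distrib)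
    then show "(if j = 0 then 0 else ?C n (j - 1) (r + int j - int (Suc n)))
        + ?l * ?C n j (r + int j - int (Suc n))
        = of_nat (Suc n) * ?C (Suc n) j (r + int j - int (Suc n))"
      unfolding f q_def[symmetric] by simp
  qed
  finally have "(1 / fact n) *\<^sub>C exp_vir_int a (?L ?w) r
      = (of_nat (Suc n)) *\<^sub>C (\<Sum>j\<le>Suc n. ?C (Suc n) j (r + int j - int (Suc n)) *\<^sub>C ?x j)"
    by (simp only: complex_vector.scale_sum_right scaleC_scaleC)
  then have "(1 / of_nat (Suc n)) *\<^sub>C ((1 / fact n) *\<^sub>C exp_vir_int a (?L ?w) r)
      = (\<Sum>j\<le>Suc n. ?C (Suc n) j (r + int j - int (Suc n)) *\<^sub>C ?x j)"
    by (simp add: scaleC_scaleC scaleC_one del: of_nat_Suc sum.atMost_Suc)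
  then show ?case
    by (simp add: scaleC_scaleC mult.commute del: of_nat_Suc sum.atMost_Suc)
qed

text \<open>Coefficient families of the fields given by finite sums of x^p Y(U_p, x) with p >= 0. It
  matters that the vectors U_p do not depend on n: this is what lets the action on the vacuum
  determine the family.\<close>

definition mode_span :: "(int \<Rightarrow> 'a \<Rightarrow> 'a) \<Rightarrow> bool"
  where "mode_span A \<longleftrightarrow> (\<exists>N U. \<forall>n v. A n v = (\<Sum>p<N. mode V (U p) (n + int p) v))"

lemma mode_spanI: "(\<And>n v. A n v = (\<Sum>p<N. mode V (U p) (n + int p) v)) \<Longrightarrow> mode_span A"
  unfolding mode_span_def by blast

lemma mode_span_0: "mode_span (\<lambda>n v. 0)"
  by (rule mode_spanI[where N = 0]) simp

lemma mode_span_mode: "mode_span (\<lambda>n v. mode V w (n + int d) v)"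
proof (rule mode_spanI)
  fix n v
  have "(\<Sum>p<Suc d. mode V (if p = d then w else 0) (n + int p) v)
      = (\<Sum>p\<in>{d}. mode V (if p = d then w else 0) (n + int p) v)"
    by (intro sum.mono_neutral_right) auto
  then show "mode V w (n + int d) v = (\<Sum>p<Suc d. mode V (if p = d then w else 0) (n + int p) v)"
    by simp
qed

lemma mode_span_add:
  assumes "mode_span A" "mode_span B" shows "mode_span (\<lambda>n v. A n v + B n v)"
proof -
  obtain N U where A: "A n v = (\<Sum>p<N. mode V (U p) (n + int p) v)" for n v
    using assms(1) unfolding mode_span_def by blast
  obtain N' U' where B: "B n v = (\<Sum>p<N'. mode V (U' p) (n + int p) v)" for n v
    using assms(2) unfolding mode_span_def by blast
  show ?thesis
  proof (rule mode_spanI)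
    fix n v
    let ?K = "max N N'"
    have "A n v = (\<Sum>p<?K. mode V (if p < N then U p else 0) (n + int p) v)"
      unfolding A by (rule sum.mono_neutral_cong_left) auto
    moreover have "B n v = (\<Sum>p<?K. mode V (if p < N' then U' p else 0) (n + int p) v)"
      unfolding B by (rule sum.mono_neutral_cong_left) auto
    ultimately show "A n v + B n v = (\<Sum>p<?K. mode V ((if p < N then U p else 0)
        + (if p < N' then U' p else 0)) (n + int p) v)"
      by (simp only: clinear_add[OF linear_left] sum.distrib)
  qed
qed

lemma mode_span_scale: "mode_span A \<Longrightarrow> mode_span (\<lambda>n v. t *\<^sub>C A n v)"
  unfolding mode_span_def
proof (elim exE)
  fix N U assume A: "\<forall>n v. A n v = (\<Sum>p<N. mode V (U p) (n + int p) v)"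
  show "\<exists>N U. \<forall>n v. t *\<^sub>C A n v = (\<Sum>p<N. mode V (U p) (n + int p) v)"
    by (rule exI[of _ N], rule exI[of _ "\<lambda>p. t *\<^sub>C U p"])
      (simp add: A complex_vector.scale_sum_right clinear_scale[OF linear_left])
qed

lemma mode_span_sum: "(\<And>i. i \<in> I \<Longrightarrow> mode_span (A i)) \<Longrightarrow> mode_span (\<lambda>n v. \<Sum>i\<in>I. A i n v)"
  by (induction I rule: infinite_finite_induct) (simp_all add: mode_span_0 mode_span_add)

text \<open>The commutator formula shifts the mode index by j + 1 - i with 0 <= i <= j + 1, so no
  negative shift arises.\<close>

lemma mode_span_commutator:
  assumes "mode_span A"
  shows "mode_span (\<lambda>n v. vir V (int j) (A n v) - A n (vir V (int j) v))"
proof -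
  obtain N U where A: "A n v = (\<Sum>p<N. mode V (U p) (n + int p) v)" for n v
    using assms unfolding mode_span_def by blast
  have "mode_span (\<lambda>n v. \<Sum>p<N. \<Sum>i\<le>Suc j. of_nat (Suc j choose i) *\<^sub>C
      mode V (vir V (int i - 1) (U p)) (n + int (p + Suc j - i)) v)"
    by (intro mode_span_sum mode_span_scale mode_span_mode)
  moreover have "(\<lambda>n v. \<Sum>p<N. \<Sum>i\<le>Suc j. of_nat (Suc j choose i) *\<^sub>C
      mode V (vir V (int i - 1) (U p)) (n + int (p + Suc j - i)) v)
    = (\<lambda>n v. vir V (int j) (A n v) - A n (vir V (int j) v))"
  proof (intro ext)
    fix n v
    have "(\<Sum>i\<le>Suc j. of_nat (Suc j choose i) *\<^sub>C mode V (vir V (int i - 1) (U p)) (n + int (p + Suc j - i)) v)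
        = vir V (int j) (mode V (U p) (n + int p) v) - mode V (U p) (n + int p) (vir V (int j) v)" for p
      using vir_mode_commutator[of "Suc j" "U p" "n + int p" v]
      by (auto simp: of_nat_diff add_ac add_diff_eq intro!: sum.cong simp del: sum.atMost_Suc)
    then show "(\<Sum>p<N. \<Sum>i\<le>Suc j. of_nat (Suc j choose i) *\<^sub>C
        mode V (vir V (int i - 1) (U p)) (n + int (p + Suc j - i)) v)
      = vir V (int j) (A n v) - A n (vir V (int j) v)"
      by (simp add: A clinear_sum[OF clinear_vir] sum_subtractf)
  qed
  ultimately show ?thesis by simp
qed

text \<open>Coefficients that are polynomial in the mode index are allowed: (L(-1) w)_(n+d+1) = -(n
  + d + 1) w_(n+d) trades one factor of the binomial for a larger shift.\<close>

lemma mode_span_gbinomial: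
  "mode_span (\<lambda>n v. ((- of_int n - of_nat d - 1) gchoose i) *\<^sub>C mode V w (n + int d) v)"
proof (induction i arbitrary: d w)
  case 0
  then show ?case using mode_span_mode by (simp add: scaleC_one)
next
  case (Suc i)
  have "((- of_int n - of_nat d - 1) gchoose Suc i) *\<^sub>C mode V w (n + int d) v
    = (1 / of_nat (Suc i)) *\<^sub>C (((- of_int n - of_nat (Suc d) - 1) gchoose i) *\<^sub>C
        mode V (vir V (- 1) w) (n + int (Suc d)) v)" for n v
  proof -
    let ?x = "- of_int n - of_nat d - 1 :: complex"
    have 1: "?x gchoose Suc i = ?x / of_nat (Suc i) * ((?x - 1) gchoose i)"
      using gbinomial_absorption'[of "Suc i" ?x] by simp
    have 2: "- of_int n - of_nat (Suc d) - 1 = ?x - 1" by simp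
    have 3: "- of_int (n + int (Suc d)) = ?x" "n + int (Suc d) - 1 = n + int d" by simp_all
    show ?thesis
      unfolding 1 2 derivative 3 scaleC_scaleC by (simp add: mult_ac del: of_nat_Suc)
  qed
  then show ?case
    by (simp only: mode_span_scale[OF Suc])
qed

text \<open>On the vacuum, (U_q)_(-1-p+q) is 0 for q > p and U_p for q = p. So the value at index -1
  - p yields U_p once the earlier vectors are known to vanish.\<close>

lemma mode_span_eq_0:
  assumes "mode_span A" and vac: "\<And>n. A n (vac V) = 0"
  shows "A n v = 0"
proof -
  obtain N U where A: "A n v = (\<Sum>p<N. mode V (U p) (n + int p) v)" for n v
    using assms(1) unfolding mode_span_def by blast
  have "U p = 0" if "p < N" for p
    using that
  proof (induction p rule: less_induct)
    case (less p)
    have "mode V (U q) (- 1 - int p + int q) (vac V) = (if q = p then U p else 0)" if "q < N" for q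
      using that less.IH[of q] creation by (cases q p rule: linorder_cases) auto
    then have "A (- 1 - int p) (vac V) = (\<Sum>q<N. if q = p then U p else 0)"
      unfolding A by (intro sum.cong) auto
    then show ?case using vac less.prems by simp
  qed
  then show ?thesis by (simp add: A)
qed

lemma mode_span_eqI:
  assumes "mode_span A" "mode_span B" and vac: "\<And>n. A n (vac V) = B n (vac V)"
  shows "A n v = B n v"
proof -
  have "mode_span (\<lambda>n v. A n v + (- 1) *\<^sub>C B n v)"
    by (intro mode_span_add mode_span_scale assms)
  from mode_span_eq_0[OF this, of n v] show ?thesis
    by (simp add: vac scaleC_one)
qed

end

text \<open>The coefficient of \<open>y\<^bsup>d\<^esup>\<close> in \<open>(f(y)/y)\<^bsup>-n-d-1\<^esup> (1 + y)\<^bsup>(k-1) wt u - k r\<^esup>\<close> for \<open>f = fps_cov k\<close> and \<open>wt u = m/2\<close>,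
  where \<open>f\<^bsup>-n-d-1\<^esup>\<close> belongs to the mode \<open>n + d\<close> of \<open>Y(\<cdot>, f(y))\<close>.\<close>

definition hom_coeff :: "nat \<Rightarrow> int \<Rightarrow> int \<Rightarrow> nat \<Rightarrow> nat \<Rightarrow> complex"
  where "hom_coeff k m n d r = fps_nth (fps_pw (fps_covu k) (- of_int n - of_nat d - 1)
    * fps_binomial ((of_nat k - 1) * (of_int m / 2) - of_nat k * of_nat r)) d"

context vertex_operator_superalgebra
begin

text \<open>A fixed coefficient of a power of f(y)/y is a combination of binomials of the exponent,
  hence polynomial in n.\<close>

lemma mode_span_hom_coeff:
  assumes k: "k > 0"
  shows "mode_span (\<lambda>n v. hom_coeff k m n d r *\<^sub>C mode V w (n + int d) v)"
proof -
  let ?g = "fps_binomial ((of_nat k - 1) * (of_int m / 2) - of_nat k * of_nat r)"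
  have "hom_coeff k m n d r
      = (\<Sum>i\<le>d. fps_nth (?g * (fps_covu k - 1) ^ i) d * ((- of_int n - of_nat d - 1) gchoose i))" for n
    unfolding hom_coeff_def fps_pw_def mult.commute[of _ ?g] using k
    by (subst fps_mult_compose_nth) (simp_all add: mult.commute)
  then have "(\<lambda>n v. hom_coeff k m n d r *\<^sub>C mode V w (n + int d) v)
    = (\<lambda>n v. \<Sum>i\<le>d. fps_nth (?g * (fps_covu k - 1) ^ i) d *\<^sub>C
        (((- of_int n - of_nat d - 1) gchoose i) *\<^sub>C mode V w (n + int d) v))"
    by (simp add: complex_vector.scale_sum_left scaleC_scaleC)
  moreover have "mode_span \<dots>"
    by (intro mode_span_sum mode_span_scale mode_span_gbinomial)
  ultimately show ?thesis by (simp only:)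
qed

text \<open>Both sides are families of operators in \<open>mode_span\<close> applied to the exponential of \<open>v\<close>, and such a family is
  determined by its values on the vacuum.\<close>

lemma exp_vir_mode:
  assumes k: "k > 0" and a: "change_of_variable k a" and u: "u \<in> wsp V m"
  shows "exp_vir V a (mode V u n v) r
    = (\<Sum>p\<le>r. \<Sum>d\<le>p. hom_coeff k m n d (p - d) *\<^sub>C
        mode V (exp_vir V a u (p - d)) (n + int d) (exp_vir V a v (r - p)))"
proof -
  define S :: "int \<Rightarrow> nat \<Rightarrow> 'a \<Rightarrow> 'a" where "S n i = (if i = 0 then mode V u n else (\<lambda>_. 0))" for n i
  \<comment> \<open>The degree p part of the conjugate of the mode u_n by exp(-L_a).\<close>
  define A where "A p n v = (\<Sum>i\<le>p. ((- 1) ^ i / fact i) *\<^sub>C (vir_ad a ^^ i) (S n) p v)" for p n v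
  have A: "exp_vir V a (mode V u n v) r = (\<Sum>p\<le>r. A p n (exp_vir V a v (r - p)))" for n v r
  proof -
    have "graded_conv (\<lambda>A. A) (S n) (\<lambda>i. if i = 0 then v else 0) = (\<lambda>i. if i = 0 then mode V u n v else 0)"
    proof
      fix r
      have "graded_conv (\<lambda>A. A) (S n) (\<lambda>i. if i = 0 then v else 0) r
          = (\<Sum>i\<in>{0}. S n i (if r - i = 0 then v else 0))"
        unfolding graded_conv_def by (rule sum.mono_neutral_right) (auto simp: S_def)
      then show "graded_conv (\<lambda>A. A) (S n) (\<lambda>i. if i = 0 then v else 0) r
          = (if r = 0 then mode V u n v else 0)"
        by (simp add: S_def)
    qed
    moreover have "clinear (S n i)" for i
      by (simp add: S_def linear_right clinearI)
    ultimately show ?thesis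
      using exp_vir_conv[of "S n" a "\<lambda>i. if i = 0 then v else 0" r]
      by (simp add: A_def exp_vir_eq)
  qed
  have spanA: "mode_span (A p)" for p
  proof -
    have "mode_span (\<lambda>n v. (vir_ad a ^^ i) (S n) p v)" for i p
    proof (induction i arbitrary: p)
      case 0
      then show ?case using mode_span_mode[of u 0] by (cases "p = 0") (simp_all add: S_def mode_span_0)
    next
      case (Suc i)
      have "mode_span (\<lambda>n v. \<Sum>j\<le>p. vf_coeff a j *\<^sub>C (vir V (int j) ((vir_ad a ^^ i) (S n) (p - j) v)
          - (vir_ad a ^^ i) (S n) (p - j) (vir V (int j) v)))"
        by (intro mode_span_sum mode_span_scale mode_span_commutator Suc)
      then show ?case unfolding funpow.simps o_apply vir_ad_def[of a "(vir_ad a ^^ i) _"] .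
    qed
    then have "mode_span (\<lambda>n v. \<Sum>i\<le>p. ((- 1) ^ i / fact i) *\<^sub>C (vir_ad a ^^ i) (S n) p v)"
      by (intro mode_span_sum mode_span_scale)
    then show ?thesis by (simp add: A_def[abs_def])
  qed
  define B where "B p n v = (\<Sum>d\<le>p. hom_coeff k m n d (p - d) *\<^sub>C
        mode V (exp_vir V a u (p - d)) (n + int d) v)" for p n v
  have spanB: "mode_span (B p)" for p
  proof -
    have "mode_span (\<lambda>n v. \<Sum>d\<le>p. hom_coeff k m n d (p - d) *\<^sub>C
        mode V (exp_vir V a u (p - d)) (n + int d) v)"
      by (intro mode_span_sum mode_span_hom_coeff k)
    then show ?thesis by (simp add: B_def[abs_def])
  qed
  \<comment> \<open>Since exp(-L_a) fixes the vacuum, the conjugate of u_n acts on it as exp(-L_a)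
    acts on u_n 1.\<close>
  have vacA: "A p n (vac V) = exp_vir V a (mode V u n (vac V)) p" for p n
  proof -
    have "A q n 0 = 0" for q
      using spanA[of q] by (auto simp: mode_span_def)
    then have "(\<Sum>q\<le>p. A q n (exp_vir V a (vac V) (p - q))) = (\<Sum>q\<in>{p}. A q n (exp_vir V a (vac V) (p - q)))"
      by (intro sum.mono_neutral_right) (auto simp: exp_vir_vac)
    then show ?thesis unfolding A[of n "vac V" p] by (simp add: exp_vir_vac)
  qed
  have vac: "A p n (vac V) = B p n (vac V)" for p n
  proof (cases "n \<ge> 0")
    case True
    then show ?thesis
      by (simp add: vacA B_def creation clinear_0[OF clinear_exp_vir])
  next
    case False
    define N where "N = nat (- 1 - n)"
    have n: "n = - 1 - int N" using False by (simp add: N_def)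
    let ?L = "vir V (- 1)"
    let ?g = "\<lambda>r. fps_binomial ((of_nat k - 1) * (of_int m / 2) - of_nat k * of_int r)"
    have "A p n (vac V) = (1 / fact N) *\<^sub>C exp_vir_int a ((?L ^^ N) u) (int p)"
      unfolding vacA n mode_vac clinear_scale[OF clinear_exp_vir] by (simp add: exp_vir_int_def)
    also have "\<dots> = (\<Sum>j\<le>N. (fps_nth (fps_cov k ^ j * ?g (int p + int j - int N)) N / fact j) *\<^sub>C
        (?L ^^ j) (exp_vir_int a u (int p + int j - int N)))"
      by (rule exp_vir_L_minus_1_pow[OF k a u])
    also have "\<dots> = (\<Sum>d\<le>N. (fps_nth (fps_cov k ^ (N - d) * ?g (int p - int d)) N / fact (N - d)) *\<^sub>C
        (?L ^^ (N - d)) (exp_vir_int a u (int p - int d)))"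
      by (rule sum.reindex_bij_witness[of _ "\<lambda>j. N - j" "\<lambda>j. N - j"])
        (auto simp: of_nat_diff diff_diff_eq2)
    also have "\<dots> = (\<Sum>d\<in>{..N} \<inter> {..p}. (fps_nth (fps_cov k ^ (N - d) * ?g (int p - int d)) N / fact (N - d)) *\<^sub>C
        (?L ^^ (N - d)) (exp_vir_int a u (int p - int d)))"
    proof (rule sum.mono_neutral_right)
      have L0: "(?L ^^ i) 0 = 0" for i by (induction i) auto
      show "\<forall>d\<in>{..N} - {..N} \<inter> {..p}. (fps_nth (fps_cov k ^ (N - d) * ?g (int p - int d)) N / fact (N - d)) *\<^sub>C
        (?L ^^ (N - d)) (exp_vir_int a u (int p - int d)) = 0"
        by (auto simp: exp_vir_int_def L0)
    qed auto
    also have "\<dots> = (\<Sum>d\<in>{..N} \<inter> {..p}. hom_coeff k m n d (p - d) *\<^sub>C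
        mode V (exp_vir V a u (p - d)) (n + int d) (vac V))"
    proof (rule sum.cong[OF refl])
      fix d assume d: "d \<in> {..N} \<inter> {..p}"
      \<comment> \<open>For n = -1 - N the exponent is the natural number N - d, and f^(N-d) =
        y^(N-d) (f/y)^(N-d) moves the coefficient of y^N to that of y^d.\<close>
      have pw: "fps_pw (fps_covu k) (- of_int n - of_nat d - 1) = fps_covu k ^ (N - d)"
        using d fps_pw_of_nat[of "fps_covu k" "N - d"] k by (simp add: n of_nat_diff algebra_simps)
      have "hom_coeff k m n d (p - d) = fps_nth (fps_cov k ^ (N - d) * ?g (int p - int d)) N"
        using d unfolding hom_coeff_def pw
        by (simp add: fps_cov_eq power_mult_distrib mult.assoc fps_X_power_mult_nth of_nat_diff)
      moreover have "n + int d = - 1 - int (N - d)" using d by (simp add: n of_nat_diff)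
      moreover have "exp_vir_int a u (int p - int d) = exp_vir V a u (p - d)"
        using d by (simp add: exp_vir_int_def nat_diff_distrib)
      ultimately show "(fps_nth (fps_cov k ^ (N - d) * ?g (int p - int d)) N / fact (N - d)) *\<^sub>C
          (?L ^^ (N - d)) (exp_vir_int a u (int p - int d))
        = hom_coeff k m n d (p - d) *\<^sub>C mode V (exp_vir V a u (p - d)) (n + int d) (vac V)"
        by (simp add: mode_vac scaleC_scaleC)
    qed
    also have "\<dots> = B p n (vac V)"
      unfolding B_def by (rule sum.mono_neutral_left) (auto simp: n creation)
    finally show ?thesis .
  qed
  show ?thesis
    unfolding A by (intro sum.cong refl) (simp only: mode_span_eqI[OF spanA spanB vac] B_def)
qed

end

section \<open>Vertex operators of single tensor factors\<close>

lemma tens_linear: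
  assumes "length us = CARD('k)" "p < CARD('k)"
  shows "clinear (\<lambda>a. tens (us[p := a]) :: ('a::complex_vector, 'k) tensor_power)"
proof (rule clinearI)
  fix x y :: 'a and c :: complex
  let ?xs = "take p us" and ?ys = "drop (Suc p) us"
  have len: "length ?xs + length ?ys + 1 = CARD('k)" using assms by simp
  have upd: "us[p := a] = ?xs @ a # ?ys" for a using assms by (simp add: upd_conv_take_nth_drop)
  have add: "tens (xs @ (x + y) # ys) = (tens (xs @ x # ys) + tens (xs @ y # ys) :: ('a, 'k) tensor_power)"
    if "length xs + length ys + 1 = CARD('k)" for xs ys
    using that
  proof transfer
    fix xs ys :: "'a list" and x y
    assume "length xs + length ys + 1 = CARD('k)"
    then have "Poly_Mapping.single (xs @ (x + y) # ys) 1 - Poly_Mapping.single (xs @ x # ys) 1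
        - Poly_Mapping.single (xs @ y # ys) 1 \<in> (tensor_rels CARD('k) :: ('a list \<Rightarrow>\<^sub>0 complex) set)"
      unfolding tensor_rels_def by blast
    then show "tensor_eq TYPE('k) (Poly_Mapping.single (xs @ (x + y) # ys) 1)
        (Poly_Mapping.single (xs @ x # ys) 1 + Poly_Mapping.single (xs @ y # ys) 1)"
      unfolding tensor_eq_def diff_diff_eq[symmetric] by (rule complex_vector.span_base)
  qed
  then show "tens (us[p := x + y]) = (tens (us[p := x]) + tens (us[p := y]) :: ('a, 'k) tensor_power)"
    unfolding upd using len by blast
  have scale: "tens (xs @ (c *\<^sub>C x) # ys) = (c *\<^sub>C tens (xs @ x # ys) :: ('a, 'k) tensor_power)"
    if "length xs + length ys + 1 = CARD('k)" for xs ys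
    using that
  proof transfer
    fix xs ys :: "'a list" and c x
    assume "length xs + length ys + 1 = CARD('k)"
    then have "Poly_Mapping.single (xs @ (c *\<^sub>C x) # ys) 1 - c *\<^sub>C Poly_Mapping.single (xs @ x # ys) 1
        \<in> (tensor_rels CARD('k) :: ('a list \<Rightarrow>\<^sub>0 complex) set)"
      unfolding tensor_rels_def by blast
    then show "tensor_eq TYPE('k) (Poly_Mapping.single (xs @ (c *\<^sub>C x) # ys) 1)
        (c *\<^sub>C Poly_Mapping.single (xs @ x # ys) 1)"
      unfolding tensor_eq_def by (rule complex_vector.span_base)
  qed
  then show "tens (us[p := c *\<^sub>C x]) = (c *\<^sub>C tens (us[p := x]) :: ('a, 'k) tensor_power)"
    unfolding upd using len by blast
qed

lemma tens_eq_0: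
  assumes "length us = CARD('k)" "p < CARD('k)" "us ! p = 0"
  shows "(tens us :: ('a::complex_vector, 'k) tensor_power) = 0"
  using clinear_0[OF tens_linear[where 'k = 'k, OF assms(1,2)]] assms by (metis list_update_id)

lemma multilinearI:
  assumes "\<And>us p. length us = k \<Longrightarrow> p < k \<Longrightarrow> clinear (\<lambda>a. F (us[p := a]))"
  shows "multilinear k F"
  unfolding multilinear_def
proof (intro allI impI)
  fix xs ys :: "'a list" assume "length xs + length ys + 1 = k"
  then show "clinear (\<lambda>a. F (xs @ a # ys))"
    using assms[of "xs @ 0 # ys" "length xs"] by simp
qed

lemma clinear_sum_scale:
  assumes "\<And>i. i \<in> I \<Longrightarrow> clinear (f i)"
  shows "clinear (\<lambda>x. \<Sum>i\<in>I. c i *\<^sub>C f i x)"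
  using assms by (intro clinearI) (simp_all add: clinear_add clinear_scale scaleC_add_right sum.distrib
      complex_vector.scale_sum_right scaleC_scaleC mult.commute cong: sum.cong)

lemma clinear_compose': "clinear f \<Longrightarrow> clinear g \<Longrightarrow> clinear (\<lambda>x. f (g x))"
  by (rule clinearI) (simp_all add: clinear_add clinear_scale)

text \<open>A common upper bound together with the fixed sum bounds the entries from below as well.
  With truncation, this makes the modes of a product of k fields finite sums.\<close>

lemma finite_int_lists_fixed_sum:
  assumes "\<And>ns. ns \<in> S \<Longrightarrow> length ns = k \<and> sum_list ns = c \<and> (\<forall>i<k. ns ! i < N)"
  shows "finite (S :: int list set)"
proof (rule finite_subset)
  have "ns ! i \<ge> c - int k * \<bar>N\<bar>" if ns: "ns \<in> S" and i: "i < k" for ns i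
  proof -
    have "c = ns ! i + (\<Sum>j\<in>{0..<k} - {i}. ns ! j)"
      using assms[OF ns] i by (auto simp: sum_list_sum_nth sum.remove[of _ i])
    also have "(\<Sum>j\<in>{0..<k} - {i}. ns ! j) \<le> (\<Sum>j\<in>{0..<k} - {i}. \<bar>N\<bar>)"
      using assms[OF ns] by (intro sum_mono) fastforce
    also have "\<dots> \<le> (\<Sum>j\<in>{0..<k}. \<bar>N\<bar>)"
      by (intro sum_mono2) auto
    finally show ?thesis by simp
  qed
  then show "S \<subseteq> {ns. set ns \<subseteq> {c - int k * \<bar>N\<bar>..<N} \<and> length ns = k}"
    using assms by (fastforce simp: set_conv_nth)
  show "finite {ns. set ns \<subseteq> {c - int k * \<bar>N\<bar>..<N} \<and> length ns = k}"
    by (rule finite_lists_length_eq) simp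
qed

lemma sum_list_modes_eq: "(\<Sum>n'\<leftarrow>ns. - n' - 1) = - sum_list ns - int (length ns)"
  by (induction ns) auto

lemma length_homogeneous_parts [simp]:
  "length (homogeneous_parts V ps us) = min (length ps) (length us)"
  by (simp add: homogeneous_parts_def)

lemma homogeneous_parts_nth [simp]:
  "i < length ps \<Longrightarrow> i < length us \<Longrightarrow> homogeneous_parts V ps us ! i = component (par V) (ps ! i) (us ! i)"
  by (simp add: homogeneous_parts_def)

lemma homogeneous_parts_update:
  assumes "length ps = length us" "p < length us"
  shows "homogeneous_parts V ps (us[p := a]) = (homogeneous_parts V ps us)[p := component (par V) (ps ! p) a]"
  using assms by (intro nth_equalityI) (auto simp: nth_list_update)

lemma rotate1_update:
  assumes "p < length xs"
  shows "rotate1 (xs[p := a]) = (rotate1 xs)[(if p = 0 then length xs else p) - 1 := a]"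
proof (cases xs)
  case (Cons y ys)
  then show ?thesis using assms by (cases p) (auto simp: list_update_append)
qed (use assms in simp)

lemma finite_bit_lists [simp]: "finite (bit_lists k)"
proof -
  have "bit_lists k = {ps. set ps \<subseteq> UNIV \<and> length ps = k}" by (auto simp: bit_lists_def)
  moreover have "finite (UNIV :: bit set)"
    by (rule finite_subset[of _ "{0, 1}"]) (use bit_cases in auto)
  ultimately show ?thesis using finite_lists_length_eq by metis
qed

context vertex_operator_superalgebra
begin

abbreviation product_term ::
  "'k itself \<Rightarrow> int \<Rightarrow> 'a list \<Rightarrow> 'a list \<Rightarrow> int list \<Rightarrow> ('a, 'k) tensor_power"
  where "product_term _ n us vs ns \<equiv>
    (if length ns = CARD('k) \<and> (\<Sum>n'\<leftarrow>ns. - n' - 1) = - n - 1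
     then tens (map (\<lambda>i. mode V (us ! i) (ns ! i) (vs ! i)) [0..<CARD('k)]) else 0)"

lemma product_term_nonzero:
  assumes "product_term TYPE('k) n us vs ns \<noteq> 0"
  shows "length ns = CARD('k)" "sum_list ns = n + 1 - int CARD('k)"
    "\<And>i. i < CARD('k) \<Longrightarrow> mode V (us ! i) (ns ! i) (vs ! i) \<noteq> 0"
proof -
  show l: "length ns = CARD('k)" using assms by (auto split: if_splits)
  then show "sum_list ns = n + 1 - int CARD('k)"
    using assms by (auto simp: sum_list_modes_eq split: if_splits)
  fix i assume i: "i < CARD('k)"
  show "mode V (us ! i) (ns ! i) (vs ! i) \<noteq> 0"
  proof
    assume "mode V (us ! i) (ns ! i) (vs ! i) = 0"
    then have "tens (map (\<lambda>i. mode V (us ! i) (ns ! i) (vs ! i)) [0..<CARD('k)]) = (0 :: ('a, 'k) tensor_power)"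
      using i by (intro tens_eq_0[of _ i]) auto
    with assms show False by (auto split: if_splits)
  qed
qed

lemma finite_product_term: "finite {ns. product_term TYPE('k) n us vs ns \<noteq> 0}"
proof -
  have "\<forall>i. \<exists>N. \<forall>m\<ge>N. mode V (us ! i) m (vs ! i) = 0"
    by (intro allI truncation)
  from choice[OF this] obtain N where N: "\<And>i m. m \<ge> N i \<Longrightarrow> mode V (us ! i) m (vs ! i) = 0"
    by blast
  let ?N = "Max (N ` {..<CARD('k)})"
  show ?thesis
  proof (rule finite_int_lists_fixed_sum)
    fix ns assume "ns \<in> {ns. product_term TYPE('k) n us vs ns \<noteq> 0}"
    then have nz: "product_term TYPE('k) n us vs ns \<noteq> 0" by simp
    have "ns ! i < ?N" if "i < CARD('k)" for i
    proof -
      have "ns ! i < N i" using product_term_nonzero(3)[OF nz that] N not_le by blast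
      also have "N i \<le> ?N" using that by (intro Max_ge) auto
      finally show ?thesis .
    qed
    then show "length ns = CARD('k) \<and> sum_list ns = n + 1 - int CARD('k) \<and> (\<forall>i<CARD('k). ns ! i < ?N)"
      using product_term_nonzero[OF nz] by blast
  qed
qed

lemma product_mode_eq: "product_mode V n us vs = Sum_any (product_term TYPE('k) n us vs)"
  by (simp add: product_mode_def)

lemma product_mode_clinear:
  assumes "\<And>ns. clinear (\<lambda>a. product_term TYPE('k) n (f a) (g a) ns)"
  shows "clinear (\<lambda>a. product_mode V n (f a) (g a) :: ('a, 'k) tensor_power)"
proof (rule clinearI)
  fix x y and c :: complex
  show "product_mode V n (f (x + y)) (g (x + y))
    = (product_mode V n (f x) (g x) + product_mode V n (f y) (g y) :: ('a, 'k) tensor_power)"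
    unfolding product_mode_eq Sum_any.distrib[OF finite_product_term finite_product_term, symmetric]
    by (rule arg_cong[of _ _ Sum_any]) (rule ext, rule clinear_add[OF assms])
  have "clinear (\<lambda>v :: ('a, 'k) tensor_power. c *\<^sub>C v)"
    by (rule clinearI) (simp_all add: scaleC_add_right scaleC_scaleC mult.commute)
  from clinear_Sum_any[OF this finite_product_term]
  show "product_mode V n (f (c *\<^sub>C x)) (g (c *\<^sub>C x)) = (c *\<^sub>C product_mode V n (f x) (g x) :: ('a, 'k) tensor_power)"
    unfolding product_mode_eq by (simp only: clinear_scale[OF assms])
qed

lemma product_mode_linear_left:
  assumes "length us = CARD('k)" "p < CARD('k)"
  shows "clinear (\<lambda>a. product_mode V n (us[p := a]) vs :: ('a, 'k) tensor_power)"
proof (rule product_mode_clinear)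
  fix ns
  let ?f = "\<lambda>us. map (\<lambda>i. mode V (us ! i) (ns ! i) (vs ! i)) [0..<CARD('k)]"
  have "?f (us[p := a]) = (?f us)[p := mode V a (ns ! p) (vs ! p)]" for a
    using assms by (intro nth_equalityI) (auto simp: nth_list_update)
  moreover have "clinear (\<lambda>a. tens ((?f us)[p := mode V a (ns ! p) (vs ! p)]) :: ('a, 'k) tensor_power)"
    by (rule clinear_compose'[OF tens_linear linear_left]) (use assms in auto)
  ultimately show "clinear (\<lambda>a. product_term TYPE('k) n (us[p := a]) vs ns)"
    by (cases "length ns = CARD('k) \<and> (\<Sum>n'\<leftarrow>ns. - n' - 1) = - n - 1")
      (simp_all only: if_True if_False simp_thms, rule clinearI, simp_all)
qed

lemma product_mode_linear_right:
  assumes "length vs = CARD('k)" "p < CARD('k)"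
  shows "clinear (\<lambda>a. product_mode V n us (vs[p := a]) :: ('a, 'k) tensor_power)"
proof (rule product_mode_clinear)
  fix ns
  let ?f = "\<lambda>vs. map (\<lambda>i. mode V (us ! i) (ns ! i) (vs ! i)) [0..<CARD('k)]"
  have "?f (vs[p := a]) = (?f vs)[p := mode V (us ! p) (ns ! p) a]" for a
    using assms by (intro nth_equalityI) (auto simp: nth_list_update)
  moreover have "clinear (\<lambda>a. tens ((?f vs)[p := mode V (us ! p) (ns ! p) a]) :: ('a, 'k) tensor_power)"
    by (rule clinear_compose'[OF tens_linear linear_right]) (use assms in auto)
  ultimately show "clinear (\<lambda>a. product_term TYPE('k) n us (vs[p := a]) ns)"
    by (cases "length ns = CARD('k) \<and> (\<Sum>n'\<leftarrow>ns. - n' - 1) = - n - 1")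
      (simp_all only: if_True if_False simp_thms, rule clinearI, simp_all)
qed

text \<open>The function of pure tensors that \<open>tensor_mode\<close> extends, isolated so that
  its linearity in each factor can be proved before the extension is evaluated.\<close>

definition superproduct :: "int \<Rightarrow> 'a list \<Rightarrow> 'a list \<Rightarrow> ('a, 'k) tensor_power"
  where "superproduct n us vs = (\<Sum>ps \<in> bit_lists CARD('k). \<Sum>qs \<in> bit_lists CARD('k).
        ksign (\<Sum>i<CARD('k). \<Sum>j<i. ps ! i * qs ! j) *\<^sub>C
          product_mode V n (homogeneous_parts V ps us) (homogeneous_parts V qs vs))"

lemma superproduct_linear_left:
  assumes us: "length us = CARD('k)" "p < CARD('k)"
  shows "clinear (\<lambda>a. superproduct n (us[p := a]) vs :: ('a, 'k) tensor_power)"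
proof -
  have "clinear (\<lambda>a. product_mode V n (homogeneous_parts V ps (us[p := a])) vs' :: ('a, 'k) tensor_power)"
    if "ps \<in> bit_lists CARD('k)" for ps vs'
    using that us product_mode_linear_left[where 'k = 'k, of "homogeneous_parts V ps us" p n vs']
    by (auto simp: bit_lists_def homogeneous_parts_update
        intro: clinear_compose'[OF _ clinear_component[OF superspace]])
  then have "clinear (\<lambda>a. \<Sum>ps \<in> bit_lists CARD('k). 1 *\<^sub>C (\<Sum>qs \<in> bit_lists CARD('k).
        ksign (\<Sum>i<CARD('k). \<Sum>j<i. ps ! i * qs ! j) *\<^sub>C
          (product_mode V n (homogeneous_parts V ps (us[p := a])) (homogeneous_parts V qs vs) :: ('a, 'k) tensor_power)))"
    by (intro clinear_sum_scale)
  then show ?thesis by (simp add: superproduct_def[abs_def] scaleC_one)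
qed

lemma superproduct_linear_right:
  assumes vs: "length vs = CARD('k)" "p < CARD('k)"
  shows "clinear (\<lambda>a. superproduct n us (vs[p := a]) :: ('a, 'k) tensor_power)"
proof -
  have "clinear (\<lambda>a. product_mode V n us' (homogeneous_parts V ps (vs[p := a])) :: ('a, 'k) tensor_power)"
    if "ps \<in> bit_lists CARD('k)" for ps us'
    using that vs product_mode_linear_right[where 'k = 'k, of "homogeneous_parts V ps vs" p n us']
    by (auto simp: bit_lists_def homogeneous_parts_update
        intro: clinear_compose'[OF _ clinear_component[OF superspace]])
  then have "clinear (\<lambda>a. \<Sum>ps \<in> bit_lists CARD('k). 1 *\<^sub>C (\<Sum>qs \<in> bit_lists CARD('k).
        ksign (\<Sum>i<CARD('k). \<Sum>j<i. ps ! i * qs ! j) *\<^sub>C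
          (product_mode V n (homogeneous_parts V ps us) (homogeneous_parts V qs (vs[p := a])) :: ('a, 'k) tensor_power)))"
    by (intro clinear_sum_scale)
  then show ?thesis by (simp add: superproduct_def[abs_def] scaleC_one)
qed

text \<open>The linear extension uses a chosen representative, so its value on a pure tensor is
  known only for a multilinear map. For the outer extension the representative of the second
  argument is held fixed.\<close>

lemma tensor_mode_tens:
  assumes "length us = CARD('k)" "length vs = CARD('k)"
  shows "tensor_mode V (tens us) n (tens vs) = (superproduct n us vs :: ('a, 'k) tensor_power)"
proof -
  have 1: "multilinear CARD('k) (\<lambda>vs. superproduct n us vs :: ('a, 'k) tensor_power)" for us
    by (rule multilinearI) (rule superproduct_linear_right)
  have "multilinear CARD('k) (\<lambda>us. tensor_extend (\<lambda>vs. superproduct n us vs) t :: ('a, 'k) tensor_power)"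
    for t :: "('a, 'k) tensor_power"
  proof (rule multilinearI)
    fix us :: "'a list" and p assume "length us = CARD('k)" "p < CARD('k)"
    then show "clinear (\<lambda>a. tensor_extend (\<lambda>vs. superproduct n (us[p := a]) vs) t :: ('a, 'k) tensor_power)"
      unfolding tensor_extend_def Let_def
      by (intro clinear_sum_scale superproduct_linear_left)
  qed
  then have "tensor_extend (\<lambda>us. tensor_extend (superproduct n us) (tens vs :: ('a, 'k) tensor_power)) (tens us :: ('a, 'k) tensor_power)
      = (tensor_extend (superproduct n us) (tens vs :: ('a, 'k) tensor_power) :: ('a, 'k) tensor_power)"
    using assms(1) by (rule tensor_extend_tens)
  also have "\<dots> = superproduct n us vs"
    using 1 assms(2) by (rule tensor_extend_tens)
  finally show ?thesis
    unfolding tensor_mode_def superproduct_def .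
qed

text \<open>Any other choice of parities has a zero component in some position, and then the whole
  product vanishes.\<close>

lemma superproduct_homogeneous:
  assumes us: "length us = CARD('k)" "length ps = CARD('k)" "\<And>i. i < CARD('k) \<Longrightarrow> us ! i \<in> par V (ps ! i)"
    and vs: "length vs = CARD('k)" "length qs = CARD('k)" "\<And>i. i < CARD('k) \<Longrightarrow> vs ! i \<in> par V (qs ! i)"
  shows "superproduct n us vs = ksign (\<Sum>i<CARD('k). \<Sum>j<i. ps ! i * qs ! j) *\<^sub>C
    (product_mode V n us vs :: ('a, 'k) tensor_power)"
proof -
  have z: "product_mode V n us' vs' = (0 :: ('a, 'k) tensor_power)"
    if "i < CARD('k)" "us' ! i = 0 \<or> vs' ! i = 0" for i us' vs'
  proof -
    have "product_term TYPE('k) n us' vs' ns = 0" for ns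
      using product_term_nonzero(3)[where 'k = 'k and n = n and us = us' and vs = vs' and ns = ns, OF _ that(1)]
        that(2) mode_0_left mode_0_right by fastforce
    then show ?thesis by (simp add: product_mode_eq)
  qed
  have c: "(component (par V) p x = 0)" if "x \<in> par V q" "p \<noteq> q" for p q x
    using component_of_homogeneous[OF superspace that(1)] that by simp
  have h: "homogeneous_parts V rs ws = ws"
    if "length ws = CARD('k)" "length rs = CARD('k)" "\<And>i. i < CARD('k) \<Longrightarrow> ws ! i \<in> par V (rs ! i)" for rs ws
    using that by (intro nth_equalityI) (simp_all add: component_of_homogeneous[OF superspace that(3)])
  have z1: "product_mode V n (homogeneous_parts V ps' us) vs' = (0 :: ('a, 'k) tensor_power)"
    if ps': "ps' \<in> bit_lists CARD('k)" "ps' \<noteq> ps" for ps' vs'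
  proof -
    obtain i where "i < CARD('k)" "ps' ! i \<noteq> ps ! i"
      using ps' us(2) by (auto simp: bit_lists_def list_eq_iff_nth_eq)
    then show ?thesis using ps' us(1,2) by (intro z[of i]) (auto simp: bit_lists_def c[OF us(3)])
  qed
  have z2: "product_mode V n us' (homogeneous_parts V qs' vs) = (0 :: ('a, 'k) tensor_power)"
    if qs': "qs' \<in> bit_lists CARD('k)" "qs' \<noteq> qs" for qs' us'
  proof -
    obtain i where "i < CARD('k)" "qs' ! i \<noteq> qs ! i"
      using qs' vs(2) by (auto simp: bit_lists_def list_eq_iff_nth_eq)
    then show ?thesis using qs' vs(1,2) by (intro z[of i]) (auto simp: bit_lists_def c[OF vs(3)])
  qed
  have bl: "ps \<in> bit_lists CARD('k)" "qs \<in> bit_lists CARD('k)"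
    using us vs by (simp_all add: bit_lists_def)
  have "superproduct n us vs = (\<Sum>ps'\<in>{ps}. \<Sum>qs'\<in>{qs}.
        ksign (\<Sum>i<CARD('k). \<Sum>j<i. ps' ! i * qs' ! j) *\<^sub>C
          (product_mode V n (homogeneous_parts V ps' us) (homogeneous_parts V qs' vs) :: ('a, 'k) tensor_power))"
    unfolding superproduct_def
  proof (intro sum.mono_neutral_cong_right)
    show "\<forall>ps'\<in>bit_lists CARD('k) - {ps}. (\<Sum>qs \<in> bit_lists CARD('k).
        ksign (\<Sum>i<CARD('k). \<Sum>j<i. ps' ! i * qs ! j) *\<^sub>C
          (product_mode V n (homogeneous_parts V ps' us) (homogeneous_parts V qs vs) :: ('a, 'k) tensor_power)) = 0"
      by (auto simp: z1)
  qed (auto simp: bl z2)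
  then show ?thesis by (simp add: h us vs)
qed

section \<open>Vectors supported in one tensor factor\<close>

lemma slot_par:
  assumes "U \<in> par V p" "i < k"
  shows "(replicate k (vac V))[j := U] ! i \<in> par V ((replicate k 0)[j := p] ! i)"
  using assms vac_even by (cases "i = j") auto

lemma tensor_mode_slot:
  assumes U: "U \<in> par V p" and W: "W \<in> par V q"
  shows "tensor_mode V (tensor_slot V i U) n (tensor_slot V 0 W)
    = ksign (\<Sum>l<CARD('k). \<Sum>j<l. (replicate CARD('k) 0)[i := p] ! l * (replicate CARD('k) 0)[0 := q] ! j) *\<^sub>C
      (product_mode V n ((replicate CARD('k) (vac V))[i := U]) ((replicate CARD('k) (vac V))[0 := W])
        :: ('a, 'k) tensor_power)"
  unfolding tensor_slot_def
  by (subst tensor_mode_tens, simp, simp, rule superproduct_homogeneous)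
    (simp_all add: slot_par[OF U] slot_par[OF W])

text \<open>Outside position 0 the vacuum acts on the vacuum, which forces the mode -1; the
  prescribed sum of the indices then leaves n for position 0.\<close>

lemma tensor_mode_slot_0:
  assumes U: "U \<in> par V p" and W: "W \<in> par V q"
  shows "tensor_mode V (tensor_slot V 0 U) n (tensor_slot V 0 W)
    = (tensor_slot V 0 (mode V U n W) :: ('a, 'k::finite) tensor_power)"
proof -
  let ?k = "CARD('k)"
  let ?v = "replicate ?k (vac V)"
  have k: "0 < ?k" by simp
  \<comment> \<open>A pair j < l has l > 0, where the first vector has an even factor.\<close>
  have sign: "(\<Sum>l<?k. \<Sum>j<l. (replicate ?k 0)[0 := p] ! l * (replicate ?k 0)[0 := q] ! j) = 0"
    by (intro sum.neutral ballI) (auto simp: nth_list_update)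
  let ?ns = "(replicate ?k (- 1))[0 := n]"
  have sn: "sum_list ?ns = n + 1 - int ?k"
    using k by (cases ?k) (simp_all add: sum_list_replicate)
  have "product_mode V n (?v[0 := U]) (?v[0 := W])
      = (product_term TYPE('k) n (?v[0 := U]) (?v[0 := W]) ?ns :: ('a, 'k) tensor_power)"
    unfolding product_mode_eq
  proof (rule Sum_any_single, rule ccontr)
    fix ns :: "int list"
    assume ne: "ns \<noteq> ?ns" and nz: "product_term TYPE('k) n (?v[0 := U]) (?v[0 := W]) ns \<noteq> 0"
    note nz = product_term_nonzero[OF nz]
    have 1: "ns ! i = - 1" if "i < ?k" "i \<noteq> 0" for i
      using nz(3)[OF that(1)] that by (auto simp: vacuum split: if_splits)
    obtain m ms where ns: "ns = m # ms" using nz(1) k by (cases ns) auto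
    have ms: "ms = replicate (?k - 1) (- 1)"
      using nz(1) 1[of "Suc _"] by (intro nth_equalityI) (auto simp: ns)
    have "m = n" using nz(1,2) k by (auto simp: ns ms sum_list_replicate of_nat_diff)
    then have "ns = ?ns" using k by (cases ?k) (simp_all add: ns ms)
    with ne show False ..
  qed
  also have "\<dots> = tens (?v[0 := mode V U n W])"
  proof -
    have "map (\<lambda>i. mode V (?v[0 := U] ! i) (?ns ! i) (?v[0 := W] ! i)) [0..<?k] = ?v[0 := mode V U n W]"
      by (intro nth_equalityI) (auto simp: nth_list_update vacuum)
    then show ?thesis by (simp add: sum_list_modes_eq sn)
  qed
  finally show ?thesis
    unfolding tensor_mode_slot[OF U W] sign by (simp add: ksign_def scaleC_one tensor_slot_def)
qed

text \<open>In position i, U acts on the vacuum, so its index must be negative. Elsewhere the vacuum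
  acts, with index -1. The sum of the indices makes the one in position i equal to n, which is
  nonnegative.\<close>

lemma tensor_mode_distinct_slots:
  assumes U: "U \<in> par V p" and W: "W \<in> par V q" and i: "0 < i" "i < CARD('k)" and n: "n \<ge> 0"
  shows "tensor_mode V (tensor_slot V i U) n (tensor_slot V 0 W)
    = (0 :: ('a, 'k::finite) tensor_power)"
proof -
  let ?k = "CARD('k)"
  let ?v = "replicate ?k (vac V)"
  have "product_term TYPE('k) n (?v[i := U]) (?v[0 := W]) ns = 0" for ns
  proof (rule ccontr)
    assume nz: "product_term TYPE('k) n (?v[i := U]) (?v[0 := W]) ns \<noteq> 0"
    note nz = product_term_nonzero[OF nz]
    have 1: "ns ! l = - 1" if "l < ?k" "l \<noteq> i" for l
      using nz(3)[OF that(1)] that by (auto simp: vacuum split: if_splits)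
    have 2: "ns ! i < 0"
      using nz(3)[OF i(2)] i creation(1)[of "ns ! i" U] by (cases "0 \<le> ns ! i") auto
    have "sum_list ns = (\<Sum>l\<in>{0..<?k}. ns ! l)"
      by (simp add: sum_list_sum_nth nz(1))
    also have "\<dots> = ns ! i + (\<Sum>l\<in>{0..<?k} - {i}. ns ! l)"
      using i by (intro sum.remove) auto
    also have "(\<Sum>l\<in>{0..<?k} - {i}. ns ! l) = (\<Sum>l\<in>{0..<?k} - {i}. - 1)"
      by (intro sum.cong) (auto simp: 1)
    also have "\<dots> = 1 - int ?k"
      using i by (simp add: of_nat_diff)
    finally show False using nz(2) 2 n by simp
  qed
  then have "product_mode V n (?v[i := U]) (?v[0 := W]) = (0 :: ('a, 'k) tensor_power)"
    by (simp add: product_mode_eq)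
  then show ?thesis
    unfolding tensor_mode_slot[OF U W] by simp
qed

lemma tensor_cycle_slot:
  assumes U: "U \<in> par V p" and j: "j < CARD('k)"
  shows "tensor_cycle V (tensor_slot V j U)
    = (tensor_slot V ((if j = 0 then CARD('k) else j) - 1) U :: ('a, 'k::finite) tensor_power)"
proof -
  let ?k = "CARD('k)"
  let ?v = "replicate ?k (vac V)"
  let ?F = "\<lambda>vs. \<Sum>ps \<in> bit_lists ?k. ksign (hd ps * sum_list (tl ps)) *\<^sub>C
      (tens (rotate1 (homogeneous_parts V ps vs)) :: ('a, 'k) tensor_power)"
  have "multilinear ?k ?F"
  proof (rule multilinearI, rule clinear_sum_scale)
    fix us :: "'a list" and p ps assume us: "length us = ?k" "p < ?k" and ps: "ps \<in> bit_lists ?k"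
    have l: "length (homogeneous_parts V ps us) = ?k" using us ps by (simp add: bit_lists_def)
    let ?q = "(if p = 0 then ?k else p) - 1"
    have "rotate1 (homogeneous_parts V ps (us[p := a]))
        = (rotate1 (homogeneous_parts V ps us))[?q := component (par V) (ps ! p) a]" for a
      using us ps l
      by (subst homogeneous_parts_update) (auto simp: bit_lists_def rotate1_update)
    moreover have "clinear (\<lambda>a. tens ((rotate1 (homogeneous_parts V ps us))[?q := component (par V) (ps ! p) a])
        :: ('a, 'k) tensor_power)"
      by (rule clinear_compose'[OF tens_linear clinear_component[OF superspace]]) (use us l in auto)
    ultimately show "clinear (\<lambda>a. tens (rotate1 (homogeneous_parts V ps (us[p := a]))) :: ('a, 'k) tensor_power)"
      by simp
  qed
  then have "tensor_cycle V (tensor_slot V j U) = ?F (?v[j := U])"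
    unfolding tensor_cycle_def tensor_slot_def by (rule tensor_extend_tens) simp
  also have "\<dots> = (\<Sum>ps\<in>{(replicate ?k 0)[j := p]}. ksign (hd ps * sum_list (tl ps)) *\<^sub>C
      (tens (rotate1 (homogeneous_parts V ps (?v[j := U]))) :: ('a, 'k) tensor_power))"
  proof (intro sum.mono_neutral_right ballI)
    fix ps assume ps: "ps \<in> bit_lists ?k - {(replicate ?k 0)[j := p]}"
    then obtain i where i: "i < ?k" "ps ! i \<noteq> (replicate ?k 0)[j := p] ! i"
      by (auto simp: bit_lists_def list_eq_iff_nth_eq)
    define h where "h = homogeneous_parts V ps (?v[j := U])"
    have h: "h ! i = 0" "length h = ?k"
      using ps i component_of_homogeneous[OF superspace slot_par[OF U i(1)], of "ps ! i" j]
      by (auto simp: bit_lists_def h_def)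
    let ?q = "(if i = 0 then ?k else i) - 1"
    have "h[i := 0] = h" using h(1) by (metis list_update_id)
    then have "rotate1 h = (rotate1 h)[?q := 0]"
      using rotate1_update[of i h 0] h(2) i(1) by (simp only:)
    moreover have "?q < length (rotate1 h)" using i h(2) by auto
    ultimately have "rotate1 h ! ?q = 0"
      by (metis nth_list_update_eq)
    then have "tens (rotate1 h) = (0 :: ('a, 'k) tensor_power)"
      using h(2) i by (intro tens_eq_0[of _ ?q]) auto
    then show "ksign (hd ps * sum_list (tl ps)) *\<^sub>C (tens (rotate1 (homogeneous_parts V ps (?v[j := U])))
        :: ('a, 'k) tensor_power) = 0"
      by (simp add: h_def)
  qed (use finite_bit_lists in \<open>auto simp: bit_lists_def\<close>)
  also have "\<dots> = tens (rotate1 (?v[j := U]))"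
  proof -
    let ?ps = "(replicate ?k 0)[j := p]"
    have "homogeneous_parts V ?ps (?v[j := U]) = ?v[j := U]"
      by (intro nth_equalityI) (simp_all add: component_of_homogeneous[OF superspace slot_par[OF U]])
    \<comment> \<open>At most one factor is odd, so the cycle produces no sign.\<close>
    moreover have "hd ?ps * sum_list (tl ?ps) = 0"
      using j by (cases ?k; cases j) (simp_all add: sum_list_replicate)
    ultimately show ?thesis by (simp add: ksign_def scaleC_one)
  qed
  also have "rotate1 (?v[j := U]) = ?v[(if j = 0 then ?k else j) - 1 := U]"
  proof -
    have "rotate1 ?v = ?v" by (cases ?k) (simp_all add: replicate_append_same)
    then show ?thesis using j by (simp add: rotate1_update)
  qed
  finally show ?thesis by (simp add: tensor_slot_def)
qed

lemma tensor_cycle_pow_slot: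
  assumes U: "U \<in> par V p" and j: "0 < j" "j < CARD('k)"
  shows "(tensor_cycle V ^^ j) (tensor_slot V 0 U)
    = (tensor_slot V (CARD('k) - j) U :: ('a, 'k::finite) tensor_power)"
  using j
proof (induction j)
  case (Suc j)
  show ?case
  proof (cases "j = 0")
    case True
    then show ?thesis using tensor_cycle_slot[OF U, where 'k = 'k, of 0] by simp
  next
    case False
    then show ?thesis
      using Suc tensor_cycle_slot[OF U, where 'k = 'k, of "CARD('k) - j"] by simp
  qed
qed simp

lemma tensor_slot_linear: "clinear (tensor_slot V 0 :: 'a \<Rightarrow> ('a, 'k::finite) tensor_power)"
  unfolding tensor_slot_def[abs_def] by (rule tens_linear) simp_all

lemma tensor_slot_par:
  assumes "U \<in> par V p"
  shows "(tensor_slot V 0 U :: ('a, 'k::finite) tensor_power) \<in> par (tensor_vosa V) p"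
proof -
  have "sum_list ((replicate CARD('k) 0)[0 := p]) = p"
    by (cases "CARD('k)") (simp_all add: sum_list_replicate)
  then show ?thesis
    unfolding tensor_vosa_def tensor_slot_def
    using slot_par[OF assms, of _ "CARD('k)" 0]
    by (auto intro!: complex_vector.span_base exI[of _ "(replicate CARD('k) (vac V))[0 := U]"]
        exI[of _ "(replicate CARD('k) 0)[0 := p]"])
qed

lemma tensor_slot_vac: "tensor_slot V 0 (vac V) = (vac (tensor_vosa V) :: ('a, 'k::finite) tensor_power)"
proof -
  have "(replicate CARD('k) (vac V))[0 := vac V] = replicate CARD('k) (vac V)"
    by (cases "CARD('k)") simp_all
  then show ?thesis by (simp add: tensor_slot_def tensor_vosa_def)
qed

end

section \<open>The Jacobi identity for a single tensor factor\<close>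

text \<open>The coefficients \<open>q\<close> are independent of the arguments: the same ones serve
  for the substitutions (1, X), (X, 1) and (z, 1), which belong to the three terms of the Jacobi
  identity.\<close>

definition homogeneous_form :: "nat \<Rightarrow> (complex fps \<Rightarrow> complex fps \<Rightarrow> complex fps) \<Rightarrow> bool"
  where "homogeneous_form d h \<longleftrightarrow>
    (\<exists>q. \<forall>x y. h x y = (\<Sum>a\<le>d. fps_const (q a) * (x ^ a * y ^ (d - a))))"

lemma homogeneous_form_mult_left:
  assumes "homogeneous_form d h" shows "homogeneous_form (Suc d) (\<lambda>x y. x * h x y)"
proof -
  obtain q where q: "h x y = (\<Sum>a\<le>d. fps_const (q a) * (x ^ a * y ^ (d - a)))" for x y
    using assms unfolding homogeneous_form_def by blast
  have "x * h x y = (\<Sum>a\<le>Suc d. fps_const (if a = 0 then 0 else q (a - 1)) * (x ^ a * y ^ (Suc d - a)))" for x y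
    unfolding q by (subst sum.atMost_Suc_shift) (simp add: sum_distrib_left mult_ac)
  then show ?thesis
    unfolding homogeneous_form_def by (intro exI[of _ "\<lambda>a. if a = 0 then 0 else q (a - 1)"] allI)
qed

lemma homogeneous_form_mult_right:
  assumes "homogeneous_form d h" shows "homogeneous_form (Suc d) (\<lambda>x y. y * h x y)"
proof -
  obtain q where q: "h x y = (\<Sum>a\<le>d. fps_const (q a) * (x ^ a * y ^ (d - a)))" for x y
    using assms unfolding homogeneous_form_def by blast
  have "y * h x y = (\<Sum>a\<le>Suc d. fps_const (if a \<le> d then q a else 0) * (x ^ a * y ^ (Suc d - a)))" for x y
    unfolding q by (simp add: sum_distrib_left mult_ac Suc_diff_le)
  then show ?thesis
    unfolding homogeneous_form_def by (intro exI[of _ "\<lambda>a. if a \<le> d then q a else 0"] allI)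
qed

lemma homogeneous_form_add:
  assumes "homogeneous_form d h" "homogeneous_form d h'"
  shows "homogeneous_form d (\<lambda>x y. h x y + h' x y)"
proof -
  obtain q where q: "h x y = (\<Sum>a\<le>d. fps_const (q a) * (x ^ a * y ^ (d - a)))" for x y
    using assms(1) unfolding homogeneous_form_def by blast
  obtain q' where q': "h' x y = (\<Sum>a\<le>d. fps_const (q' a) * (x ^ a * y ^ (d - a)))" for x y
    using assms(2) unfolding homogeneous_form_def by blast
  have "h x y + h' x y = (\<Sum>a\<le>d. fps_const (q a + q' a) * (x ^ a * y ^ (d - a)))" for x y
    unfolding q q' sum.distrib[symmetric] by (simp add: distrib_right flip: fps_const_add)
  then show ?thesis
    unfolding homogeneous_form_def by (intro exI[of _ "\<lambda>a. q a + q' a"] allI)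
qed

lemma homogeneous_form_neg:
  assumes "homogeneous_form d h" shows "homogeneous_form d (\<lambda>x y. - h x y)"
proof -
  obtain q where q: "h x y = (\<Sum>a\<le>d. fps_const (q a) * (x ^ a * y ^ (d - a)))" for x y
    using assms unfolding homogeneous_form_def by blast
  have "- h x y = (\<Sum>a\<le>d. fps_const (- q a) * (x ^ a * y ^ (d - a)))" for x y
    unfolding q by (simp add: sum_negf flip: fps_const_neg)
  then show ?thesis
    unfolding homogeneous_form_def by (intro exI[of _ "\<lambda>a. - q a"] allI)
qed

lemma homogeneous_form_0: "homogeneous_form d (\<lambda>x y. 0)"
  unfolding homogeneous_form_def by (intro exI[of _ "\<lambda>_. 0"]) simp

lemma homogeneous_form_sum:
  assumes "\<And>i. i \<in> I \<Longrightarrow> homogeneous_form d (h i)"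
  shows "homogeneous_form d (\<lambda>x y. \<Sum>i\<in>I. h i x y)"
  using assms
  by (induction I rule: infinite_finite_induct) (simp_all add: homogeneous_form_0 homogeneous_form_add)

lemma homogeneous_form_monom_mult:
  assumes "homogeneous_form d h" shows "homogeneous_form (a + b + d) (\<lambda>x y. x ^ a * y ^ b * h x y)"
proof (induction a)
  case 0
  show ?case
  proof (induction b)
    case (Suc b)
    then show ?case using homogeneous_form_mult_right[OF Suc] by (simp add: mult_ac)
  qed (use assms in simp)
next
  case (Suc a)
  then show ?case using homogeneous_form_mult_left[OF Suc] by (simp add: mult_ac)
qed

text \<open>The polynomial (x^k - y^k)/(x - y).\<close>

definition cyc_form :: "nat \<Rightarrow> 'a::comm_semiring_1 \<Rightarrow> 'a \<Rightarrow> 'a"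
  where "cyc_form k x y = (\<Sum>b<k. x ^ b * y ^ (k - 1 - b))"

lemma cyc_form_mult: "cyc_form k x y * (x - y) = x ^ k - y ^ k" for x y :: "'a::comm_ring_1"
  by (simp add: cyc_form_def power_diff_sumr2 mult.commute diff_diff_eq)

text \<open>This polynomial is (x - y)^(e-L) cleared of its denominator (x^k - y^k)^L.\<close>

lemma homogeneous_form_cyc:
  assumes "k > 0"
  shows "homogeneous_form ((k - 1) * L + e) (\<lambda>x y. cyc_form k x y ^ L * (x - y) ^ e)"
proof (induction L)
  case 0
  show ?case
  proof (induction e)
    case 0
    show ?case unfolding homogeneous_form_def by (intro exI[of _ "\<lambda>_. 1"]) simp
  next
    case (Suc e)
    have "homogeneous_form (Suc e) (\<lambda>x y. x * (x - y) ^ e + - (y * (x - y) ^ e))"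
      using Suc by (intro homogeneous_form_add homogeneous_form_neg homogeneous_form_mult_left
          homogeneous_form_mult_right) simp_all
    then show ?case by (simp add: algebra_simps)
  qed
next
  case (Suc L)
  have "homogeneous_form (k - 1 + ((k - 1) * L + e))
      (\<lambda>x y. x ^ b * y ^ (k - 1 - b) * (cyc_form k x y ^ L * (x - y) ^ e))" if "b < k" for b
    using homogeneous_form_monom_mult[OF Suc, of b "k - 1 - b"] that by simp
  then have "homogeneous_form (k - 1 + ((k - 1) * L + e))
      (\<lambda>x y. \<Sum>b\<in>{..<k}. x ^ b * y ^ (k - 1 - b) * (cyc_form k x y ^ L * (x - y) ^ e))"
    by (intro homogeneous_form_sum) simp
  moreover have "(\<Sum>b\<in>{..<k}. x ^ b * y ^ (k - 1 - b) * (cyc_form k x y ^ L * (x - y) ^ e))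
      = cyc_form k x y ^ Suc L * (x - y) ^ e" for x y :: "complex fps"
    by (simp add: cyc_form_def sum_distrib_right mult.assoc)
  ultimately show ?case by (simp add: add.assoc)
qed

definition fps_binexp :: "complex \<Rightarrow> complex fps"
  where "fps_binexp s = Abs_fps (binexp s)"

lemma fps_binexp_eq: "fps_binexp s = fps_binomial s oo (- fps_X)"
proof -
  have "fps_binomial s oo (fps_const (- 1) * fps_X) = fps_binexp s"
    by (simp only: fps_compose_linear) (simp add: fps_binexp_def binexp_def[abs_def])
  moreover have "fps_const (- 1) * fps_X = (- fps_X :: complex fps)"
    by (simp flip: fps_const_neg)
  ultimately show ?thesis by metis
qed

lemma fps_binexp_add: "fps_binexp (s + t) = fps_binexp s * fps_binexp t"
  by (simp add: fps_binexp_eq fps_binomial_add_mult fps_compose_mult_distrib)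

lemma fps_binexp_of_nat: "fps_binexp (of_nat n) = (1 - fps_X) ^ n"
  by (simp add: fps_binexp_eq fps_binomial_of_nat_complex fps_compose_power[symmetric]
      fps_compose_add_distrib)

lemma fps_compose_X_power_nth:
  assumes "k > 0"
  shows "fps_nth (F oo fps_X ^ k) n = (if k dvd n then fps_nth F (n div k) else 0)"
proof -
  have "fps_nth (F oo fps_X ^ k) n = (\<Sum>i=0..n. fps_nth F i * (if n = k * i then 1 else 0))"
    by (simp add: fps_compose_nth flip: power_mult)
  also have "\<dots> = (if k dvd n then fps_nth F (n div k) else 0)"
  proof (cases "k dvd n")
    case True
    then obtain q where n: "n = k * q" by blast
    have "(\<Sum>i=0..n. fps_nth F i * (if n = k * i then 1 else 0)) = (\<Sum>i\<in>{q}. fps_nth F i)"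
      using assms by (intro sum.mono_neutral_cong_right) (auto simp: n)
    then show ?thesis using assms by (simp add: n)
  next
    case False
    then show ?thesis by (auto intro!: sum.neutral)
  qed
  finally show ?thesis .
qed

text \<open>The identity (x - y)^l = \<open>cyc_form\<close>^L (x - y)^e (x^k - y^k)^(-L) at x = 1,
  y = X. It is checked after multiplication by (1 - X)^L, which may be cancelled.\<close>

lemma fps_binexp_cyc:
  assumes k: "k > 0" and l: "l = int e - int L"
  shows "cyc_form k 1 fps_X ^ L * (1 - fps_X) ^ e * (fps_binexp (- of_nat L) oo fps_X ^ k)
    = fps_binexp (of_int l)"
proof -
  let ?G = "fps_binexp (- of_nat L) oo fps_X ^ k"
  have G: "?G * (1 - fps_X ^ k) ^ L = 1"
  proof -
    have "(1 - fps_X ^ k) ^ L = (fps_binexp (of_nat L) oo fps_X ^ k :: complex fps)"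
      using k by (simp add: fps_binexp_of_nat fps_compose_power[symmetric] fps_compose_sub_distrib)
    then show ?thesis
      using k fps_binexp_add[of "- of_nat L" "of_nat L"] fps_binexp_of_nat[of 0]
      by (simp add: fps_compose_mult_distrib[symmetric])
  qed
  have "cyc_form k 1 fps_X ^ L * (1 - fps_X) ^ e * ?G * (1 - fps_X) ^ L
      = (cyc_form k 1 fps_X * (1 - fps_X)) ^ L * ?G * (1 - fps_X) ^ e"
    by (simp add: power_mult_distrib mult_ac)
  also have "\<dots> = (1 - fps_X) ^ e"
  proof -
    have "cyc_form k 1 fps_X * (1 - fps_X) = (1 - fps_X ^ k :: complex fps)"
      using cyc_form_mult[of k 1 "fps_X :: complex fps"] by simp
    then show ?thesis using G by (simp only: mult.commute[of _ ?G] mult_1_left)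
  qed
  also have "\<dots> = fps_binexp (of_int l) * (1 - fps_X) ^ L"
    using fps_binexp_add[of "of_int l" "of_nat L"] by (simp add: l fps_binexp_of_nat)
  finally show ?thesis
  proof (rule mult_right_cancel[THEN iffD1, rotated])
    have "fps_nth ((1 - fps_X :: complex fps) ^ L) 0 \<noteq> 0" by (simp add: fps_power_zeroth)
    then show "(1 - fps_X :: complex fps) ^ L \<noteq> 0" by (metis fps_zero_nth)
  qed
qed

text \<open>The terms of a Jacobi identity take this form with \<open>x\<close> eventually zero, so
  that their linear combinations can be computed on the series \<open>F\<close> alone.\<close>

definition pairing :: "complex fps \<Rightarrow> (nat \<Rightarrow> 'm::complex_vector) \<Rightarrow> 'm"
  where "pairing F x = Sum_any (\<lambda>i. fps_nth F i *\<^sub>C x i)"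

lemma pairing_upto:
  assumes "\<And>i. i \<ge> N \<Longrightarrow> x i = 0"
  shows "pairing F x = (\<Sum>i<N. fps_nth F i *\<^sub>C x i)"
  unfolding pairing_def by (rule Sum_any_lessThan) (simp add: assms)

lemma pairing_sum:
  assumes "\<And>i. i \<ge> N \<Longrightarrow> x i = 0"
  shows "pairing (\<Sum>a\<in>I. fps_const (c a) * F a) x = (\<Sum>a\<in>I. c a *\<^sub>C pairing (F a) x)"
proof -
  have u: "pairing F x = (\<Sum>i<N. fps_nth F i *\<^sub>C x i)" for F
    by (rule pairing_upto) (rule assms)
  have "pairing (\<Sum>a\<in>I. fps_const (c a) * F a) x = (\<Sum>i<N. \<Sum>a\<in>I. (c a * fps_nth (F a) i) *\<^sub>C x i)"
    by (simp add: u fps_sum_nth complex_vector.scale_sum_left)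
  also have "\<dots> = (\<Sum>a\<in>I. \<Sum>i<N. (c a * fps_nth (F a) i) *\<^sub>C x i)"
    by (rule sum.swap)
  finally show ?thesis
    by (simp add: u complex_vector.scale_sum_right scaleC_scaleC)
qed

lemma Sum_any_reindex_inj:
  assumes "inj h" "\<And>i. i \<notin> range h \<Longrightarrow> f i = 0"
  shows "Sum_any f = Sum_any (\<lambda>j. f (h j))"
proof -
  have "bij_betw h {j. f (h j) \<noteq> 0} {i. f i \<noteq> 0}"
  proof (rule bij_betw_imageI)
    show "inj_on h {j. f (h j) \<noteq> 0}" by (rule inj_on_subset[OF assms(1)]) simp
    show "h ` {j. f (h j) \<noteq> 0} = {i. f i \<noteq> 0}"
    proof (intro equalityI subsetI)
      fix i assume i: "i \<in> {i. f i \<noteq> 0}"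
      then obtain j where "i = h j" using assms(2) by blast
      with i show "i \<in> h ` {j. f (h j) \<noteq> 0}" by simp
    qed auto
  qed
  then show ?thesis
    unfolding Sum_any.expand_set by (rule sum.reindex_bij_betw[symmetric])
qed

text \<open>The sums in the twisted identity move the modes in steps of k, which amounts to
  substituting X^k into the series.\<close>

lemma pairing_shift_dilate:
  assumes k: "k > 0"
  shows "pairing (fps_X ^ a * (F oo fps_X ^ k)) x = Sum_any (\<lambda>i. fps_nth F i *\<^sub>C x (a + k * i))"
proof -
  have "pairing (fps_X ^ a * (F oo fps_X ^ k)) x
      = Sum_any (\<lambda>i. fps_nth (fps_X ^ a * (F oo fps_X ^ k)) (a + k * i) *\<^sub>C x (a + k * i))"
    unfolding pairing_def
  proof (rule Sum_any_reindex_inj)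
    show "inj (\<lambda>i. a + k * i)" using k by (auto simp: inj_def)
    fix i assume i: "i \<notin> range (\<lambda>i. a + k * i)"
    have "fps_nth (fps_X ^ a * (F oo fps_X ^ k)) i = 0"
    proof (cases "i < a")
      case False
      have "\<not> k dvd i - a"
      proof
        assume "k dvd i - a"
        then obtain j where "i - a = k * j" by blast
        then have "i = a + k * j" using False by simp
        with i show False by blast
      qed
      then show ?thesis using False by (simp add: fps_X_power_mult_nth fps_compose_X_power_nth[OF k])
    qed (simp add: fps_X_power_mult_nth)
    then show "fps_nth (fps_X ^ a * (F oo fps_X ^ k)) i *\<^sub>C x i = 0" by simp
  qed
  then show ?thesis
    using k by (simp add: fps_X_power_mult_nth fps_compose_X_power_nth[OF k])
qed

lemma pairing_eq_0:
  assumes "\<And>i. fps_nth F i = 0 \<or> x i = 0"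
  shows "pairing F x = 0"
proof -
  have z: "fps_nth F i *\<^sub>C x i = 0" for i using assms[of i] by auto
  then have "pairing F x = fps_nth F 0 *\<^sub>C x 0"
    unfolding pairing_def by (intro Sum_any_single)
  then show ?thesis by (simp add: z)
qed

text \<open>Here z - 1 is invertible, so the quotient (z^k - 1)/(z - 1) equals X/(z - 1) and has
  order one.\<close>

lemma cyc_form_order:
  fixes z :: "complex fps"
  assumes k: "k > 0" and z: "z ^ k = 1 + fps_X" "fps_nth z 0 \<noteq> 1" and i: "i < L"
  shows "fps_nth (G * (cyc_form k z 1 ^ L * (z - 1) ^ e)) i = 0"
proof -
  have u: "fps_nth (z - 1) 0 \<noteq> 0" using z(2) by simp
  have "cyc_form k z 1 = cyc_form k z 1 * (z - 1) * inverse (z - 1)"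
    using inverse_mult_eq_1'[OF u] by (simp add: mult.assoc)
  also have "\<dots> = fps_X * inverse (z - 1)"
    using cyc_form_mult[of k z 1] by (simp add: z(1))
  finally have eq: "G * (cyc_form k z 1 ^ L * (z - 1) ^ e)
      = fps_X ^ L * (G * (inverse (z - 1) ^ L * (z - 1) ^ e))"
    by (simp only: power_mult_distrib mult_ac)
  show ?thesis unfolding eq using i by (simp only: fps_X_power_mult_nth if_True)
qed

lemma cyc_form_cov:
  assumes k: "k > 0"
  shows "cyc_form k (1 + fps_X) 1 = fps_const (of_nat k) * fps_covu k"
proof -
  have "cyc_form k (1 + fps_X) 1 * fps_X = (1 + fps_X) ^ k - (1 :: complex fps)"
    using cyc_form_mult[of k "1 + fps_X :: complex fps" 1] by simp
  also have "\<dots> = (fps_const (of_nat k) * fps_covu k) * fps_X"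
  proof -
    have "(fps_const (of_nat k) * fps_covu k) * fps_X = fps_const (of_nat k) * fps_cov k"
      by (simp add: fps_cov_eq mult_ac)
    also have "\<dots> = (1 + fps_X) ^ k - 1"
      using k by (simp add: fps_cov_def mult.assoc[symmetric])
    finally show ?thesis by simp
  qed
  finally show ?thesis by simp
qed

lemma power_int_root_of_unity:
  fixes x :: complex
  assumes "x ^ k = 1" "x \<noteq> 0"
  shows "x powi (int k * s - int j * t) = inverse (x ^ j) powi t"
proof -
  have "x powi (int k * s - int j * t) = (x powi int k) powi s / (x powi int j) powi t"
    by (simp only: power_int_diff[OF disjI1[OF assms(2)]] power_int_mult)
  then show ?thesis
    using assms(1) by (simp add: power_int_inverse inverse_eq_divide[symmetric])
qed

section \<open>The first tensor factor acting on the twisted module\<close>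

locale twisted_tensor_module = vertex_operator_superalgebra V c +
  tw: weak_twisted_module "tensor_vosa V" "CARD('k)" "tensor_cycle V" \<eta> Mg Yg
  for V :: "'v::complex_vector vosa_data" and c \<eta> :: complex
    and Mg :: "bit \<Rightarrow> 'm::complex_vector set"
    and Yg :: "('v, 'k::finite) tensor_power \<Rightarrow> int \<Rightarrow> 'm \<Rightarrow> 'm" +
  assumes root: "primitive_root \<eta> CARD('k)"
begin

text \<open>The coefficient of z^(-N-k) in T(U, z) = Y_g(U^1, z^k).\<close>

definition slot_mode :: "'v \<Rightarrow> int \<Rightarrow> 'm \<Rightarrow> 'm"
  where "slot_mode U N w = Yg (tensor_slot V 0 U) N w"

lemma slot_mode_linear_left: "clinear (\<lambda>U. slot_mode U N w)"
  unfolding slot_mode_def by (rule clinear_compose'[OF tw.linear_left tensor_slot_linear])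

lemma slot_mode_linear_right: "clinear (slot_mode U N)"
  unfolding slot_mode_def by (rule tw.linear_right)

lemma slot_mode_0 [simp]: "slot_mode 0 N w = 0" "slot_mode U N 0 = 0"
  using clinear_0[OF slot_mode_linear_left] clinear_0[OF slot_mode_linear_right] by auto

lemma slot_mode_truncation: "\<exists>K. \<forall>N\<ge>K. slot_mode U N w = 0"
  unfolding slot_mode_def by (rule tw.truncation)

lemma slot_mode_eventually_0:
  assumes "k > 0"
  shows "\<exists>N. \<forall>i\<ge>N. slot_mode U (B + k * int i) w = 0"
proof -
  obtain K where K: "\<And>N. N \<ge> K \<Longrightarrow> slot_mode U N w = 0" using slot_mode_truncation by blast
  have "slot_mode U (B + k * int i) w = 0" if "i \<ge> nat (\<bar>K\<bar> + \<bar>B\<bar>)" for i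
  proof (rule K)
    have "int i \<le> k * int i" using assms by (simp add: mult_le_cancel_right1)
    then show "K \<le> B + k * int i" using that by linarith
  qed
  then show ?thesis by blast
qed

text \<open>The factor \<open>(x\<^sub>1\<^bsup>1/k\<^esup> - x\<^sub>2\<^bsup>1/k\<^esup>)\<^bsup>l\<^esup>\<close> is a polynomial multiple of \<open>(x\<^sub>1 - x\<^sub>2)\<^bsup>-L\<^esup>\<close>, and the polynomial
  vanishes to order \<open>L\<close> along \<open>x\<^sub>1\<^bsup>1/k\<^esup> = \<eta>\<^bsup>j\<^esup> x\<^sub>2\<^bsup>1/k\<^esup>\<close> for \<open>j \<noteq> 0\<close>, where the modes with nonnegative index
  of different tensor factors annihilate each other. So only the summand \<open>j = 0\<close> of the twisted Jacobi
  identity survives.\<close>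

lemma slot_jacobi:
  assumes U: "U \<in> par V p" and W: "W \<in> par V q"
  defines "k \<equiv> CARD('k)"
  shows "Sum_any (\<lambda>i. binexp (of_int l) i *\<^sub>C slot_mode U (A + l - int i) (slot_mode W (B + int i) w))
    - ksign (p * q) *\<^sub>C ((- 1) powi l *\<^sub>C
        Sum_any (\<lambda>i. binexp (of_int l) i *\<^sub>C slot_mode W (B + l - int i) (slot_mode U (A + int i) w)))
    = (1 / of_nat k) *\<^sub>C Sum_any (\<lambda>d::nat. (of_nat k powi (- (l + int d)) *
        fps_nth (fps_pw (fps_covu k) (- of_int l - of_nat d - 1) * fps_binomial (of_int A + of_nat k - 1)) d) *\<^sub>C
        slot_mode (mode V U (l + int d) W) (A + B + l - int k * (l + int d)) w)"
proof -
  have k: "k > 0" by (simp add: k_def)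
  \<comment> \<open>With l = e - L, the function (z_1 - z_2)^l is the polynomial
    \<open>cyc_form\<close>^L (z_1 - z_2)^e, of degree d, divided by (x_1 - x_2)^L.\<close>
  define L where "L = nat \<bar>l\<bar>"
  define e where "e = nat (l + int L)"
  have l: "l = int e - int L" by (simp add: e_def L_def)
  define d where "d = (k - 1) * L + e"
  have dk: "int d = l + int k * int L"
    using k by (cases k) (simp_all add: d_def l algebra_simps)
  obtain q' where q': "cyc_form k x y ^ L * (x - y) ^ e = (\<Sum>a\<le>d. fps_const (q' a) * (x ^ a * y ^ (d - a)))"
    for x y :: "complex fps"
    using homogeneous_form_cyc[OF k, of L e] unfolding homogeneous_form_def d_def by blast
  let ?G = "fps_binexp (- of_nat L) oo fps_X ^ k"
  let ?u = "tensor_slot V 0 U :: ('v, 'k) tensor_power"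
  let ?v = "tensor_slot V 0 W :: ('v, 'k) tensor_power"
  let ?l' = "- int L"
  \<comment> \<open>The twisted identity with exponent -L, shifted by the monomial z_1^a z_2^(d-a)
    of that polynomial.\<close>
  define J1 where "J1 a = jacobi_term1 k Yg ?u ?v ?l' (A + int a) (B + int d - int a) w" for a
  define J2 where "J2 a = jacobi_term2 k Yg ?u ?v ?l' (A + int a) (B + int d - int a) w" for a
  define J3 where "J3 a = jacobi_term3 (mode (tensor_vosa V)) k (tensor_cycle V) \<eta> Yg ?u ?v ?l'
      (A + int a) (B + int d - int a) w" for a
  have J: "J1 a - ksign (p * q) *\<^sub>C J2 a = J3 a" for a
    unfolding J1_def J2_def J3_def k_def
    by (rule tw.jacobi[unfolded jacobi_identity_def, rule_format, OF tensor_slot_par[OF U] tensor_slot_par[OF W]])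

  define x where "x I = slot_mode U (A + l - int I) (slot_mode W (B + int I) w)" for I
  obtain Nx where "\<forall>i\<ge>Nx. slot_mode W (B + 1 * int i) w = 0"
    using slot_mode_eventually_0[of 1 W B w] zero_less_one by blast
  then have x0: "x i = 0" if "i \<ge> Nx" for i using that by (simp add: x_def)
  define y where "y I = slot_mode W (B + l - int I) (slot_mode U (A + int I) w)" for I
  obtain Ny where "\<forall>i\<ge>Ny. slot_mode U (A + 1 * int i) w = 0"
    using slot_mode_eventually_0[of 1 U A w] zero_less_one by blast
  then have y0: "y i = 0" if "i \<ge> Ny" for i using that by (simp add: y_def)

  have J1: "J1 a = pairing (fps_X ^ (d - a) * ?G) x" if "a \<le> d" for a
  proof -
    have 1: "A + int a + int k * (?l' - int i) = A + l - int (d - a + k * i)" for i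
      using that dk by (simp add: of_nat_diff algebra_simps)
    have 2: "B + int d - int a + int k * int i = B + int (d - a + k * i)" for i
      using that by (simp add: of_nat_diff)
    show ?thesis
      unfolding J1_def jacobi_term1_def pairing_shift_dilate[OF k] 1 2
      by (simp add: x_def slot_mode_def fps_binexp_def)
  qed
  have "(\<Sum>a\<le>d. q' a *\<^sub>C J1 a) = (\<Sum>a\<le>d. q' a *\<^sub>C pairing (fps_X ^ (d - a) * ?G) x)"
    by (intro sum.cong) (auto simp: J1)
  also have "\<dots> = pairing (\<Sum>a\<le>d. fps_const (q' a) * (fps_X ^ (d - a) * ?G)) x"
    by (rule pairing_sum[symmetric]) (rule x0)
  \<comment> \<open>Summed with the weights \<open>q'\<close>, the monomials give the polynomial at
    (1, X), and the denominator cancels to leave (1 - X)^l.\<close>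
  also have "(\<Sum>a\<le>d. fps_const (q' a) * (fps_X ^ (d - a) * ?G)) = fps_binexp (of_int l)"
    using q'[of 1 fps_X] fps_binexp_cyc[OF k l] by (simp add: sum_distrib_right mult.assoc)
  finally have S1: "(\<Sum>a\<le>d. q' a *\<^sub>C J1 a) = pairing (fps_binexp (of_int l)) x" .

  have J2: "J2 a = (- 1) ^ L *\<^sub>C pairing (fps_X ^ a * ?G) y" if "a \<le> d" for a
  proof -
    have 1: "B + int d - int a + int k * (?l' - int i) = B + l - int (a + k * i)" for i
      using that dk by (simp add: of_nat_diff algebra_simps)
    have 2: "A + int a + int k * int i = A + int (a + k * i)" for i
      by simp
    have 3: "(- 1) powi ?l' = ((- 1) ^ L :: complex)"
      by (simp add: power_int_minus power_inverse flip: power_inverse)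
    show ?thesis
      unfolding J2_def jacobi_term2_def pairing_shift_dilate[OF k] 1 2 3
      by (simp add: y_def slot_mode_def fps_binexp_def)
  qed
  \<comment> \<open>The second term uses the polynomial at (X, 1): \<open>cyc_form\<close> is
    symmetric and (X - 1)^e contributes (-1)^e, which joins the sign (-1)^L of the delta
    function.\<close>
  have sgn: "(- 1) ^ L * (- 1) ^ e = ((- 1) powi l :: complex)"
    by (simp add: l power_int_diff power_int_minus) (simp add: field_simps flip: power_mult_distrib)
  have "(\<Sum>a\<le>d. q' a *\<^sub>C J2 a) = (\<Sum>a\<le>d. q' a *\<^sub>C ((- 1) ^ L *\<^sub>C pairing (fps_X ^ a * ?G) y))"
    by (intro sum.cong) (auto simp: J2)
  also have "\<dots> = (- 1) ^ L *\<^sub>C (\<Sum>a\<le>d. q' a *\<^sub>C pairing (fps_X ^ a * ?G) y)"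
    by (simp add: complex_vector.scale_sum_right scaleC_scaleC mult.commute)
  also have "(\<Sum>a\<le>d. q' a *\<^sub>C pairing (fps_X ^ a * ?G) y) = pairing (\<Sum>a\<le>d. fps_const (q' a) * (fps_X ^ a * ?G)) y"
    by (rule pairing_sum[symmetric]) (rule y0)
  also have "(\<Sum>a\<le>d. fps_const (q' a) * (fps_X ^ a * ?G)) = cyc_form k fps_X 1 ^ L * (fps_X - 1) ^ e * ?G"
    using q'[of fps_X 1] by (simp add: sum_distrib_right mult.assoc)
  also have "cyc_form k fps_X 1 = (cyc_form k 1 fps_X :: complex fps)"
    unfolding cyc_form_def by (rule sum.reindex_bij_witness[of _ "\<lambda>b. k - 1 - b" "\<lambda>b. k - 1 - b"]) auto
  also have "(fps_X - 1) ^ e = (fps_const ((- 1) ^ e) * (1 - fps_X) ^ e :: complex fps)"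
  proof -
    have "fps_X - 1 = (fps_const (- 1) * (1 - fps_X) :: complex fps)"
      by (simp flip: fps_const_neg)
    then show ?thesis by (simp only: power_mult_distrib fps_const_power)
  qed
  also have "cyc_form k 1 fps_X ^ L * (fps_const ((- 1) ^ e) * (1 - fps_X) ^ e) * ?G
      = (\<Sum>a\<in>{0::nat}. fps_const ((- 1) ^ e) * fps_binexp (of_int l))"
    unfolding fps_binexp_cyc[OF k l, symmetric] by (simp add: mult_ac)
  also have "pairing \<dots> y = (\<Sum>a\<in>{0::nat}. (- 1) ^ e *\<^sub>C pairing (fps_binexp (of_int l)) y)"
    by (rule pairing_sum) (rule y0)
  finally have S2: "(\<Sum>a\<le>d. q' a *\<^sub>C J2 a) = (- 1) powi l *\<^sub>C pairing (fps_binexp (of_int l)) y"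
    using sgn by (simp add: scaleC_scaleC)

  \<comment> \<open>The vector attached to x_0^i in summand j of the third term. The mode i - L is
    nonnegative from i = L on.\<close>
  define z where "z j i = Yg (tensor_mode V ((tensor_cycle V ^^ j) ?u) (int i - int L) ?v)
      (A + B + int d - int k * int i) w" for j i
  define \<zeta> where "\<zeta> j = inverse (\<eta> ^ j)" for j :: nat
  have \<eta>: "\<eta> ^ k = 1" "\<And>j. 0 < j \<Longrightarrow> j < k \<Longrightarrow> \<eta> ^ j \<noteq> 1"
    using root by (auto simp: primitive_root_def k_def)
  have \<eta>0: "\<eta> \<noteq> 0" using \<eta>(1) k by (metis power_0_left zero_neq_one neq0_conv)
  have z0: "z 0 i = slot_mode (mode V U (int i - int L) W) (A + B + int d - int k * int i) w" for i
    by (simp add: z_def slot_mode_def tensor_mode_slot_0[OF U W])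
  have zj: "z j i = 0" if "0 < j" "j < k" "i \<ge> L" for j i
    using that clinear_0[OF tw.linear_left]
    by (simp add: z_def k_def tensor_cycle_pow_slot[OF U] tensor_mode_distinct_slots[OF U W])
  have "\<exists>N. \<forall>j<k. \<forall>i\<ge>N. z j i = 0"
  proof -
    obtain K where K: "\<And>n. n \<ge> K \<Longrightarrow> mode V U n W = 0" using truncation by blast
    have "z j i = 0" if "j < k" "i \<ge> nat \<bar>K\<bar> + L" for i j
    proof (cases "j = 0")
      case True
      have "mode V U (int i - int L) W = 0" by (rule K) (use that in linarith)
      then show ?thesis by (simp add: True z0)
    qed (use that zj in auto)
    then show ?thesis by blast
  qed
  then obtain Nz where zN: "\<And>j i. j < k \<Longrightarrow> i \<ge> Nz \<Longrightarrow> z j i = 0" by blast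
  let ?b = "\<lambda>s. fps_binomial (s / of_nat k)"
  \<comment> \<open>This is z^(A+a) for z = \<open>\<zeta> j\<close> (1 + X)^(1/k), the value of
    z_1/z_2 on the j-th branch in terms of X = x_0/x_2.\<close>
  define F where "F j a = fps_const (\<zeta> j powi A) * (?b (of_int A) * (fps_const (\<zeta> j) * ?b 1) ^ a)" for j a
  have J3: "J3 a = (1 / of_nat k) *\<^sub>C (\<Sum>j<k. pairing (F j a) (z j))" for a
  proof -
    have t: "\<eta> powi (int j * (int k * int i - (A + int a) - int k)) * binexp (of_int (int k * int i - (A + int a) - int k) / of_nat k) i
        = fps_nth (F j a) i" for i j
    proof -
      have "\<eta> powi (int j * (int k * int i - (A + int a) - int k)) = \<zeta> j powi (A + int a)"
      proof -
        have "int j * (int k * int i - (A + int a) - int k) = int k * (int j * (int i - 1)) - int j * (A + int a)"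
          by (simp add: algebra_simps)
        then show ?thesis
          unfolding \<zeta>_def using power_int_root_of_unity[OF \<eta>(1) \<eta>0] by metis
      qed
      moreover have "binexp (of_int (int k * int i - (A + int a) - int k) / of_nat k) i
          = (of_int A / of_nat k + of_nat a / of_nat k) gchoose i"
      proof -
        have "of_int (int k * int i - (A + int a) - int k) / of_nat k
            = (of_nat i - (of_int A / of_nat k + of_nat a / of_nat k) - 1 :: complex)"
          using k by (simp add: field_simps)
        then show ?thesis by (simp only: binexp_eq_gbinomial)
      qed
      moreover have "F j a = fps_const (\<zeta> j powi (A + int a)) * fps_binomial (of_int A / of_nat k + of_nat a / of_nat k)"
        using \<eta>0 by (simp add: F_def \<zeta>_def power_int_add power_mult_distrib fps_binomial_power
            fps_binomial_add_mult fps_const_power mult_ac flip: fps_const_mult)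
      ultimately show ?thesis by simp
    qed
    have "A + int a + (B + int d - int a) - int k * int i = A + B + int d - int k * int i" for i
      by simp
    then show ?thesis
      unfolding J3_def jacobi_term3_def Let_def t pairing_def z_def
      by (simp add: tensor_vosa_def add.assoc)
  qed
  define R where "R j = (\<Sum>a\<le>d. fps_const (q' a) * F j a)" for j
  have "(\<Sum>a\<le>d. q' a *\<^sub>C J3 a) = (1 / of_nat k) *\<^sub>C (\<Sum>a\<le>d. \<Sum>j<k. q' a *\<^sub>C pairing (F j a) (z j))"
    unfolding J3 by (simp add: complex_vector.scale_sum_right scaleC_scaleC mult.commute)
  also have "\<dots> = (1 / of_nat k) *\<^sub>C (\<Sum>j<k. \<Sum>a\<le>d. q' a *\<^sub>C pairing (F j a) (z j))"
    by (subst sum.swap) simp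
  also have "\<dots> = (1 / of_nat k) *\<^sub>C (\<Sum>j<k. pairing (R j) (z j))"
    unfolding R_def by (intro arg_cong[of _ _ "\<lambda>v. _ *\<^sub>C v"] sum.cong refl pairing_sum[symmetric]) (rule zN, auto)
  also have "(\<Sum>j<k. pairing (R j) (z j)) = (\<Sum>j\<in>{0}. pairing (R j) (z j))"
  proof (rule sum.mono_neutral_right)
    show "\<forall>j\<in>{..<k} - {0}. pairing (R j) (z j) = 0"
    proof
      fix j assume "j \<in> {..<k} - {0}"
      then have j: "0 < j" "j < k" by auto
      let ?z = "fps_const (\<zeta> j) * ?b 1"
      have R: "R j = (fps_const (\<zeta> j powi A) * ?b (of_int A)) * (cyc_form k ?z 1 ^ L * (?z - 1) ^ e)"
        unfolding q' by (simp add: R_def F_def sum_distrib_left mult_ac)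
      have "(\<eta> ^ j) ^ k = (\<eta> ^ k) ^ j"
        by (simp only: power_mult[symmetric] mult.commute)
      then have "\<zeta> j ^ k = 1"
        using \<eta>(1) by (simp add: \<zeta>_def power_inverse)
      moreover have "?b 1 ^ k = 1 + fps_X"
        using k by (simp add: fps_binomial_power fps_binomial_1)
      ultimately have 1: "?z ^ k = 1 + fps_X"
        by (simp add: power_mult_distrib fps_const_power)
      have 2: "fps_nth ?z 0 \<noteq> 1"
        using \<eta>(2)[OF j] by (simp add: \<zeta>_def inverse_eq_1_iff)
      \<comment> \<open>Below degree L the coefficient vanishes because \<open>cyc_form\<close> has
        a zero at this branch; from degree L on the vector vanishes because distinct tensor factors
        have regular products.\<close>
      show "pairing (R j) (z j) = 0"
      proof (rule pairing_eq_0)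
        fix i
        show "fps_nth (R j) i = 0 \<or> z j i = 0"
          unfolding R using cyc_form_order[OF k 1 2, of i L] zj[OF j, of i] by (cases "i < L") auto
      qed
    qed
  qed (use k in auto)
  finally have S3: "(\<Sum>a\<le>d. q' a *\<^sub>C J3 a) = (1 / of_nat k) *\<^sub>C pairing (R 0) (z 0)"
    by simp

  \<comment> \<open>On the branch j = 0 put X = k f(y), so that z = 1 + y. The factor k^i comes from
    this rescaling, and \<open>cyc_form\<close> becomes k f(y)/y, whence k^L and the shift of the
    exponent by L.\<close>
  have R0: "fps_nth (R 0) i * of_nat k ^ i = of_nat k ^ L *
     fps_nth (fps_X ^ e * (fps_pw (fps_covu k) (of_nat L - of_nat i - 1) * fps_binomial (of_int A + of_nat k - 1))) i" for i
  proof -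
    let ?P = "fps_pw (fps_covu k) (- of_nat i - 1) * fps_binomial (of_int A + of_nat k - 1)"
    have F0: "fps_nth (F 0 a) i * of_nat k ^ i = fps_nth (?P * (1 + fps_X) ^ a) i" for a
    proof -
      have "F 0 a = fps_binomial ((of_int A + of_nat a) / of_nat k)"
        by (simp add: F_def \<zeta>_def fps_binomial_power fps_binomial_add_mult add_divide_distrib)
      then have "fps_nth (F 0 a) i * of_nat k ^ i = ((of_int A + of_nat a) / of_nat k gchoose i) * of_nat k ^ i"
        by simp
      also have "\<dots> = fps_nth (fps_pw (fps_covu k) (- of_nat i - 1) * fps_binomial (of_int A + of_nat a + of_nat k - 1)) i"
        by (rule gbinomial_root_eq[OF k])
      also have "fps_binomial (of_int A + of_nat a + of_nat k - 1)
          = fps_binomial (of_int A + of_nat k - 1) * (1 + fps_X :: complex fps) ^ a"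
        unfolding fps_binomial_of_nat_complex[symmetric] fps_binomial_add_mult[symmetric]
        by (simp add: algebra_simps)
      finally show ?thesis by (simp add: mult.assoc)
    qed
    have "fps_nth (R 0) i * of_nat k ^ i = (\<Sum>a\<le>d. q' a * (fps_nth (F 0 a) i * of_nat k ^ i))"
      by (simp add: R_def fps_sum_nth sum_distrib_right mult.assoc)
    also have "\<dots> = fps_nth (?P * (\<Sum>a\<le>d. fps_const (q' a) * ((1 + fps_X) ^ a * 1 ^ (d - a)))) i"
      unfolding F0 by (simp add: sum_distrib_left fps_sum_nth mult.left_commute[of _ "fps_const _"])
    also have "(\<Sum>a\<le>d. fps_const (q' a) * ((1 + fps_X) ^ a * 1 ^ (d - a))) = cyc_form k (1 + fps_X) 1 ^ L * fps_X ^ e"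
      unfolding q'[symmetric] by simp
    also have "cyc_form k (1 + fps_X) 1 = fps_const (of_nat k) * fps_covu k"
      by (rule cyc_form_cov[OF k])
    also have "?P * ((fps_const (of_nat k) * fps_covu k) ^ L * fps_X ^ e)
       = fps_const (of_nat k ^ L) * (fps_X ^ e * ((fps_pw (fps_covu k) (- of_nat i - 1) * fps_covu k ^ L) * fps_binomial (of_int A + of_nat k - 1)))"
      by (simp add: power_mult_distrib fps_const_power mult_ac)
    also have "fps_pw (fps_covu k) (- of_nat i - 1) * fps_covu k ^ L = fps_pw (fps_covu k) (of_nat L - of_nat i - 1)"
      using fps_pw_add[of "fps_covu k" "- of_nat i - 1" "of_nat L"] k by (simp add: fps_pw_of_nat algebra_simps)
    finally show ?thesis by simp
  qed
  \<comment> \<open>The factor y^e left from (z - 1)^e makes the sum start at i = e, so that the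
    mode i - L becomes l + d'.\<close>
  have "pairing (R 0) (z 0) = Sum_any (\<lambda>d'. fps_nth (R 0) (e + d') *\<^sub>C z 0 (e + d'))"
    unfolding pairing_def
  proof (rule Sum_any_reindex_inj)
    fix i assume "i \<notin> range (\<lambda>d'. e + d')"
    then have "i < e" by (metis le_add_diff_inverse not_le rangeI)
    then have "fps_nth (R 0) i * of_nat k ^ i = 0" unfolding R0 by (simp add: fps_X_power_mult_nth)
    then show "fps_nth (R 0) i *\<^sub>C z 0 i = 0" using k by simp
  qed (simp add: inj_def)
  also have "\<dots> = Sum_any (\<lambda>d::nat. (of_nat k powi (- (l + int d)) *
        fps_nth (fps_pw (fps_covu k) (- of_int l - of_nat d - 1) * fps_binomial (of_int A + of_nat k - 1)) d) *\<^sub>C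
        slot_mode (mode V U (l + int d) W) (A + B + l - int k * (l + int d)) w)"
  proof (rule arg_cong[of _ _ Sum_any], rule ext)
    fix d' :: nat
    have "fps_nth (R 0) (e + d') = (of_nat k ^ L / of_nat k ^ (e + d')) *
        fps_nth (fps_pw (fps_covu k) (of_nat L - of_nat (e + d') - 1) * fps_binomial (of_int A + of_nat k - 1)) d'"
      using R0[of "e + d'"] k by (simp add: fps_X_power_mult_nth field_simps)
    moreover have "of_nat k ^ L / of_nat k ^ (e + d') = (of_nat k powi (- (l + int d')) :: complex)"
    proof -
      have 1: "- (l + int d') = int L - int (e + d')" by (simp add: l)
      have "of_nat k powi (int L - int (e + d'))
          = (of_nat k powi int L / of_nat k powi int (e + d') :: complex)"
        by (rule power_int_diff) (use k in simp)
      then show ?thesis unfolding 1 by (simp only: power_int_of_nat)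
    qed
    moreover have "of_nat L - of_nat (e + d') - 1 = (- of_int l - of_nat d' - 1 :: complex)"
      by (simp add: l)
    moreover have "int (e + d') - int L = l + int d'" by (simp add: l)
    moreover have "A + B + int d - int k * int (e + d') = A + B + l - int k * (l + int d')"
      using dk by (simp add: l algebra_simps)
    ultimately show "fps_nth (R 0) (e + d') *\<^sub>C z 0 (e + d') = (of_nat k powi (- (l + int d')) *
        fps_nth (fps_pw (fps_covu k) (- of_int l - of_nat d' - 1) * fps_binomial (of_int A + of_nat k - 1)) d') *\<^sub>C
        slot_mode (mode V U (l + int d') W) (A + B + l - int k * (l + int d')) w"
      unfolding z0 by (simp only:)
  qed
  finally have S4: "pairing (R 0) (z 0) = \<dots>" .
  have "(\<Sum>a\<le>d. q' a *\<^sub>C J1 a) - ksign (p * q) *\<^sub>C (\<Sum>a\<le>d. q' a *\<^sub>C J2 a) = (\<Sum>a\<le>d. q' a *\<^sub>C J3 a)"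
    unfolding J[symmetric]
    by (simp add: complex_vector.scale_right_diff_distrib sum_subtractf complex_vector.scale_sum_right
        scaleC_scaleC mult.commute)
  then show ?thesis
    unfolding S1 S2 S3 S4 by (simp add: pairing_def fps_binexp_def x_def y_def)
qed

end

section \<open>The untwisted module\<close>

lemma clinear_Sum_any_fun:
  assumes "\<And>i. clinear (f i)" "\<And>u. finite {i. f i u \<noteq> 0}"
  shows "clinear (\<lambda>u. Sum_any (\<lambda>i. f i u))"
proof (rule clinearI)
  fix x y c
  show "Sum_any (\<lambda>i. f i (x + y)) = Sum_any (\<lambda>i. f i x) + Sum_any (\<lambda>i. f i y)"
    unfolding Sum_any.distrib[OF assms(2) assms(2), symmetric] by (simp only: clinear_add[OF assms(1)])
  have "clinear (\<lambda>v :: 'c. c *\<^sub>C v)"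
    by (rule clinearI) (simp_all add: scaleC_add_right scaleC_scaleC mult.commute)
  from clinear_Sum_any[OF this assms(2)]
  show "Sum_any (\<lambda>i. f i (c *\<^sub>C x)) = c *\<^sub>C Sum_any (\<lambda>i. f i x)"
    by (simp only: clinear_scale[OF assms(1)])
qed

lemma Sum_any_sum_swap:
  assumes "finite I" "\<And>r. r \<in> I \<Longrightarrow> finite {i. f r i \<noteq> 0}"
  shows "finite {i. (\<Sum>r\<in>I. f r i) \<noteq> (0 :: 'a::comm_monoid_add)}"
    and "Sum_any (\<lambda>i. \<Sum>r\<in>I. f r i) = (\<Sum>r\<in>I. Sum_any (f r))"
proof -
  have "finite {i. (\<Sum>r\<in>I. f r i) \<noteq> 0} \<and> Sum_any (\<lambda>i. \<Sum>r\<in>I. f r i) = (\<Sum>r\<in>I. Sum_any (f r))"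
    using assms
  proof (induction I)
    case (insert x I)
    then have IH: "finite {i. (\<Sum>r\<in>I. f r i) \<noteq> 0}" "Sum_any (\<lambda>i. \<Sum>r\<in>I. f r i) = (\<Sum>r\<in>I. Sum_any (f r))"
      and x: "finite {i. f x i \<noteq> 0}" by auto
    have "finite {i. f x i + (\<Sum>r\<in>I. f r i) \<noteq> 0}"
      by (rule finite_subset[OF _ finite_UnI[OF x IH(1)]]) auto
    then show ?case
      using insert(1,2) by (simp add: Sum_any.distrib[OF x IH(1)] IH(2))
  qed simp
  then show "finite {i. (\<Sum>r\<in>I. f r i) \<noteq> 0}"
    and "Sum_any (\<lambda>i. \<Sum>r\<in>I. f r i) = (\<Sum>r\<in>I. Sum_any (f r))" by auto
qed

lemma finite_eventually_0:
  fixes N :: nat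
  assumes "\<And>i. i \<ge> N \<Longrightarrow> f i = 0"
  shows "finite {i. f i \<noteq> 0}"
proof (rule finite_subset)
  show "{i. f i \<noteq> 0} \<subseteq> {..<N}"
    using assms by (metis (mono_tags, lifting) mem_Collect_eq lessThan_iff not_le subsetI)
qed simp

text \<open>Regrouping by the partial totals n = r + r' + d and p = r + d.\<close>

lemma sum_lessThan_simplex:
  fixes t :: "nat \<Rightarrow> nat \<Rightarrow> nat \<Rightarrow> 'a::comm_monoid_add"
  assumes "\<And>r r' d. r + r' + d \<ge> K \<Longrightarrow> t r r' d = 0"
  shows "(\<Sum>r<K. \<Sum>r'<K. \<Sum>d<K. t r r' d) = (\<Sum>n<K. \<Sum>p\<le>n. \<Sum>d\<le>p. t (p - d) (n - p) d)"
proof -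
  let ?A = "{(r, r', d). r + r' + d < K}"
  have nz: "r + r' + d < K" if "t r r' d \<noteq> 0" for r r' d
    using assms that by (meson not_le)
  have "(\<Sum>r<K. \<Sum>r'<K. \<Sum>d<K. t r r' d) = (\<Sum>(r, r', d)\<in>{..<K} \<times> {..<K} \<times> {..<K}. t r r' d)"
    by (simp add: sum.cartesian_product)
  also have "\<dots> = (\<Sum>(r, r', d)\<in>?A. t r r' d)"
    by (rule sum.mono_neutral_right) (auto dest: nz)
  also have "\<dots> = (\<Sum>(n, p, d)\<in>(SIGMA n:{..<K}. SIGMA p:{..n}. {..p}). t (p - d) (n - p) d)"
    by (rule sum.reindex_bij_witness[where i = "\<lambda>(n, p, d). (p - d, n - p, d)"
        and j = "\<lambda>(r, r', d). (r + r' + d, r + d, d)"]) auto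
  also have "\<dots> = (\<Sum>n<K. \<Sum>p\<le>n. \<Sum>d\<le>p. t (p - d) (n - p) d)"
    by (simp add: sum.Sigma)
  finally show ?thesis .
qed

context vertex_operator_superalgebra
begin

lemma weight_parity_shift: "weight_parity (m - 2 * r) = weight_parity m"
  by (simp add: weight_parity_def)

lemma exp_vir_par: "u \<in> wsp V m \<Longrightarrow> exp_vir V a u r \<in> par V (weight_parity m)"
  using exp_vir_wsp[of u m a r] wsp_par[of "m - 2 * int r"] weight_parity_shift[of m "int r"] by auto

lemma par_induct [consumes 1, case_names homogeneous zero add]:
  assumes u: "u \<in> par V p"
    and hom: "\<And>m u. u \<in> wsp V m \<Longrightarrow> weight_parity m = p \<Longrightarrow> P u"
    and zero: "P 0" and add: "\<And>x y. P x \<Longrightarrow> P y \<Longrightarrow> P (x + y)"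
  shows "P u"
proof -
  have "par V p = cspan (\<Union>m\<in>{m. weight_parity m = p}. wsp V m)"
    using even_part odd_part bit_cases[of p] by (auto simp: weight_parity_def)
  with u have "u \<in> cspan (\<Union>m\<in>{m. weight_parity m = p}. wsp V m)" by simp
  then show ?thesis
  proof (rule complex_vector.span_induct_alt)
    fix c x y assume x: "x \<in> (\<Union>m\<in>{m. weight_parity m = p}. wsp V m)" and y: "P y"
    then obtain m where "x \<in> wsp V m" "weight_parity m = p" by blast
    then have "P (c *\<^sub>C x)"
      using hom complex_vector.subspace_scale[OF direct_sum_subspace[OF grading]] by blast
    then show "P (c *\<^sub>C x + y)" using y by (rule add)
  qed (rule zero)
qed

text \<open>The coefficient of degree r lowers the weight by r, and weights are bounded
  below.\<close>

lemma exp_vir_eventually_0: "\<exists>R. \<forall>r\<ge>R. exp_vir V a u r = 0"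
  using grading
proof (induction u rule: direct_sum_induct)
  case (homogeneous m u)
  obtain N where N: "\<And>m. m < N \<Longrightarrow> wsp V m = {0}" using bounded_below by blast
  have "exp_vir V a u r = 0" if "r \<ge> nat (\<bar>m\<bar> + \<bar>N\<bar> + 1)" for r
    using exp_vir_wsp[OF homogeneous, of a r] N[of "m - 2 * int r"] that by simp
  then show ?case by blast
next
  case zero
  then show ?case by (simp add: clinear_0[OF clinear_exp_vir])
next
  case (add x y)
  then obtain R R' where "\<forall>r\<ge>R. exp_vir V a x r = 0" "\<forall>r\<ge>R'. exp_vir V a y r = 0" by blast
  then have "\<forall>r\<ge>max R R'. exp_vir V a (x + y) r = 0"
    by (simp add: clinear_add[OF clinear_exp_vir])
  then show ?case by blast
qed

text \<open>The sum over i multiplies the series in \<open>hom_coeff\<close> by (1 + y)^m. The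
  resulting coefficient is the one in \<open>slot_jacobi\<close> for A = m + 1 - k + (k - 1) wt u -
  k r, with r = p - d the degree taken from u.\<close>

lemma exp_vir_mode_binomial_sum:
  assumes k: "k > 0" and a: "change_of_variable k a" and u: "u \<in> wsp V mu"
  shows "(\<Sum>i\<le>n. (of_int m gchoose i) *\<^sub>C exp_vir V a (mode V u (l + int i) v) (n - i))
    = (\<Sum>p\<le>n. \<Sum>d\<le>p. fps_nth (fps_pw (fps_covu k) (- of_int l - of_nat d - 1)
        * fps_binomial (of_int m + (of_nat k - 1) * (of_int mu / 2) - of_nat k * of_nat (p - d))) d *\<^sub>C
        mode V (exp_vir V a u (p - d)) (l + int d) (exp_vir V a v (n - p)))"
proof -
  define G where "G i d r t = ((of_int m gchoose i) * hom_coeff k mu (l + int i) d r) *\<^sub>C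
      mode V (exp_vir V a u r) (l + int i + int d) (exp_vir V a v t)" for i d r t
  have "(\<Sum>i\<le>n. (of_int m gchoose i) *\<^sub>C exp_vir V a (mode V u (l + int i) v) (n - i))
    = (\<Sum>i\<le>n. \<Sum>p\<le>n - i. \<Sum>d\<le>p. G i d (p - d) (n - i - p))"
    unfolding exp_vir_mode[OF k a u] G_def by (simp add: complex_vector.scale_sum_right scaleC_scaleC)
  also have "\<dots> = (\<Sum>p\<le>n. \<Sum>i\<le>p. \<Sum>d\<le>p - i. G i d (p - i - d) (n - p))"
    by (rule sum_assoc_atMost[symmetric])
  also have "\<dots> = (\<Sum>p\<le>n. \<Sum>D\<le>p. \<Sum>i\<le>D. G i (D - i) (p - D) (n - p))"
    by (intro sum.cong refl sum_assoc_atMost[symmetric])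
  also have "\<dots> = (\<Sum>p\<le>n. \<Sum>d\<le>p. fps_nth (fps_pw (fps_covu k) (- of_int l - of_nat d - 1)
        * fps_binomial (of_int m + (of_nat k - 1) * (of_int mu / 2) - of_nat k * of_nat (p - d))) d *\<^sub>C
        mode V (exp_vir V a u (p - d)) (l + int d) (exp_vir V a v (n - p)))"
  proof (intro sum.cong refl)
    fix p D
    let ?h = "fps_pw (fps_covu k) (- of_int l - of_nat D - 1)
      * fps_binomial ((of_nat k - 1) * (of_int mu / 2) - of_nat k * of_nat (p - D))"
    have "G i (D - i) (p - D) (n - p) = ((of_int m gchoose i) * fps_nth ?h (D - i)) *\<^sub>C
        mode V (exp_vir V a u (p - D)) (l + int D) (exp_vir V a v (n - p))" if "i \<le> D" for i
    proof -
      have "- of_int (l + int i) - of_nat (D - i) - 1 = (- of_int l - of_nat D - 1 :: complex)"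
        "l + int i + int (D - i) = l + int D"
        using that by (simp_all add: of_nat_diff)
      then show ?thesis unfolding G_def hom_coeff_def by (simp only:)
    qed
    then have "(\<Sum>i\<le>D. G i (D - i) (p - D) (n - p))
      = (\<Sum>i\<le>D. ((of_int m gchoose i) * fps_nth ?h (D - i)) *\<^sub>C
        mode V (exp_vir V a u (p - D)) (l + int D) (exp_vir V a v (n - p)))"
      by (intro sum.cong) auto
    also have "\<dots> = fps_nth (fps_binomial (of_int m) * ?h) D *\<^sub>C
        mode V (exp_vir V a u (p - D)) (l + int D) (exp_vir V a v (n - p))"
      by (simp add: fps_mult_atMost[of "fps_binomial (of_int m)"] complex_vector.scale_sum_left)
    also have "fps_binomial (of_int m) * ?h = fps_pw (fps_covu k) (- of_int l - of_nat D - 1)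
        * fps_binomial (of_int m + (of_nat k - 1) * (of_int mu / 2) - of_nat k * of_nat (p - D))"
      unfolding mult.left_commute[of "fps_binomial (of_int m)"] fps_binomial_add_mult[symmetric]
      by (simp only: add_diff_eq)
    finally show "(\<Sum>i\<le>D. G i (D - i) (p - D) (n - p)) = fps_nth (fps_pw (fps_covu k) (- of_int l - of_nat D - 1)
        * fps_binomial (of_int m + (of_nat k - 1) * (of_int mu / 2) - of_nat k * of_nat (p - D))) D *\<^sub>C
        mode V (exp_vir V a u (p - D)) (l + int D) (exp_vir V a v (n - p))" .
  qed
  finally show ?thesis .
qed

section \<open>Coefficients of the inverse of Delta_k\<close>

abbreviation Delta_term :: "nat \<Rightarrow> (nat \<Rightarrow> complex) \<Rightarrow> complex \<Rightarrow> 'a \<Rightarrow> int \<Rightarrow> nat \<times> int \<Rightarrow> 'a"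
  where "Delta_term k a s u e \<equiv> \<lambda>(r, m). if (int k - 1) * m - 2 * int r = e
    then s powi m *\<^sub>C component (wsp V) m (exp_vir V a u r) else 0"

lemma finite_exp_vir_components: "finite {(r, m). component (wsp V) m (exp_vir V a u r) \<noteq> 0}"
proof -
  obtain R where R: "\<And>r. r \<ge> R \<Longrightarrow> exp_vir V a u r = 0" using exp_vir_eventually_0 by blast
  have "r < R" if "component (wsp V) m (exp_vir V a u r) \<noteq> 0" for r m
    by (rule ccontr) (use that R[of r] clinear_0[OF clinear_component[OF grading]] in auto)
  then have "{(r, m). component (wsp V) m (exp_vir V a u r) \<noteq> 0}
    \<subseteq> (SIGMA r:{..<R}. {m. component (wsp V) m (exp_vir V a u r) \<noteq> 0})"
    by auto
  then show ?thesis
    by (rule finite_subset) (auto simp: finite_component[OF grading])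
qed

lemma finite_Delta_term: "finite {x. Delta_term k a s u e x \<noteq> 0}"
  by (rule finite_subset[OF _ finite_exp_vir_components[of a u]]) (auto split: if_splits)

lemma Delta_inv_linear: "clinear (\<lambda>u. Delta_inv V k a s u e)"
proof -
  have "clinear (\<lambda>u. Delta_term k a s u e x)" for x
  proof -
    have lin: "clinear (\<lambda>u. component (wsp V) m (exp_vir V a u r))" for m r
      by (rule clinear_compose'[OF clinear_component[OF grading] clinear_exp_vir])
    then show ?thesis
      by (cases x) (auto intro!: clinearI
          simp: clinear_add[OF lin] clinear_scale[OF lin] scaleC_add_right scaleC_scaleC mult.commute)
  qed
  then show ?thesis
    unfolding Delta_inv_def by (rule clinear_Sum_any_fun) (rule finite_Delta_term)
qed

lemma finite_Delta_inv: "finite {e. Delta_inv V k a s u e \<noteq> 0}"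
proof (rule finite_subset)
  show "finite ((\<lambda>(r, m). (int k - 1) * m - 2 * int r) ` {(r, m). component (wsp V) m (exp_vir V a u r) \<noteq> 0})"
    by (rule finite_imageI[OF finite_exp_vir_components])
  show "{e. Delta_inv V k a s u e \<noteq> 0}
    \<subseteq> (\<lambda>(r, m). (int k - 1) * m - 2 * int r) ` {(r, m). component (wsp V) m (exp_vir V a u r) \<noteq> 0}"
  proof
    fix e assume "e \<in> {e. Delta_inv V k a s u e \<noteq> 0}"
    then have "{x. Delta_term k a s u e x \<noteq> 0} \<noteq> {}"
      unfolding Delta_inv_def Sum_any.expand_set by force
    then obtain x where "Delta_term k a s u e x \<noteq> 0" by blast
    then show "e \<in> (\<lambda>(r, m). (int k - 1) * m - 2 * int r) ` {(r, m). component (wsp V) m (exp_vir V a u r) \<noteq> 0}"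
      by (intro image_eqI[of _ _ x]) (auto split: if_splits prod.splits)
  qed
qed

text \<open>For odd k the exponent (k - 1) m - 2 r is even for every doubled weight m, including odd
  ones.\<close>

lemma Delta_inv_odd: "odd k \<Longrightarrow> odd e \<Longrightarrow> Delta_inv V k a s u e = 0"
proof -
  assume "odd k" "odd e"
  then have z: "Delta_term k a s u e x = 0" for x by (cases x) auto
  then have "Sum_any (Delta_term k a s u e) = Delta_term k a s u e undefined"
    by (intro Sum_any_single)
  then show "Delta_inv V k a s u e = 0" unfolding Delta_inv_def z .
qed

text \<open>The part of degree r has doubled weight mu - 2 r, so its exponent is (k - 1)(mu - 2 r) -
  2 r = (k - 1) mu - 2 k r.\<close>

lemma Delta_inv_homogeneous:
  assumes u: "u \<in> wsp V mu" and R: "\<And>r. r \<ge> R \<Longrightarrow> exp_vir V a u r = 0"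
  shows "Delta_inv V k a s u e = (\<Sum>r<R. if (int k - 1) * mu - 2 * int k * int r = e
    then s powi (mu - 2 * int r) *\<^sub>C exp_vir V a u r else 0)"
proof -
  have c: "component (wsp V) m (exp_vir V a u r) = (if m = mu - 2 * int r then exp_vir V a u r else 0)" for m r
    by (rule component_of_homogeneous[OF grading exp_vir_wsp[OF u]])
  have "Delta_inv V k a s u e = Sum_any (\<lambda>r. Delta_term k a s u e (r, mu - 2 * int r))"
    unfolding Delta_inv_def
  proof (rule Sum_any_reindex_inj)
    show "inj (\<lambda>r. (r, mu - 2 * int r))" by (auto simp: inj_def)
    fix x assume x: "x \<notin> range (\<lambda>r. (r, mu - 2 * int r))"
    obtain r m where [simp]: "x = (r, m)" by (cases x)
    have "m \<noteq> mu - 2 * int r" using x by auto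
    then show "Delta_term k a s u e x = 0" by (simp add: c)
  qed
  also have "\<dots> = (\<Sum>r<R. Delta_term k a s u e (r, mu - 2 * int r))"
    by (rule Sum_any.expand_superset) (use R in \<open>auto simp: c not_less[symmetric] split: if_splits\<close>)
  also have "\<dots> = (\<Sum>r<R. if (int k - 1) * mu - 2 * int k * int r = e
    then s powi (mu - 2 * int r) *\<^sub>C exp_vir V a u r else 0)"
    by (intro sum.cong refl) (simp add: c algebra_simps)
  finally show ?thesis .
qed

end

locale untwisted_module = twisted_tensor_module V c \<eta> Mg Yg
  for V :: "'v::complex_vector vosa_data" and c \<eta> :: complex
    and Mg :: "bit \<Rightarrow> 'm::complex_vector set"
    and Yg :: "('v, 'k::finite) tensor_power \<Rightarrow> int \<Rightarrow> 'm \<Rightarrow> 'm" +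
  fixes a :: "nat \<Rightarrow> complex" and s :: complex
  assumes odd_order: "odd CARD('k)" and cov: "change_of_variable CARD('k) a"
    and sqrt: "s ^ 2 = of_nat CARD('k)"
begin

abbreviation Y :: "'v \<Rightarrow> int \<Rightarrow> 'm \<Rightarrow> 'm"
  where "Y \<equiv> untwisted_mode V a s Yg"

lemma s_nonzero: "s \<noteq> 0"
  using sqrt by auto

lemma untwisted_coeff_eq: "untwisted_coeff V a s Yg u h w
    = Sum_any (\<lambda>N. slot_mode (Delta_inv V CARD('k) a s u (h + 2 * N + 2 * int CARD('k))) N w)"
  by (simp add: untwisted_coeff_def slot_mode_def)

lemma untwisted_coeff_odd: "odd h \<Longrightarrow> untwisted_coeff V a s Yg u h w = 0"
  by (simp add: untwisted_coeff_eq Delta_inv_odd[OF odd_order])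

lemma Y_linear_left: "clinear (\<lambda>u. Y u n w)"
proof -
  let ?e = "\<lambda>N. 2 * (- n - 1) + 2 * N + 2 * int CARD('k)"
  show ?thesis
    unfolding untwisted_mode_def untwisted_coeff_eq
  proof (rule clinear_Sum_any_fun)
    fix N
    show "clinear (\<lambda>u. slot_mode (Delta_inv V CARD('k) a s u (?e N)) N w)"
      by (rule clinear_compose'[OF slot_mode_linear_left Delta_inv_linear])
  next
    fix u
    have "finite (?e -` {e. Delta_inv V CARD('k) a s u e \<noteq> 0})"
      by (rule finite_vimageI[OF finite_Delta_inv]) (auto simp: inj_def)
    moreover have "{N. slot_mode (Delta_inv V CARD('k) a s u (?e N)) N w \<noteq> 0}
        \<subseteq> ?e -` {e. Delta_inv V CARD('k) a s u e \<noteq> 0}"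
      by auto
    ultimately show "finite {N. slot_mode (Delta_inv V CARD('k) a s u (?e N)) N w \<noteq> 0}"
      by (rule rev_finite_subset)
  qed
qed

text \<open>The integer (k - 1) wt u for wt u = mu/2; the division is exact because k is
  odd.\<close>

definition half_shift :: "int \<Rightarrow> int"
  where "half_shift mu = (int CARD('k) - 1) * mu div 2"

lemma half_shift: "2 * half_shift mu = (int CARD('k) - 1) * mu"
  using odd_order by (simp add: half_shift_def)

lemma of_int_half_shift: "(of_int (half_shift mu) :: complex) = (of_nat CARD('k) - 1) * (of_int mu / 2)"
proof -
  have "of_int (2 * half_shift mu) = (of_int ((int CARD('k) - 1) * mu) :: complex)"
    by (simp only: half_shift)
  then show ?thesis by (simp add: field_simps)
qed

text \<open>The degree r part of the exponential carries x^(\<open>half_shift mu\<close> - k r) and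
  the mode N carries x^(-N-k). Comparison with x^(-n-1) leaves exactly one N for each r.\<close>

lemma Y_homogeneous:
  assumes u: "u \<in> wsp V mu" and R: "\<And>r. r \<ge> R \<Longrightarrow> exp_vir V a u r = 0"
  shows "Y u n w = (\<Sum>r<R. s powi (mu - 2 * int r) *\<^sub>C
    slot_mode (exp_vir V a u r) (n + 1 - int CARD('k) + half_shift mu - int CARD('k) * int r) w)"
proof -
  let ?k = "CARD('k)"
  let ?N = "\<lambda>r. n + 1 - int ?k + half_shift mu - int ?k * int r"
  let ?t = "\<lambda>r N. s powi (mu - 2 * int r) *\<^sub>C slot_mode (exp_vir V a u r) N w"
  have D: "Delta_inv V ?k a s u e = (\<Sum>r<R. if (int ?k - 1) * mu - 2 * int ?k * int r = e
    then s powi (mu - 2 * int r) *\<^sub>C exp_vir V a u r else 0)" for e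
    by (rule Delta_inv_homogeneous[OF u]) (rule R)
  have "Y u n w = Sum_any (\<lambda>N. \<Sum>r<R. if N = ?N r then ?t r N else 0)"
    unfolding untwisted_mode_def untwisted_coeff_eq
  proof (rule arg_cong[of _ _ Sum_any], rule ext)
    fix N
    have "((int ?k - 1) * mu - 2 * int ?k * int r = 2 * (- n - 1) + 2 * N + 2 * int ?k) \<longleftrightarrow> N = ?N r" for r
      unfolding half_shift[symmetric] by auto
    then show "slot_mode (Delta_inv V ?k a s u (2 * (- n - 1) + 2 * N + 2 * int ?k)) N w
      = (\<Sum>r<R. if N = ?N r then ?t r N else 0)"
      unfolding D by (auto simp: clinear_sum[OF slot_mode_linear_left] clinear_scale[OF slot_mode_linear_left] intro!: sum.cong)
  qed
  also have "\<dots> = (\<Sum>r<R. Sum_any (\<lambda>N. if N = ?N r then ?t r N else 0))"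
    by (rule Sum_any_sum_swap(2)) (auto intro: finite_subset[of _ "{?N _}"])
  also have "\<dots> = (\<Sum>r<R. ?t r (?N r))"
    by (intro sum.cong refl) (subst Sum_any_single, auto)
  finally show ?thesis .
qed

lemma Y_linear_right: "clinear (Y u n)"
  using grading
proof (induction u rule: direct_sum_induct)
  case (homogeneous m u)
  obtain R where R: "\<And>r. r \<ge> R \<Longrightarrow> exp_vir V a u r = 0" using exp_vir_eventually_0 by blast
  have "clinear (\<lambda>w. \<Sum>r<R. s powi (m - 2 * int r) *\<^sub>C
    slot_mode (exp_vir V a u r) (n + 1 - int CARD('k) + half_shift m - int CARD('k) * int r) w)"
    by (intro clinear_sum_scale slot_mode_linear_right)
  then show ?case by (simp add: Y_homogeneous[OF homogeneous R, symmetric])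
next
  case zero
  show ?case by (simp add: clinear_0[OF Y_linear_left] clinearI)
next
  case (add x y)
  then show ?case
    by (intro clinearI) (simp_all add: clinear_add[OF Y_linear_left] clinear_add clinear_scale scaleC_add_right)
qed

lemma Y_truncation: "\<exists>K. \<forall>n\<ge>K. Y u n w = 0"
  using grading
proof (induction u rule: direct_sum_induct)
  case (homogeneous m u)
  obtain R where R: "\<And>r. r \<ge> R \<Longrightarrow> exp_vir V a u r = 0" using exp_vir_eventually_0 by blast
  have "\<forall>r. \<exists>K. \<forall>N\<ge>K. slot_mode (exp_vir V a u r) N w = 0" using slot_mode_truncation by blast
  from choice[OF this] obtain K where K: "\<And>r N. N \<ge> K r \<Longrightarrow> slot_mode (exp_vir V a u r) N w = 0" by blast
  define K' where "K' = (\<Sum>r<R. \<bar>K r - 1 + int CARD('k) - half_shift m + int CARD('k) * int r\<bar>)"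
  have "Y u n w = 0" if n: "n \<ge> K'" for n
  proof (subst Y_homogeneous[OF homogeneous], erule R, rule sum.neutral, rule ballI)
    fix r assume "r \<in> {..<R}"
    then have "\<bar>K r - 1 + int CARD('k) - half_shift m + int CARD('k) * int r\<bar> \<le> K'"
      unfolding K'_def by (intro member_le_sum) auto
    then have "K r \<le> n + 1 - int CARD('k) + half_shift m - int CARD('k) * int r"
      using n by linarith
    then show "s powi (m - 2 * int r) *\<^sub>C slot_mode (exp_vir V a u r)
        (n + 1 - int CARD('k) + half_shift m - int CARD('k) * int r) w = 0"
      by (simp add: K)
  qed
  then show ?case by blast
next
  case zero
  show ?case by (simp add: clinear_0[OF Y_linear_left])
next
  case (add x y)
  then obtain K K' where "\<forall>n\<ge>K. Y x n w = 0" "\<forall>n\<ge>K'. Y y n w = 0" by blast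
  then have "\<forall>n\<ge>max K K'. Y (x + y) n w = 0"
    by (simp add: clinear_add[OF Y_linear_left])
  then show ?case by blast
qed

lemma Y_eventually_0: "\<exists>N. \<forall>i\<ge>N. Y u (n + int i) w = 0"
proof -
  obtain K where K: "\<And>n. n \<ge> K \<Longrightarrow> Y u n w = 0" using Y_truncation by blast
  have "Y u (n + int i) w = 0" if "i \<ge> nat (\<bar>K\<bar> + \<bar>n\<bar>)" for i
    by (rule K) (use that in linarith)
  then show ?thesis by blast
qed

lemma Y_parity:
  assumes u: "u \<in> par V p" and w: "w \<in> Mg q"
  shows "Y u n w \<in> Mg (p + q)"
  using u
proof (induction rule: par_induct)
  case (homogeneous m u)
  obtain R where R: "\<And>r. r \<ge> R \<Longrightarrow> exp_vir V a u r = 0" using exp_vir_eventually_0 by blast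
  have "exp_vir V a u r \<in> par V p" for r
    using exp_vir_par[OF homogeneous(1)] homogeneous(2) by simp
  then have T: "slot_mode (exp_vir V a u r) N w \<in> Mg (p + q)" for r N
    unfolding slot_mode_def by (intro tw.parity[OF tensor_slot_par w])
  show ?case
    by (subst Y_homogeneous[OF homogeneous(1)], erule R)
      (intro T complex_vector.subspace_sum complex_vector.subspace_scale direct_sum_subspace[OF tw.superspace])
next
  case zero
  show ?case
    using complex_vector.subspace_0[OF direct_sum_subspace[OF tw.superspace]]
    by (simp add: clinear_0[OF Y_linear_left])
next
  case (add x y)
  then show ?case
    using complex_vector.subspace_add[OF direct_sum_subspace[OF tw.superspace]]
    by (simp add: clinear_add[OF Y_linear_left])
qed

lemma Y_vacuum: "Y (vac V) n w = (if n = - 1 then w else 0)"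
proof -
  have "Y (vac V) n w = (\<Sum>r<1. s powi (0 - 2 * int r) *\<^sub>C
    slot_mode (exp_vir V a (vac V) r) (n + 1 - int CARD('k) + half_shift 0 - int CARD('k) * int r) w)"
    by (rule Y_homogeneous[OF vac_wsp]) (simp add: exp_vir_vac)
  then show ?thesis
    by (simp add: exp_vir_vac slot_mode_def tensor_slot_vac tw.vacuum half_shift_def scaleC_one)
qed

section \<open>The Jacobi identity for Y_M\<close>

lemma jacobi_term1_eq: "jacobi_term1 1 Y u v l m n w
    = Sum_any (\<lambda>i. binexp (of_int l) i *\<^sub>C Y u (m + l - int i) (Y v (n + int i) w))"
  by (simp add: jacobi_term1_def add_diff_eq)

lemma jacobi_term2_eq: "jacobi_term2 1 Y u v l m n w = (- 1) powi l *\<^sub>C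
    Sum_any (\<lambda>i. binexp (of_int l) i *\<^sub>C Y v (n + l - int i) (Y u (m + int i) w))"
  by (simp add: jacobi_term2_def add_diff_eq)

lemma jacobi_term3_eq: "jacobi_term3 (mode V) 1 (\<lambda>v. v) 1 Y u v l m n w
    = Sum_any (\<lambda>i. (of_int m gchoose i) *\<^sub>C Y (mode V u (l + int i) v) (m + n - int i) w)"
proof -
  have "binexp (of_int (int i - m - 1)) i = of_int m gchoose i" for i
    using binexp_eq_gbinomial[of i "of_int m"] by simp
  then show ?thesis
    by (simp add: jacobi_term3_def Let_def scaleC_one)
qed

lemma finite_term1: "finite {i. binexp (of_int l) i *\<^sub>C Y u (m + l - int i) (Y v (n + int i) w) \<noteq> 0}"
proof -
  obtain N where "\<forall>i\<ge>N. Y v (n + int i) w = 0" using Y_eventually_0 by blast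
  then show ?thesis
    by (intro finite_eventually_0[of N]) (simp add: clinear_0[OF Y_linear_right])
qed

lemma finite_term3: "finite {i. (of_int m gchoose i) *\<^sub>C Y (mode V u (l + int i) v) (m + n - int i) w \<noteq> 0}"
proof -
  obtain K where K: "\<And>n. n \<ge> K \<Longrightarrow> mode V u n v = 0" using truncation by blast
  have "mode V u (l + int i) v = 0" if "i \<ge> nat (\<bar>K\<bar> + \<bar>l\<bar>)" for i
    by (rule K) (use that in linarith)
  then show ?thesis
    by (intro finite_eventually_0[of "nat (\<bar>K\<bar> + \<bar>l\<bar>)"]) (simp add: clinear_0[OF Y_linear_left])
qed

lemma clinear_scaled: "clinear f \<Longrightarrow> clinear (\<lambda>x. t *\<^sub>C f x)"
  by (rule clinearI) (simp_all add: clinear_add clinear_scale scaleC_add_right scaleC_scaleC mult.commute)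

text \<open>With the sign replaced by a constant this is linear in u and in v, so its vanishing can
  be tested on weight vectors.\<close>

definition jacobi_defect :: "complex \<Rightarrow> int \<Rightarrow> int \<Rightarrow> int \<Rightarrow> 'm \<Rightarrow> 'v \<Rightarrow> 'v \<Rightarrow> 'm"
  where "jacobi_defect \<epsilon> l m n w u v = jacobi_term1 1 Y u v l m n w - \<epsilon> *\<^sub>C jacobi_term2 1 Y u v l m n w
    - jacobi_term3 (mode V) 1 (\<lambda>v. v) 1 Y u v l m n w"

lemma clinear_minus: "clinear f \<Longrightarrow> clinear g \<Longrightarrow> clinear (\<lambda>x. f x - g x)"
  by (rule clinearI) (simp_all add: clinear_add clinear_scale complex_vector.scale_right_diff_distrib)

lemma jacobi_defect_linear_left: "clinear (\<lambda>u. jacobi_defect \<epsilon> l m n w u v)"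
  unfolding jacobi_defect_def jacobi_term1_eq jacobi_term2_eq jacobi_term3_eq
  by (intro clinear_minus clinear_scaled clinear_Sum_any_fun finite_term1 finite_term3 Y_linear_left
      clinear_compose'[OF Y_linear_left linear_left] clinear_compose'[OF Y_linear_right Y_linear_left])

lemma jacobi_defect_linear_right: "clinear (\<lambda>v. jacobi_defect \<epsilon> l m n w u v)"
  unfolding jacobi_defect_def jacobi_term1_eq jacobi_term2_eq jacobi_term3_eq
  by (intro clinear_minus clinear_scaled clinear_Sum_any_fun finite_term1 finite_term3 Y_linear_left
      clinear_compose'[OF Y_linear_left linear_right] clinear_compose'[OF Y_linear_right Y_linear_left])

lemma Sum_any_double_sum:
  fixes f :: "nat \<Rightarrow> nat \<Rightarrow> nat \<Rightarrow> 'm"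
  assumes "\<And>r r'. finite {i. f r r' i \<noteq> 0}"
  shows "Sum_any (\<lambda>i. \<Sum>r<K. \<Sum>r'<K. t r r' *\<^sub>C f r r' i)
    = (\<Sum>r<K. \<Sum>r'<K. t r r' *\<^sub>C Sum_any (f r r'))"
proof -
  have fin: "finite {i. t r r' *\<^sub>C f r r' i \<noteq> 0}" for r r'
    by (rule finite_subset[OF _ assms[of r r']]) auto
  have scale: "Sum_any (\<lambda>i. t r r' *\<^sub>C f r r' i) = t r r' *\<^sub>C Sum_any (f r r')" for r r'
    using clinear_Sum_any[OF clinear_scaled[where f = "\<lambda>x. x"] assms, of "t r r'" r r']
    by (simp add: clinearI)
  have "Sum_any (\<lambda>i. \<Sum>r<K. \<Sum>r'<K. t r r' *\<^sub>C f r r' i)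
      = (\<Sum>r<K. Sum_any (\<lambda>i. \<Sum>r'<K. t r r' *\<^sub>C f r r' i))"
    by (rule Sum_any_sum_swap(2), simp, rule Sum_any_sum_swap(1), simp, rule fin)
  also have "\<dots> = (\<Sum>r<K. \<Sum>r'<K. Sum_any (\<lambda>i. t r r' *\<^sub>C f r r' i))"
    by (intro sum.cong refl Sum_any_sum_swap(2), simp, rule fin)
  finally show ?thesis by (simp only: scale)
qed

lemma finite_slot_product:
  "finite {i. binexp (of_int l) i *\<^sub>C slot_mode U (A - int i) (slot_mode W (B + int i) w) \<noteq> 0}"
proof -
  obtain N where "\<forall>i\<ge>N. slot_mode W (B + 1 * int i) w = 0"
    using slot_mode_eventually_0[of 1 W B w] zero_less_one by blast
  then show ?thesis by (intro finite_eventually_0[of N]) simp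
qed

text \<open>\<open>slot_jacobi\<close> is applied to each pair of degrees r, r'. Scalars and mode
  indices of the result depend only on r + r' + d, so the terms can be collected by this total, and
  there \<open>exp_vir_mode_binomial_sum\<close> identifies them with the third term.\<close>

lemma Y_jacobi_homogeneous:
  assumes u: "u \<in> wsp V mu" and v: "v \<in> wsp V mv"
  shows "jacobi_term1 1 Y u v l m n w
      - ksign (weight_parity mu * weight_parity mv) *\<^sub>C jacobi_term2 1 Y u v l m n w
    = jacobi_term3 (mode V) 1 (\<lambda>v. v) 1 Y u v l m n w"
proof -
  define k where "k = CARD('k)"
  have k: "k > 0" by (simp add: k_def)
  define \<epsilon> where "\<epsilon> = ksign (weight_parity mu * weight_parity mv)"
  define eu where "eu r = exp_vir V a u r" for r
  define ev where "ev r = exp_vir V a v r" for r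
  obtain N0 where N0: "\<And>m. m < N0 \<Longrightarrow> wsp V m = {0}" using bounded_below by blast
  \<comment> \<open>From index K on, all doubled weights that occur lie below \<open>N0\<close>, so
    every sum stops before K. The part 2 |l| + 2 accounts for the weight wt u + wt v - l - d - 1 of
    a product.\<close>
  define K where "K = nat (\<bar>mu\<bar> + \<bar>mv\<bar> + 2 * \<bar>l\<bar> + \<bar>N0\<bar> + 2)"
  have K: "mu - N0 < 2 * int K" "mv - N0 < 2 * int K" "mu + mv - 2 * l - 2 - N0 < 2 * int K"
    by (simp_all add: K_def)
  have eu_wsp: "eu r \<in> wsp V (mu - 2 * int r)" for r unfolding eu_def by (rule exp_vir_wsp[OF u])
  have ev_wsp: "ev r \<in> wsp V (mv - 2 * int r)" for r unfolding ev_def by (rule exp_vir_wsp[OF v])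
  have eu0: "eu r = 0" if "r \<ge> K" for r
  proof -
    have "mu - 2 * int r < N0" using that K by linarith
    then show ?thesis using N0 eu_wsp[of r] by blast
  qed
  have ev0: "ev r = 0" if "r \<ge> K" for r
  proof -
    have "mv - 2 * int r < N0" using that K by linarith
    then show ?thesis using N0 ev_wsp[of r] by blast
  qed
  have euv0: "mode V (eu r) (l + int d) (ev r') = 0" if "r + r' + d \<ge> K" for r r' d
  proof -
    have "2 * int K \<le> 2 * int r + 2 * int r' + 2 * int d" using that by linarith
    then have "mu - 2 * int r + (mv - 2 * int r') - 2 * (l + int d) - 2 < N0"
      using K(3) unfolding distrib_left by linarith
    then show ?thesis using N0 wsp_mode[OF eu_wsp[of r] ev_wsp[of r'], of "l + int d"] by blast
  qed
  have wuv: "exp_vir V a (mode V u (l + int i) v) r \<in> wsp V (mu + mv - 2 * (l + int i) - 2 - 2 * int r)" for i r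
    by (rule exp_vir_wsp[OF wsp_mode[OF u v]])
  have uv0: "exp_vir V a (mode V u (l + int i) v) r = 0" if "i + r \<ge> K" for i r
  proof -
    have "2 * int K \<le> 2 * int i + 2 * int r" using that by linarith
    then have "mu + mv - 2 * (l + int i) - 2 - 2 * int r < N0"
      using K(3) unfolding distrib_left by linarith
    then show ?thesis using N0 wuv[of i r] by blast
  qed
  have uv0': "mode V u (l + int i) v = 0" if "i \<ge> K" for i
  proof -
    have "2 * int K \<le> 2 * int i" using that by linarith
    then have "mu + mv - 2 * (l + int i) - 2 < N0"
      using K(3) unfolding distrib_left by linarith
    then show ?thesis using N0 wsp_mode[OF u v, of "l + int i"] by blast
  qed

  define A where "A r = m + 1 - int k + half_shift mu - int k * int r" for r
  define B where "B r = n + 1 - int k + half_shift mv - int k * int r" for r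
  define su where "su r = s powi (mu - 2 * int r)" for r
  define sv where "sv r = s powi (mv - 2 * int r)" for r
  have Yu: "Y u (m + j) x = (\<Sum>r<K. su r *\<^sub>C slot_mode (eu r) (A r + j) x)" for j x
  proof -
    have "Y u (m + j) x = (\<Sum>r<K. s powi (mu - 2 * int r) *\<^sub>C
        slot_mode (exp_vir V a u r) (m + j + 1 - int CARD('k) + half_shift mu - int CARD('k) * int r) x)"
      by (rule Y_homogeneous[OF u]) (rule eu0[unfolded eu_def])
    moreover have "m + j + 1 - int CARD('k) + half_shift mu - int CARD('k) * int r = A r + j" for r
      by (simp add: A_def k_def)
    ultimately show ?thesis by (simp only: su_def eu_def)
  qed
  have Yv: "Y v (n + j) x = (\<Sum>r<K. sv r *\<^sub>C slot_mode (ev r) (B r + j) x)" for j x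
  proof -
    have "Y v (n + j) x = (\<Sum>r<K. s powi (mv - 2 * int r) *\<^sub>C
        slot_mode (exp_vir V a v r) (n + j + 1 - int CARD('k) + half_shift mv - int CARD('k) * int r) x)"
      by (rule Y_homogeneous[OF v]) (rule ev0[unfolded ev_def])
    moreover have "n + j + 1 - int CARD('k) + half_shift mv - int CARD('k) * int r = B r + j" for r
      by (simp add: B_def k_def)
    ultimately show ?thesis by (simp only: sv_def ev_def)
  qed

  define P where "P r r' = Sum_any (\<lambda>i. binexp (of_int l) i *\<^sub>C
      slot_mode (eu r) (A r + l - int i) (slot_mode (ev r') (B r' + int i) w))" for r r'
  define Q where "Q r r' = Sum_any (\<lambda>i. binexp (of_int l) i *\<^sub>C
      slot_mode (ev r') (B r' + l - int i) (slot_mode (eu r) (A r + int i) w))" for r r'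
  have T1: "jacobi_term1 1 Y u v l m n w = (\<Sum>r<K. \<Sum>r'<K. (su r * sv r') *\<^sub>C P r r')"
  proof -
    have "binexp (of_int l) i *\<^sub>C Y u (m + l - int i) (Y v (n + int i) w)
        = (\<Sum>r<K. \<Sum>r'<K. (su r * sv r') *\<^sub>C (binexp (of_int l) i *\<^sub>C
            slot_mode (eu r) (A r + l - int i) (slot_mode (ev r') (B r' + int i) w)))" for i
      using Yu[of "l - int i"]
      by (simp add: Yv add_diff_eq clinear_sum[OF slot_mode_linear_right] clinear_scale[OF slot_mode_linear_right]
          complex_vector.scale_sum_right scaleC_scaleC mult_ac)
    then show ?thesis
      unfolding jacobi_term1_eq P_def by (simp only: Sum_any_double_sum[OF finite_slot_product])
  qed
  have T2: "jacobi_term2 1 Y u v l m n w = (\<Sum>r<K. \<Sum>r'<K. (su r * sv r') *\<^sub>C ((- 1) powi l *\<^sub>C Q r r'))"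
  proof -
    have "binexp (of_int l) i *\<^sub>C Y v (n + l - int i) (Y u (m + int i) w)
        = (\<Sum>r'<K. \<Sum>r<K. (su r * sv r') *\<^sub>C (binexp (of_int l) i *\<^sub>C
            slot_mode (ev r') (B r' + l - int i) (slot_mode (eu r) (A r + int i) w)))" for i
      using Yv[of "l - int i"]
      by (simp add: Yu add_diff_eq clinear_sum[OF slot_mode_linear_right] clinear_scale[OF slot_mode_linear_right]
          complex_vector.scale_sum_right scaleC_scaleC mult_ac)
    then have "jacobi_term2 1 Y u v l m n w = (- 1) powi l *\<^sub>C (\<Sum>r'<K. \<Sum>r<K. (su r * sv r') *\<^sub>C Q r r')"
      unfolding jacobi_term2_eq Q_def by (simp only: Sum_any_double_sum[OF finite_slot_product])
    also have "(\<Sum>r'<K. \<Sum>r<K. (su r * sv r') *\<^sub>C Q r r') = (\<Sum>r<K. \<Sum>r'<K. (su r * sv r') *\<^sub>C Q r r')"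
      by (rule sum.swap)
    finally show ?thesis
      by (simp add: complex_vector.scale_sum_right scaleC_scaleC mult_ac)
  qed

  define \<kappa> where "\<kappa> r d = fps_nth (fps_pw (fps_covu k) (- of_int l - of_nat d - 1)
      * fps_binomial (of_int m + (of_nat k - 1) * (of_int mu / 2) - of_nat k * of_nat r)) d" for r d
  \<comment> \<open>The common power of s and, in \<open>N\<close>, the common mode index of all
    terms of total degree i. Since k = s^2, the factors 1/k and k^(-(l+d)) are powers of s as
    well.\<close>
  define S where "S i = s powi (mu + mv - 2 * (l + int i + 1))" for i
  define N where "N i = m + n + l + 2 - 2 * int k + half_shift mu + half_shift mv - int k * (l + int i)" for i
  define t where "t r r' d = (S (r + r' + d) * \<kappa> r d) *\<^sub>C
      slot_mode (mode V (eu r) (l + int d) (ev r')) (N (r + r' + d)) w" for r r' d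
  have PQ: "(su r * sv r') *\<^sub>C (P r r' - \<epsilon> *\<^sub>C ((- 1) powi l *\<^sub>C Q r r')) = (\<Sum>d<K. t r r' d)" for r r'
  proof -
    have eu: "eu r \<in> par V (weight_parity mu)" and ev: "ev r' \<in> par V (weight_parity mv)"
      by (simp_all add: eu_def ev_def exp_vir_par u v)
    have A: "of_int (A r) + of_nat k - 1 = of_int m + (of_nat k - 1) * (of_int mu / 2) - of_nat k * (of_nat r :: complex)"
      using of_int_half_shift[of mu] by (simp add: A_def k_def)
    have "P r r' - \<epsilon> *\<^sub>C ((- 1) powi l *\<^sub>C Q r r') = (1 / of_nat k) *\<^sub>C Sum_any (\<lambda>d. (of_nat k powi (- (l + int d)) * \<kappa> r d) *\<^sub>C
        slot_mode (mode V (eu r) (l + int d) (ev r')) (A r + B r' + l - int k * (l + int d)) w)"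
      using slot_jacobi[OF eu ev, of l "A r" "B r'" w]
      unfolding P_def Q_def \<epsilon>_def \<kappa>_def k_def[symmetric] A .
    also have "Sum_any (\<lambda>d. (of_nat k powi (- (l + int d)) * \<kappa> r d) *\<^sub>C
        slot_mode (mode V (eu r) (l + int d) (ev r')) (A r + B r' + l - int k * (l + int d)) w)
      = (\<Sum>d<K. (of_nat k powi (- (l + int d)) * \<kappa> r d) *\<^sub>C
        slot_mode (mode V (eu r) (l + int d) (ev r')) (A r + B r' + l - int k * (l + int d)) w)"
      by (rule Sum_any_lessThan) (simp add: euv0)
    finally have "(su r * sv r') *\<^sub>C (P r r' - \<epsilon> *\<^sub>C ((- 1) powi l *\<^sub>C Q r r'))
      = (\<Sum>d<K. (su r * sv r' * (1 / of_nat k) * of_nat k powi (- (l + int d)) * \<kappa> r d) *\<^sub>C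
        slot_mode (mode V (eu r) (l + int d) (ev r')) (A r + B r' + l - int k * (l + int d)) w)"
      by (simp only: complex_vector.scale_sum_right scaleC_scaleC mult.assoc)
    also have "\<dots> = (\<Sum>d<K. t r r' d)"
    proof (rule sum.cong[OF refl])
      fix d
      have k2: "(of_nat k :: complex) = s powi 2"
        using sqrt by (simp add: k_def)
      have k1: "1 / of_nat k = s powi (- 2)"
        unfolding k2 by (simp add: power_int_minus inverse_eq_divide)
      have "su r * sv r' * (1 / of_nat k) * of_nat k powi (- (l + int d)) = S (r + r' + d)"
        unfolding k1 unfolding k2 su_def sv_def S_def power_int_mult[symmetric]
          power_int_add[OF disjI1[OF s_nonzero], symmetric]
        by (rule arg_cong[of _ _ "\<lambda>e. s powi e"]) simp
      moreover have "A r + B r' + l - int k * (l + int d) = N (r + r' + d)"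
        by (simp add: A_def B_def N_def algebra_simps)
      ultimately show "(su r * sv r' * (1 / of_nat k) * of_nat k powi (- (l + int d)) * \<kappa> r d) *\<^sub>C
        slot_mode (mode V (eu r) (l + int d) (ev r')) (A r + B r' + l - int k * (l + int d)) w = t r r' d"
        by (simp only: t_def)
    qed
    finally show ?thesis .
  qed
  define t' where "t' i r = (S (i + r) * (of_int m gchoose i)) *\<^sub>C
      slot_mode (exp_vir V a (mode V u (l + int i) v) r) (N (i + r)) w" for i r
  have "jacobi_term1 1 Y u v l m n w - \<epsilon> *\<^sub>C jacobi_term2 1 Y u v l m n w
      = (\<Sum>r<K. \<Sum>r'<K. (su r * sv r') *\<^sub>C (P r r' - \<epsilon> *\<^sub>C ((- 1) powi l *\<^sub>C Q r r')))"
    unfolding T1 T2 by (simp add: complex_vector.scale_right_diff_distrib sum_subtractf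
        complex_vector.scale_sum_right scaleC_scaleC mult_ac)
  also have "\<dots> = (\<Sum>r<K. \<Sum>r'<K. \<Sum>d<K. t r r' d)"
    by (simp only: PQ)
  also have "\<dots> = (\<Sum>i<K. \<Sum>p\<le>i. \<Sum>d\<le>p. t (p - d) (i - p) d)"
    by (rule sum_lessThan_simplex) (simp add: t_def euv0)
  also have "\<dots> = (\<Sum>i<K. S i *\<^sub>C slot_mode (\<Sum>p\<le>i. \<Sum>d\<le>p. \<kappa> (p - d) d *\<^sub>C
      mode V (eu (p - d)) (l + int d) (ev (i - p))) (N i) w)"
    by (intro sum.cong refl) (simp add: t_def clinear_sum[OF slot_mode_linear_left]
        clinear_scale[OF slot_mode_linear_left] complex_vector.scale_sum_right scaleC_scaleC)
  also have "\<dots> = (\<Sum>i<K. S i *\<^sub>C slot_mode (\<Sum>j\<le>i. (of_int m gchoose j) *\<^sub>C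
      exp_vir V a (mode V u (l + int j) v) (i - j)) (N i) w)"
    unfolding exp_vir_mode_binomial_sum[OF k cov[folded k_def] u] \<kappa>_def eu_def ev_def ..
  also have "\<dots> = (\<Sum>i<K. \<Sum>j\<le>i. t' j (i - j))"
    by (intro sum.cong refl) (simp add: t'_def clinear_sum[OF slot_mode_linear_left]
        clinear_scale[OF slot_mode_linear_left] complex_vector.scale_sum_right scaleC_scaleC)
  also have "\<dots> = (\<Sum>(i, j) | i + j < K. t' i j)"
    by (rule sum.triangle_reindex[symmetric])
  also have "\<dots> = (\<Sum>(i, j)\<in>{..<K} \<times> {..<K}. t' i j)"
  proof (rule sum.mono_neutral_left)
    show "\<forall>x\<in>{..<K} \<times> {..<K} - {(i, j). i + j < K}. (case x of (i, j) \<Rightarrow> t' i j) = 0"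
    proof
      fix x assume "x \<in> {..<K} \<times> {..<K} - {(i, j). i + j < K}"
      then obtain i j where "x = (i, j)" "i + j \<ge> K" by fastforce
      then show "(case x of (i, j) \<Rightarrow> t' i j) = 0" by (simp add: t'_def uv0)
    qed
  qed auto
  also have "\<dots> = (\<Sum>i<K. \<Sum>r<K. t' i r)"
    by (rule sum.cartesian_product[symmetric])
  also have "\<dots> = (\<Sum>i<K. (of_int m gchoose i) *\<^sub>C Y (mode V u (l + int i) v) (m + n - int i) w)"
  proof (rule sum.cong[OF refl])
    fix i
    let ?mw = "mu + mv - 2 * (l + int i) - 2"
    \<comment> \<open>The product u_(l+i) v has weight wt u + wt v - (l + i + 1), so its shift of
      modes again leads to an index depending on i + r only.\<close>
    have hs: "half_shift ?mw = half_shift mu + half_shift mv - (int k - 1) * (l + int i + 1)"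
    proof -
      have "2 * half_shift ?mw = 2 * half_shift mu + 2 * half_shift mv - 2 * ((int k - 1) * (l + int i + 1))"
        unfolding half_shift by (simp add: k_def algebra_simps)
      then show ?thesis by linarith
    qed
    have "Y (mode V u (l + int i) v) (m + n - int i) w = (\<Sum>r<K. s powi (?mw - 2 * int r) *\<^sub>C
        slot_mode (exp_vir V a (mode V u (l + int i) v) r)
          (m + n - int i + 1 - int CARD('k) + half_shift ?mw - int CARD('k) * int r) w)"
      by (rule Y_homogeneous[OF wsp_mode[OF u v]]) (simp add: uv0)
    moreover have "s powi (?mw - 2 * int r) = S (i + r)" for r
      unfolding S_def by (rule arg_cong[of _ _ "\<lambda>e. s powi e"]) simp
    moreover have "m + n - int i + 1 - int CARD('k) + half_shift ?mw - int CARD('k) * int r = N (i + r)" for r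
      unfolding hs k_def[symmetric] N_def by (simp add: algebra_simps)
    ultimately have "Y (mode V u (l + int i) v) (m + n - int i) w
        = (\<Sum>r<K. S (i + r) *\<^sub>C slot_mode (exp_vir V a (mode V u (l + int i) v) r) (N (i + r)) w)"
      by (simp only:)
    then show "(\<Sum>r<K. t' i r) = (of_int m gchoose i) *\<^sub>C Y (mode V u (l + int i) v) (m + n - int i) w"
      by (simp add: t'_def complex_vector.scale_sum_right scaleC_scaleC mult.commute)
  qed
  also have "\<dots> = jacobi_term3 (mode V) 1 (\<lambda>v. v) 1 Y u v l m n w"
    unfolding jacobi_term3_eq
    by (rule Sum_any_lessThan[symmetric]) (simp add: uv0' clinear_0[OF Y_linear_left])
  finally show ?thesis unfolding \<epsilon>_def .
qed

lemma Y_jacobi: "jacobi_identity (par V) (mode V) 1 (\<lambda>v. v) 1 Y"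
  unfolding jacobi_identity_def
proof (intro allI ballI)
  fix p q u v l m n w assume u: "u \<in> par V p" and v: "v \<in> par V q"
  have "jacobi_defect (ksign (p * q)) l m n w u v = 0"
    using u
  proof (induction rule: par_induct)
    case (homogeneous mu u)
    show ?case
      using v
    proof (induction rule: par_induct)
      case (homogeneous mv v)
      then show ?case
        using Y_jacobi_homogeneous[OF \<open>u \<in> wsp V mu\<close> homogeneous(1), of l m n w] \<open>weight_parity mu = p\<close>
        by (simp add: jacobi_defect_def)
    qed (simp_all add: clinear_0[OF jacobi_defect_linear_right] clinear_add[OF jacobi_defect_linear_right])
  qed (simp_all add: clinear_0[OF jacobi_defect_linear_left] clinear_add[OF jacobi_defect_linear_left])
  then show "jacobi_term1 1 Y u v l m n w - ksign (p * q) *\<^sub>C jacobi_term2 1 Y u v l m n w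
    = jacobi_term3 (mode V) 1 (\<lambda>v. v) 1 Y u v l m n w"
    by (simp add: jacobi_defect_def)
qed

lemma Y_weak_module: "weak_module V Mg Y"
  unfolding weak_module_def
  by (rule weak_twisted_module.intro[OF tw.superspace Y_linear_left Y_linear_right Y_parity
        Y_truncation _ Y_jacobi]) (simp_all add: Y_vacuum)

end

theorem theorem6p3:
  fixes V :: "'v::complex_vector vosa_data"
    and Mg :: "bit \<Rightarrow> 'm::complex_vector set"
    and Yg :: "('v, 'k::finite) tensor_power \<Rightarrow> int \<Rightarrow> 'm \<Rightarrow> 'm"
    and c \<eta> s :: complex
    and a :: "nat \<Rightarrow> complex"
  assumes "vertex_operator_superalgebra V c"
    and "odd CARD('k)"
    and "primitive_root \<eta> CARD('k)"
    and "weak_twisted_module (tensor_vosa V) CARD('k) (tensor_cycle V) \<eta> Mg Yg"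
    and "change_of_variable CARD('k) a"
    and "s ^ 2 = of_nat CARD('k)"
  shows "(\<forall>u h w. odd h \<longrightarrow> untwisted_coeff V a s Yg u h w = 0) \<and>
    weak_module V Mg (untwisted_mode V a s Yg)"
proof -
  interpret untwisted_module V c \<eta> Mg Yg a s
    by (intro untwisted_module.intro twisted_tensor_module.intro untwisted_module_axioms.intro
        twisted_tensor_module_axioms.intro assms)
  show ?thesis using untwisted_coeff_odd Y_weak_module by blast
qed

end
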